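(* Let $g:\mathbb{R}\to\mathbb{R}$ be a bounded measurable function with compact support, and let $g_d$ be its signed decreasing rearrangement. Then $$\|\mathcal{H} g_d\|_{L^1(\mathbb{R})}\le 4\,\|\mathcal{H} g\|_{L^1(\mathbb{R})},$$ where $\mathcal{H}$ denotes the Hilbert transform.
   Context: The Hilbert transform of a bounded measurable compactly supported function $g$ on $\mathbb{R}$ is $(\mathcal{H}g)(\xi)=\frac1\pi\,\mathrm{p.v.}\!\int_{\mathbb{R}}\frac{g(t)}{t-\xi}\,dt$, with the principal value taken at $t=\xi$; it is defined for almost every $\xi$. The $L^1$-norms are with respect to Lebesgue measure on $\mathbb{R}$ and take values in $[0,+\infty]$. The signed distribution function of $g$ is $N_g(s)=\mathrm{meas}\{x: g(x)>s\}$ for $s>0$ and $N_g(s)=-\mathrm{meas}\{x: g(x)<s\}$ for $s<0$, where $\mathrm{meas}$ is Lebesgue measure (the value at $s=0$ is immaterial). The signed decreasing rearrangement of $g$ is $g_d=N_{N_g}$, i.e. the signed distribution function of the function $N_g$. Both $N_g$ and $g_d$ are again bounded with compact support. *)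

theory Defs
  imports "HOL-Analysis.Analysis"
begin

text \<open>
  The principal value is the limit of the integrals over \<open>\<bar>t - \<xi>\<bar> > \<epsilon>\<close> as \<open>\<epsilon>\<close> decreases to 0.
  Where that limit does not exist (a null set, for \<open>g\<close> bounded, measurable and compactly
  supported), \<^const>\<open>Lim\<close> yields an unspecified value, which does not affect the \<open>L\<^sup>1\<close>-norm below.
\<close>

definition hilbert_transform :: "(real \<Rightarrow> real) \<Rightarrow> real \<Rightarrow> real" where
  "hilbert_transform g \<xi> =
     1 / pi * Lim (at_right 0) (\<lambda>\<epsilon>. LINT t:{t. \<bar>t - \<xi>\<bar> > \<epsilon>}|lebesgue. g t / (t - \<xi>))"

definition L1_norm :: "(real \<Rightarrow> real) \<Rightarrow> ennreal" where
  "L1_norm f = (\<integral>\<^sup>+x. ennreal \<bar>f x\<bar> \<partial>lebesgue)"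

text \<open>
  For \<open>g\<close> of compact support, both level sets have finite measure, so the real-valued
  \<^const>\<open>measure\<close> agrees with \<^const>\<open>emeasure\<close> on them. The value at \<open>s = 0\<close> is immaterial;
  it is fixed to be 0.
\<close>

definition signed_distribution :: "(real \<Rightarrow> real) \<Rightarrow> real \<Rightarrow> real" where
  "signed_distribution g s =
     (if s > 0 then measure lebesgue {x. g x > s}
      else if s < 0 then - measure lebesgue {x. g x < s}
      else 0)"

definition signed_decreasing_rearrangement :: "(real \<Rightarrow> real) \<Rightarrow> real \<Rightarrow> real" where
  "signed_decreasing_rearrangement g = signed_distribution (signed_distribution g)"

end

theory Submission
  imports Defs "HOL-Computational_Algebra.Fundamental_Theorem_Algebra" "HOL-Real_Asymp.Real_Asymp"
begin

text \<open>
  Write \<open>h = \<H> g\<close> and \<open>N = N\<^sub>g\<close>. By the layer cake formula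
  \<open>\<pi> (\<H> N)(s) = u(s)\<close>, where \<open>u(s) = \<integral> ln \<bar>1 - g(x)/s\<bar> dx\<close>. If \<open>h\<close> is integrable, then \<open>g\<close> has
  integral 0, and \<open>1 - (g - i h)/s\<close> is the boundary value of a function \<open>W\<close> analytic in a half-plane
  with \<open>W - 1 = O(\<bar>z\<bar>\<^sup>-\<^sup>2)\<close>; Jensen's inequality gives \<open>\<integral> ln \<bar>W\<bar> \<ge> 0\<close>, that is,
  \<open>- u(s) \<le> \<integral> 1/2 ln (1 + h\<^sup>2/(s - g)\<^sup>2) dx\<close>. Integrating in \<open>s\<close>, the negative part of \<open>u\<close> has
  integral at most \<open>\<pi> \<integral> \<bar>h\<bar>\<close>. Since \<open>\<integral> u\<close> over \<open>[-R, R]\<close> is at most \<open>O(1/R)\<close>, the positive part has no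
  larger integral, whence \<open>\<parallel>\<H> N\<parallel> \<le> 2 \<parallel>\<H> g\<parallel>\<close>. Applying this to \<open>g\<close> and to \<open>N\<close> gives
  the constant 4.

  Jensen's inequality is applied to the harmonic extension at height \<open>a > 0\<close>, where it follows from the
  case of rational functions by discretising \<open>g\<close>, and then \<open>a\<close> tends to 0. That the extension of \<open>h\<close>
  is the Poisson integral of the principal values, whose existence almost everywhere is not assumed,
  is obtained from \<open>L\<^sup>2\<close> convergence and Lebesgue points.
\<close>

section \<open>Logarithmic integrals of rational functions\<close>

text \<open>Residues and Jensen's formula are replaced by one real computation: over
  \<open>[-R, R]\<close> the integral of \<open>ln |x - z|\<close> is
  \<open>2 R ln R - 2 R + pi |Im z| + o(1)\<close>. For equally many zeros and poles the divergent
  terms cancel and \<open>pi\<close> times a difference of sums of \<open>|Im z|\<close> remains,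
  which yields Jensen's inequality for rational \<open>W\<close>; for the zero
  \<open>c - i h\<close> against the real pole \<open>c\<close> it yields \<open>pi |h|\<close>, the
  bound for the negative part of \<open>u\<close>. The obstacle is that logarithms are unbounded
  below and that \<open>u\<close> is not known to be integrable, so the logarithmic inequalities
  pass to limits by Fatou's lemma only. They are therefore kept as inequalities between
  \<open>ennreal\<close> integrals of \<open>D - ln ...\<close> with an integrable majorant
  \<open>D\<close>, and the convention \<open>ln 0 = 0\<close> has to err on the favourable side. A
  positive height makes the kernel bounded, and vanishing mass makes its transform decay
  quadratically; together they provide the majorant.\<close>

text \<open>
  An antiderivative of \<open>ln \<bar>x - z\<bar>\<close>. For real \<open>z\<close> the last term, which then divides by \<open>Im z = 0\<close>, is 0.
\<close>
definition log_prim :: "complex \<Rightarrow> real \<Rightarrow> real" where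
  "log_prim z x = (x - Re z) * ln ((x - Re z)^2 + (Im z)^2) / 2 - (x - Re z)
     + Im z * arctan ((x - Re z) / Im z)"

lemma ln_cmod_real_diff: "complex_of_real x \<noteq> z \<Longrightarrow> ln (cmod (of_real x - z)) = ln ((x - Re z)^2 + (Im z)^2) / 2"
proof -
  assume ne: "complex_of_real x \<noteq> z"
  then have pos: "(x - Re z)^2 + (Im z)^2 > 0"
    by (metis Im_complex_of_real Re_complex_of_real complex_eqI eq_iff_diff_eq_0 sum_power2_gt_zero_iff)
  show ?thesis using pos by (simp add: cmod_def ln_sqrt)
qed

text \<open>For real \<open>z\<close> the term \<open>y * ln (y^2)\<close> tends to 0 at the
  singularity and also takes the value 0 there. Continuity at this point is what lets the
  fundamental theorem of calculus integrate across a real root.\<close>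

lemma continuous_on_log_prim: "continuous_on UNIV (log_prim z)"
proof (cases "Im z = 0")
  case False
  then have "(x - Re z)^2 + (Im z)^2 \<noteq> 0" for x
    by (simp add: sum_power2_eq_zero_iff)
  then show ?thesis using False unfolding log_prim_def by (intro continuous_intros) auto
next
  case True
  have "((\<lambda>y::real. y * ln (y^2) / 2) \<longlongrightarrow> 0) (at_right 0)" by real_asymp
  moreover have "((\<lambda>y::real. y * ln (y^2) / 2) \<longlongrightarrow> 0) (at_left 0)" by real_asymp
  ultimately have "((\<lambda>y::real. y * ln (y^2) / 2) \<longlongrightarrow> 0) (at 0)"
    by (simp add: filterlim_split_at)
  then have 0: "isCont (\<lambda>y::real. y * ln (y^2) / 2) 0" by (simp add: isCont_def)
  have "continuous_on (-{0}) (\<lambda>y::real. y * ln (y^2) / 2)"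
    by (intro continuous_intros) auto
  then have "isCont (\<lambda>y::real. y * ln (y^2) / 2) y" if "y \<noteq> 0" for y
    using that by (simp add: continuous_on_eq_continuous_at open_Compl)
  with 0 have "isCont (\<lambda>y::real. y * ln (y^2) / 2) y" for y
    by (cases "y = 0") auto
  then have c: "continuous_on UNIV (\<lambda>y::real. y * ln (y^2) / 2)"
    by (intro continuous_at_imp_continuous_on ballI)
  have "continuous_on UNIV (\<lambda>x. (\<lambda>y::real. y * ln (y^2) / 2) (x - Re z))"
    by (rule continuous_on_compose2[OF c]) (auto intro!: continuous_intros)
  then show ?thesis unfolding log_prim_def using True by (auto intro!: continuous_intros)
qed

lemma log_prim_has_integral:
  assumes "0 \<le> R"
  shows "((\<lambda>x. ln (cmod (of_real x - z))) has_integral (log_prim z R - log_prim z (-R))) {-R..R}"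
proof (rule fundamental_theorem_of_calculus_interior_strong[where S="{Re z}"])
  show "continuous_on {- R..R} (log_prim z)"
    using continuous_on_log_prim continuous_on_subset by blast
  fix x assume x: "x \<in> {- R<..<R} - {Re z}"
  then have xz: "complex_of_real x \<noteq> z" and ne: "x - Re z \<noteq> 0" by auto
  have pos: "(x - Re z)^2 + (Im z)^2 > 0" using ne by (simp add: sum_power2_gt_zero_iff)
  have "(log_prim z has_real_derivative ln ((x - Re z)^2 + (Im z)^2) / 2) (at x)"
  proof (cases "Im z = 0")
    case True
    then show ?thesis unfolding log_prim_def using ne
      by (auto intro!: derivative_eq_intros) (auto simp: power2_eq_square divide_simps)
  next
    case False
    have *: "Im z * (1 / Im z * inverse (1 + ((x - Re z) / Im z)^2)) = (Im z)^2 / ((x - Re z)^2 + (Im z)^2)"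
    proof -
      have "1 + ((x - Re z) / Im z)^2 = ((x - Re z)^2 + (Im z)^2) / (Im z)^2"
        using False by (simp add: field_simps)
      then have "inverse (1 + ((x - Re z) / Im z)^2) = (Im z)^2 / ((x - Re z)^2 + (Im z)^2)"
        by simp
      then show ?thesis using False by simp
    qed
    have 1: "((\<lambda>x. (x - Re z) * ln ((x - Re z)^2 + (Im z)^2) / 2 - (x - Re z)) has_real_derivative
       (ln ((x - Re z)^2 + (Im z)^2) + (x - Re z) * (2 * (x - Re z) / ((x - Re z)^2 + (Im z)^2))) / 2 - 1) (at x)"
      using pos by (auto intro!: derivative_eq_intros)
    have 2: "((\<lambda>x. Im z * arctan ((x - Re z) / Im z)) has_real_derivative
        Im z * (1 / Im z * inverse (1 + ((x - Re z) / Im z)^2))) (at x)"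
      using False by (auto intro!: derivative_eq_intros)
    have 3: "(ln ((x - Re z)^2 + (Im z)^2) + (x - Re z) * (2 * (x - Re z) / ((x - Re z)^2 + (Im z)^2))) / 2 - 1
       + (Im z)^2 / ((x - Re z)^2 + (Im z)^2) = ln ((x - Re z)^2 + (Im z)^2) / 2"
    proof -
      define d u L where "d = (x - Re z)^2 + (Im z)^2" and "u = x - Re z" and "L = ln d"
      have d: "d \<noteq> 0" "d - u^2 = (Im z)^2" using pos by (auto simp: d_def u_def)
      have "(L + u * (2 * u / d)) / 2 - 1 + (d - u^2) / d = L / 2"
      proof -
        have "(d - u^2) / d = 1 - u^2 / d" using d(1) by (simp add: diff_divide_distrib)
        moreover have "u * (2 * u / d) = 2 * (u^2 / d)" by (simp add: power2_eq_square)
        moreover have "(L + 2 * q) / 2 - 1 + (1 - q) = L / 2" for q by (simp add: add_divide_distrib)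
        ultimately show ?thesis by (simp only:)
      qed
      then show ?thesis unfolding d(2) unfolding L_def d_def u_def .
    qed
    show ?thesis using DERIV_add[OF 1 2] unfolding log_prim_def * 3 by simp
  qed
  then show "(log_prim z has_vector_derivative ln (cmod (complex_of_real x - z))) (at x)"
    by (simp only: has_real_derivative_iff_has_vector_derivative ln_cmod_real_diff[OF xz])
qed (use assms in auto)

text \<open>The divergent part \<open>2 * R * ln R - 2 * R\<close> does not depend on
  \<open>z\<close>, so it cancels between equally many zeros and poles; what is left is the total
  variation \<open>pi\<close> of the arctangent, times \<open>|Im z|\<close>.\<close>

lemma log_prim_asymp:
  "((\<lambda>R. log_prim z R - log_prim z (-R) - (2 * R * ln R - 2 * R)) \<longlongrightarrow> pi * \<bar>Im z\<bar>) at_top"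
proof -
  define a b where "a = Re z" and "b = Im z"
  have 1: "((\<lambda>R. (R - a) * ln ((R - a)^2 + b^2) / 2 - (R - a)
      - ((-R - a) * ln ((-R - a)^2 + b^2) / 2 - (-R - a)) - (2 * R * ln R - 2 * R)) \<longlongrightarrow> 0) at_top"
  proof (cases "b = 0")
    case True
    have "((\<lambda>R. (R - a) * ln ((R - a)^2) / 2 - (R - a)
      - ((-R - a) * ln ((-R - a)^2) / 2 - (-R - a)) - (2 * R * ln R - 2 * R)) \<longlongrightarrow> 0) at_top"
      by real_asymp
    then show ?thesis using True by simp
  next
    case False
    define c where "c = b^2"
    have "c > 0" using False by (simp add: c_def)
    then have "((\<lambda>R. (R - a) * ln ((R - a)^2 + c) / 2 - (R - a)
      - ((-R - a) * ln ((-R - a)^2 + c) / 2 - (-R - a)) - (2 * R * ln R - 2 * R)) \<longlongrightarrow> 0) at_top"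
      by real_asymp
    then show ?thesis by (simp add: c_def)
  qed
  have 2: "((\<lambda>R. c * arctan ((R - a) / c) - c * arctan ((-R - a) / c)) \<longlongrightarrow> pi * c) at_top" if "c > 0" for c
    using that by real_asymp
  have 3: "((\<lambda>R. b * arctan ((R - a) / b) - b * arctan ((-R - a) / b)) \<longlongrightarrow> pi * \<bar>b\<bar>) at_top"
  proof -
    consider "b = 0" | "b > 0" | "b < 0" by linarith
    then show ?thesis
    proof cases
      case 3
      have "x / - b = - (x / b)" for x by simp
      then have "- b * arctan (x / - b) = b * arctan (x / b)" for x
        by (simp only: arctan_minus minus_mult_minus)
      with 3 2[of "-b"] show ?thesis by (simp add: arctan_minus)
    qed (use 2[of b] in auto)
  qed
  show ?thesis using tendsto_add[OF 1 3] unfolding log_prim_def a_def b_def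
    by (simp add: algebra_simps)
qed

lemma log_mset_has_integral:
  fixes A :: "complex multiset"
  assumes "0 \<le> R"
  shows "((\<lambda>x. \<Sum>z\<in>#A. ln (cmod (of_real x - z))) has_integral (\<Sum>z\<in>#A. log_prim z R - log_prim z (-R))) {-R..R}"
  by (induction A) (auto intro!: has_integral_add log_prim_has_integral assms)

lemma log_mset_asymp:
  fixes A :: "complex multiset"
  shows "((\<lambda>R. (\<Sum>z\<in>#A. log_prim z R - log_prim z (-R)) - size A * (2 * R * ln R - 2 * R))
           \<longlongrightarrow> pi * (\<Sum>z\<in>#A. \<bar>Im z\<bar>)) at_top"
proof (induction A)
  case (add z A)
  from tendsto_add[OF log_prim_asymp[of z] add] show ?case
    by (simp add: algebra_simps)
qed simp

text \<open>Monotone convergence along growing intervals turns integrals computed from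
  antiderivatives into a nonnegative Lebesgue integral over the line.\<close>

lemma nn_integral_exhaustion_interval:
  fixes f :: "real \<Rightarrow> real"
  assumes [measurable]: "f \<in> borel_measurable borel" and nn: "\<And>x. 0 \<le> f x"
    and I: "\<And>R. 0 < R \<Longrightarrow> (f has_integral I R) {-R..R}" and lim: "(I \<longlongrightarrow> l) at_top"
  shows "(\<integral>\<^sup>+x. ennreal (f x) \<partial>lborel) = ennreal l"
proof -
  let ?F = "\<lambda>n x. ennreal (indicator {- real (Suc n)..real (Suc n)} x * f x)"
  have "(\<lambda>n. \<integral>\<^sup>+x. ?F n x \<partial>lborel) \<longlonglongrightarrow> (\<integral>\<^sup>+x. ennreal (f x) \<partial>lborel)"
  proof (rule nn_integral_LIMSEQ)
    show "incseq ?F"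
      using nn by (auto simp: incseq_def le_fun_def split: split_indicator intro!: ennreal_leI)
    fix x :: real
    have "eventually (\<lambda>n. ?F n x = ennreal (f x)) sequentially"
    proof -
      obtain k :: nat where "\<bar>x\<bar> \<le> k" using real_arch_simple by blast
      then show ?thesis
        by (intro eventually_sequentiallyI[of k]) (auto split: split_indicator)
    qed
    then show "(\<lambda>n. ?F n x) \<longlonglongrightarrow> ennreal (f x)" by (rule tendsto_eventually)
  qed measurable
  moreover have "(\<integral>\<^sup>+x. ?F n x \<partial>lborel) = ennreal (I (real (Suc n)))" for n
    using nn_integral_has_integral_lebesgue[OF nn I[of "real (Suc n)"]] by simp
  moreover have "(\<lambda>n. ennreal (I (real (Suc n)))) \<longlonglongrightarrow> ennreal l"
    by (intro tendsto_ennrealI filterlim_compose[OF lim] filterlim_compose[OF filterlim_real_sequentially filterlim_Suc])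
  ultimately show ?thesis using LIMSEQ_unique by auto
qed

text \<open>Vieta's formula for the two leading coefficients. The number and the sum of the zeros of
  \<open>W\<close> are all that is used about them later.\<close>

lemma prod_linear_mset_coeffs:
  fixes A :: "complex multiset"
  defines "P \<equiv> \<Prod>z\<in>#A. [:-z, 1:]"
  shows "degree P = size A" "coeff P (size A) = 1" "A \<noteq> {#} \<Longrightarrow> coeff P (size A - 1) = - (\<Sum>z\<in>#A. z)"
proof -
  have "degree P = size A \<and> coeff P (size A) = 1 \<and> (A \<noteq> {#} \<longrightarrow> coeff P (size A - 1) = - (\<Sum>z\<in>#A. z))"
    unfolding P_def
  proof (induction A)
    case (add z A)
    let ?P = "\<Prod>z\<in>#A. [:-z, 1:]"
    have c: "coeff ([:-z, 1:] * ?P) (Suc k) = coeff ?P k - z * coeff ?P (Suc k)" for k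
      by simp
    have "degree ([:-z, 1:] * ?P) = degree [:-z,1:] + degree ?P"
      using add by (intro degree_mult_eq) auto
    moreover have "coeff ([:-z, 1:] * ?P) (Suc (size A)) = 1"
      unfolding c using add by (simp add: coeff_eq_0)
    moreover have "coeff ([:-z, 1:] * ?P) (size A) = - (z + (\<Sum>z\<in>#A. z))"
    proof (cases "A = {#}")
      case False
      then obtain k where k: "size A = Suc k" by (metis size_eq_0_iff_empty not0_implies_Suc)
      then show ?thesis using add False by (simp only: k c) simp
    qed simp
    ultimately show ?case using add by simp
  qed auto
  then show "degree P = size A" "coeff P (size A) = 1" "A \<noteq> {#} \<Longrightarrow> coeff P (size A - 1) = - (\<Sum>z\<in>#A. z)"
    by auto
qed

lemma ln_norm_prod_mset:
  fixes A :: "complex multiset"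
  assumes "w \<notin># A"
  shows "ln (cmod (\<Prod>z\<in>#A. (w - z))) = (\<Sum>z\<in>#A. ln (cmod (w - z)))" "(\<Prod>z\<in>#A. (w - z)) \<noteq> 0"
proof -
  have "ln (cmod (\<Prod>z\<in>#A. (w - z))) = (\<Sum>z\<in>#A. ln (cmod (w - z))) \<and> (\<Prod>z\<in>#A. (w - z)) \<noteq> 0"
    using assms by (induction A) (auto simp: norm_mult ln_mult)
  then show "ln (cmod (\<Prod>z\<in>#A. (w - z))) = (\<Sum>z\<in>#A. ln (cmod (w - z)))" "(\<Prod>z\<in>#A. (w - z)) \<noteq> 0"
    by auto
qed

text \<open>
  The inequality \<open>\<integral> ln \<bar>W\<bar> \<ge> 0\<close>, stated with a majorant \<open>D\<close> so that both sides are
  integrals of nonnegative functions. The numerator and the denominator of \<open>W\<close> have the same sum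
  of roots, and all poles have imaginary part \<open>-a\<close>.
\<close>
lemma jensen_rational:
  fixes T :: "real set" and l D :: "real \<Rightarrow> real"
  defines "W \<equiv> \<lambda>a x. 1 - \<i> * (\<Sum>t\<in>T. of_real (l t) / (of_real x - Complex t (-a)))"
  assumes T: "finite T" and l: "(\<Sum>t\<in>T. l t) = 0" and a: "a > 0"
    and D: "integrable lborel D" and DW: "\<And>x. ln (cmod (W a x)) \<le> D x"
  shows "(\<integral>\<^sup>+x. ennreal (D x - ln (cmod (W a x))) \<partial>lborel) \<le> ennreal (LBINT x. D x)"
proof (cases "T = {}")
  case True
  then show ?thesis using D DW unfolding W_def by (subst nn_integral_eq_integral) auto
next
  case False
  define p where "p t = Complex t (-a)" for t
  define M where "M S = image_mset p (mset_set S)" for S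
  define PP where "PP S = (\<Prod>z\<in>#M S. [:-z, 1:])" for S
  \<comment> \<open>Numerator of \<open>W\<close> over the common denominator \<open>PP T\<close>;
    its roots exist by algebraic closedness but are not explicit.\<close>
  define Q where "Q = PP T - smult \<i> (\<Sum>t\<in>T. smult (of_real (l t)) (PP (T - {t})))"
  define n where "n = card T"
  have n: "n > 0" using T False by (simp add: n_def card_gt_0_iff)
  have sM: "size (M T) = n" "\<And>t. t \<in> T \<Longrightarrow> size (M (T - {t})) = n - 1"
    using T by (auto simp: M_def n_def)
  have MT: "M T \<noteq> {#}" using sM n by auto
  have cT: "coeff (PP T) n = 1" "coeff (PP T) (n - 1) = - (\<Sum>z\<in>#M T. z)" "degree (PP T) = n"
    using prod_linear_mset_coeffs[of "M T"] MT sM by (auto simp: PP_def)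
  have ct: "coeff (PP (T - {t})) (n - 1) = 1" "degree (PP (T - {t})) = n - 1" if "t \<in> T" for t
    using prod_linear_mset_coeffs[of "M (T - {t})"] sM(2)[OF that] by (auto simp: PP_def)
  have cQn: "coeff Q k = coeff (PP T) k" if "k \<ge> n" for k
  proof -
    have "coeff (PP (T - {t})) k = 0" if "t \<in> T" for t
      using ct(2)[OF that] \<open>k \<ge> n\<close> n by (intro coeff_eq_0) auto
    then show ?thesis by (simp add: Q_def coeff_sum)
  qed
  \<comment> \<open>Each partial product has degree \<open>n - 1\<close> and leading coefficient 1,
    so together they shift this coefficient by a multiple of the sum of \<open>l\<close>, which is
    0. This is why zeros and poles have equal sums.\<close>
  have "coeff Q (n - 1) = - (\<Sum>z\<in>#M T. z) - \<i> * (\<Sum>t\<in>T. of_real (l t))"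
    using ct cT by (simp add: Q_def coeff_sum)
  also have "(\<Sum>t\<in>T. complex_of_real (l t)) = 0" using l by (simp flip: of_real_sum)
  finally have cQ1: "coeff Q (n - 1) = - (\<Sum>z\<in>#M T. z)" by simp
  have dQ: "degree Q = n"
  proof (rule antisym)
    show "degree Q \<le> n"
      by (rule degree_le) (use cQn cT(3) coeff_eq_0 in \<open>auto\<close>)
    show "n \<le> degree Q" using cQn[of n] cT by (intro le_degree) auto
  qed
  have lQ: "lead_coeff Q = 1" using dQ cQn[of n] cT by auto
  then have "Q \<noteq> 0" by auto
  from alg_closed_imp_factorization[OF this] obtain A where
    A: "size A = n" "Q = (\<Prod>z\<in>#A. [:-z, 1:])" using dQ lQ by auto
  have "A \<noteq> {#}" using A n by auto
  from prod_linear_mset_coeffs(3)[OF this] have sumA: "(\<Sum>z\<in>#A. z) = (\<Sum>z\<in>#M T. z)"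
    using A cQ1 by simp
  have pol: "poly (\<Prod>z\<in>#B. [:-z, 1:]) w = (\<Prod>z\<in>#B. (w - z))" for B and w :: complex
    by (induction B) (auto simp: algebra_simps)
  have ne: "complex_of_real x \<noteq> p t" for x t
    using a by (auto simp: p_def complex_eq_iff)
  have W: "W a x = poly Q (of_real x) / poly (PP T) (of_real x)" for x
  proof -
    let ?x = "complex_of_real x"
    have PT: "poly (PP S) ?x = (\<Prod>t\<in>S. (?x - p t))" for S
      unfolding PP_def pol M_def by (simp add: image_mset.compositionality comp_def prod_unfold_prod_mset)
    have nz: "poly (PP T) ?x \<noteq> 0" unfolding PT using ne T by simp
    have "poly (PP (T - {t})) ?x / poly (PP T) ?x = 1 / (?x - p t)" if "t \<in> T" for t
      using that T ne unfolding PT by (subst prod.remove[of T t]) (auto simp: field_simps)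
    then have "of_real (l t) * poly (PP (T - {t})) ?x / poly (PP T) ?x = of_real (l t) / (?x - p t)" if "t \<in> T" for t
      using that by (metis times_divide_eq_right mult.right_neutral)
    then have "(\<Sum>t\<in>T. of_real (l t) * poly (PP (T - {t})) ?x) / poly (PP T) ?x = (\<Sum>t\<in>T. of_real (l t) / (?x - p t))"
      unfolding sum_divide_distrib by (intro sum.cong) auto
    moreover have "poly Q ?x / poly (PP T) ?x = 1 - \<i> * ((\<Sum>t\<in>T. of_real (l t) * poly (PP (T - {t})) ?x) / poly (PP T) ?x)"
      using nz by (simp add: Q_def poly_sum diff_divide_distrib)
    ultimately show ?thesis unfolding W_def p_def by simp
  qed
  have lnW: "ln (cmod (W a x)) = (\<Sum>z\<in>#A. ln (cmod (of_real x - z))) - (\<Sum>z\<in>#M T. ln (cmod (of_real x - z)))"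
    if "x \<notin> Re ` set_mset A" for x
  proof -
    have 1: "complex_of_real x \<notin># A" using that by force
    have 2: "complex_of_real x \<notin># M T" using ne T by (auto simp: M_def)
    show ?thesis unfolding W
      using ln_norm_prod_mset[OF 1] ln_norm_prod_mset[OF 2]
      by (simp add: A(2) PP_def pol norm_divide ln_div)
  qed
  define J where "J B R = (\<Sum>z\<in>#B. log_prim z R - log_prim z (-R))" for B R
  have Dint: "(D has_integral (LBINT x. indicator {-R..R} x *\<^sub>R D x)) {-R..R}" for R
  proof -
    have "integrable lborel (\<lambda>x. indicator {-R..R} x *\<^sub>R D x)"
      using D by (intro integrable_mult_indicator) auto
    from has_integral_integral_lborel[OF this]
    have "((\<lambda>x. if x \<in> {-R..R} then D x else 0) has_integral (LBINT x. indicator {-R..R} x *\<^sub>R D x)) UNIV"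
      by (rule has_integral_eq[rotated]) (auto split: split_indicator)
    then show ?thesis by (simp only: has_integral_restrict_UNIV)
  qed
  define I where "I R = (LBINT x. indicator {-R..R} x *\<^sub>R D x) - (J A R - J (M T) R)" for R
  have fI: "((\<lambda>x. D x - ln (cmod (W a x))) has_integral I R) {-R..R}" if "0 < R" for R
  proof -
    have "((\<lambda>x. D x - ((\<Sum>z\<in>#A. ln (cmod (of_real x - z))) - (\<Sum>z\<in>#M T. ln (cmod (of_real x - z))))) has_integral I R) {-R..R}"
      unfolding I_def J_def using that by (intro has_integral_diff Dint log_mset_has_integral) auto
    then show ?thesis
      by (rule has_integral_spike_finite[rotated 2, where S="Re ` set_mset A"]) (use lnW in auto)
  qed
  define l0 where "l0 = (\<Sum>z\<in>#A. \<bar>Im z\<bar>) - (\<Sum>z\<in>#M T. \<bar>Im z\<bar>)"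
  have "((\<lambda>R. J A R - J (M T) R) \<longlongrightarrow> pi * (\<Sum>z\<in>#A. \<bar>Im z\<bar>) - pi * (\<Sum>z\<in>#M T. \<bar>Im z\<bar>)) at_top"
    using tendsto_diff[OF log_mset_asymp[of A] log_mset_asymp[of "M T"]] A sM by (simp add: J_def)
  moreover have "((\<lambda>R. LBINT x. indicator {-R..R} x *\<^sub>R D x) \<longlongrightarrow> (LBINT x. D x)) at_top"
  proof (rule integral_dominated_convergence_at_top[where w="\<lambda>x. \<bar>D x\<bar>"])
    show "AE x in lborel. ((\<lambda>R. indicator {-R..R} x *\<^sub>R D x) \<longlongrightarrow> D x) at_top"
    proof (intro AE_I2 tendsto_eventually)
      fix x :: real
      show "eventually (\<lambda>R. indicator {-R..R} x *\<^sub>R D x = D x) at_top"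
        using eventually_ge_at_top[of "\<bar>x\<bar>"] by eventually_elim (auto split: split_indicator)
    qed
  qed (use D in \<open>auto split: split_indicator\<close>)
  ultimately have lim: "(I \<longlongrightarrow> (LBINT x. D x) - pi * l0) at_top"
    using tendsto_diff unfolding I_def l0_def right_diff_distrib by blast
  \<comment> \<open>The zeros may lie in both half-planes, so only the triangle inequality is
    available for them; the poles lie on one side and turn it into an equality. With equal sums of
    roots the sign of \<open>l0\<close> follows.\<close>
  have abs_sum: "\<bar>Im (\<Sum>z\<in>#B. z)\<bar> \<le> (\<Sum>z\<in>#B. \<bar>Im z\<bar>)" for B
    by (induction B) auto
  have "\<bar>Im (\<Sum>z\<in>#image_mset p B. z)\<bar> = size B * a \<and> (\<Sum>z\<in>#image_mset p B. \<bar>Im z\<bar>) = size B * a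
      \<and> Im (\<Sum>z\<in>#image_mset p B. z) \<le> 0" for B
    using a by (induction B) (auto simp: p_def algebra_simps)
  then have "(\<Sum>z\<in>#M T. \<bar>Im z\<bar>) = \<bar>Im (\<Sum>z\<in>#M T. z)\<bar>" unfolding M_def by metis
  then have l0: "l0 \<ge> 0" using abs_sum[of A] sumA by (simp add: l0_def)
  have "(\<lambda>x. D x - ln (cmod (W a x))) \<in> borel_measurable borel"
  proof -
    have [measurable]: "D \<in> borel_measurable borel" using borel_measurable_integrable[OF D] by simp
    have "(\<lambda>x. of_real (l t) / (complex_of_real x - Complex t (-a))) \<in> borel_measurable borel" for t
      by measurable
    then have [measurable]: "(\<lambda>x. \<Sum>t\<in>T. of_real (l t) / (complex_of_real x - Complex t (-a))) \<in> borel_measurable borel"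
      by (intro borel_measurable_sum) auto
    show ?thesis unfolding W_def by measurable
  qed
  from nn_integral_exhaustion_interval[OF this _ fI lim] DW
  have "(\<integral>\<^sup>+x. ennreal (D x - ln (cmod (W a x))) \<partial>lborel) = ennreal ((LBINT x. D x) - pi * l0)"
    by simp
  also have "\<dots> \<le> ennreal (LBINT x. D x)" using l0 by (intro ennreal_leI) simp
  finally show ?thesis .
qed

section \<open>Poisson averages at Lebesgue points\<close>

text \<open>The factor \<open>1/pi\<close> is left out, so the total mass is \<open>pi\<close>; this
  is the source of the factor \<open>pi\<close> in the limits below.\<close>

definition poisson :: "real \<Rightarrow> real \<Rightarrow> real" where
  "poisson a v = a / (a^2 + v^2)"

lemma borel_measurable_poisson [measurable]: "poisson a \<in> borel_measurable borel"
  unfolding poisson_def by measurable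

lemma poisson_nonneg: "a \<ge> 0 \<Longrightarrow> 0 \<le> poisson a v"
  by (simp add: poisson_def)

lemma poisson_minus [simp]: "poisson a (-v) = poisson a v"
  by (simp add: poisson_def)

lemma poisson_has_integral_interval:
  assumes "a > 0" "0 < R"
  shows "((\<lambda>t. poisson a (t - x)) has_integral (arctan ((R - x) / a) - arctan ((-R - x) / a))) {-R..R}"
proof (rule fundamental_theorem_of_calculus)
  fix t :: real
  have "((\<lambda>t. arctan ((t - x) / a)) has_real_derivative 1 / a * inverse (1 + ((t - x) / a)^2)) (at t within {-R..R})"
    using assms by (auto intro!: derivative_eq_intros)
  moreover have "1 / a * inverse (1 + ((t - x) / a)^2) = poisson a (t - x)"
  proof -
    have "1 + ((t - x) / a)^2 = (a^2 + (t - x)^2) / a^2" using assms by (simp add: add_divide_distrib power_divide)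
    then show ?thesis using assms by (simp add: poisson_def power2_eq_square)
  qed
  ultimately show "((\<lambda>t. arctan ((t - x) / a)) has_vector_derivative poisson a (t - x)) (at t within {-R..R})"
    by (simp add: has_real_derivative_iff_has_vector_derivative)
qed (use assms in auto)

lemma nn_integral_poisson:
  assumes "a > 0" shows "(\<integral>\<^sup>+t. ennreal (poisson a (t - x)) \<partial>lborel) = ennreal pi"
proof (rule nn_integral_exhaustion_interval)
  show "((\<lambda>R. arctan ((R - x) / a) - arctan ((-R - x) / a)) \<longlongrightarrow> pi) at_top"
    using assms by real_asymp
qed (use assms poisson_nonneg poisson_has_integral_interval in auto)

lemma has_bochner_integral_poisson:
  assumes "a > 0" shows "has_bochner_integral lborel (\<lambda>t. poisson a (t - x)) pi"
  by (rule has_bochner_integral_nn_integral) (use assms poisson_nonneg nn_integral_poisson in auto)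

lemma has_bochner_integral_Cauchy_density: "has_bochner_integral lborel (\<lambda>t::real. 1 / (1 + t^2)) pi"
  using has_bochner_integral_poisson[of 1 0] by (simp add: poisson_def)

text \<open>Two uses: \<open>d = a\<close> is admissible for every \<open>t\<close> and gives
  integrability against the weight; a fixed \<open>d\<close> with \<open>|t - x| >= d\<close> gives
  a tail linear in \<open>a\<close>. The constant comes from
  \<open>1 + t^2 <= 1 + 2 x^2 + 2 (t - x)^2\<close>.\<close>

lemma poisson_bound:
  assumes "d > 0" "a > 0" "d^2 \<le> a^2 + (t - x)^2"
  shows "poisson a (t - x) \<le> a * ((1 + 2 * x^2) / d^2 + 2) * (1 / (1 + t^2))"
proof -
  let ?w = "a^2 + (t - x)^2"
  have w: "?w > 0" using assms by (simp add: add_pos_nonneg)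
  have p: "1 + t^2 > 0" by (simp add: add_pos_nonneg)
  have "t^2 \<le> 2 * x^2 + 2 * (t - x)^2"
    using zero_le_power2[of "2 * x - t"] by (simp add: power2_eq_square algebra_simps)
  moreover have "1 + 2 * x^2 \<le> (1 + 2 * x^2) / d^2 * ?w"
    using assms mult_left_mono[OF assms(3), of "(1 + 2 * x^2) / d^2"] by simp
  moreover have "2 * (t - x)^2 \<le> 2 * ?w" by simp
  ultimately have "1 + t^2 \<le> ((1 + 2 * x^2) / d^2 + 2) * ?w"
    unfolding distrib_right by linarith
  then have "1 / ?w \<le> ((1 + 2 * x^2) / d^2 + 2) * (1 / (1 + t^2))"
    using w p by (simp add: field_simps)
  then show ?thesis using mult_left_mono[of _ _ a] assms(2) unfolding poisson_def
    by (metis (no_types, lifting) less_imp_le mult.assoc mult.right_neutral times_divide_eq_right)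
qed

section \<open>Lebesgue points of locally integrable functions\<close>

lemma right_density:
  fixes f :: "real \<Rightarrow> real"
  assumes "\<And>a b. f integrable_on {a..b}"
  obtains N where "negligible N"
    "\<And>x e. x \<notin> N \<Longrightarrow> 0 < e \<Longrightarrow> \<exists>d>0. \<forall>h. 0 < h \<and> h < d \<longrightarrow> \<bar>integral {x..x+h} f / h - f x\<bar> < e"
proof -
  obtain N where N: "negligible N" "\<And>x e. \<lbrakk>x \<notin> N; 0 < e\<rbrakk> \<Longrightarrow> \<exists>d>0. \<forall>h. 0 < h \<and> h < d \<longrightarrow>
       norm(integral (cbox x (x + h *\<^sub>R One)) f /\<^sub>R h ^ DIM(real) - f x) < e"
    using integrable_ccontinuous_explicit[of f] assms by (metis cbox_interval)
  show thesis
    by (rule that[OF N(1)]) (use N(2) in \<open>simp add: divide_inverse_commute\<close>)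
qed

lemma left_density:
  fixes f :: "real \<Rightarrow> real"
  assumes "\<And>a b. f integrable_on {a..b}"
  obtains N where "negligible N"
    "\<And>x e. x \<notin> N \<Longrightarrow> 0 < e \<Longrightarrow> \<exists>d>0. \<forall>h. 0 < h \<and> h < d \<longrightarrow> \<bar>integral {x-h..x} f / h - f x\<bar> < e"
proof -
  have "(\<lambda>x. f (-x)) integrable_on {a..b}" for a b
    using assms[of "-b" "-a"] Henstock_Kurzweil_Integration.integrable_reflect_real[where f=f and a="-b" and b="-a"] by simp
  from right_density[OF this] obtain N where N: "negligible N"
    "\<And>x e. x \<notin> N \<Longrightarrow> 0 < e \<Longrightarrow> \<exists>d>0. \<forall>h. 0 < h \<and> h < d \<longrightarrow> \<bar>integral {x..x+h} (\<lambda>x. f (-x)) / h - f (-x)\<bar> < e"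
    by blast
  show thesis
  proof (rule that[of "uminus ` N"])
    show "negligible (uminus ` N)"
      by (intro negligible_differentiable_image_negligible N) (auto intro!: derivative_intros differentiable_on_minus)
  next
    fix x e :: real assume "x \<notin> uminus ` N" "0 < e"
    then have "-x \<notin> N" by force
    have "integral {-x..-x+h} (\<lambda>x. f (-x)) = integral {x-h..x} f" for h
      using Henstock_Kurzweil_Integration.integral_reflect_real[where f=f and a="x - h" and b=x] by simp
    with N(2)[OF \<open>-x \<notin> N\<close> \<open>0 < e\<close>]
    show "\<exists>d>0. \<forall>h. 0 < h \<and> h < d \<longrightarrow> \<bar>integral {x-h..x} f / h - f x\<bar> < e" by simp
  qed
qed

text \<open>The differentiation theorem is applied to \<open>|f - q|\<close> for each rational
  \<open>q\<close>. Countably many null sets are discarded, and a rational close to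
  \<open>f x\<close> then stands in for \<open>f x\<close>, which varies with the point.\<close>

lemma AE_lebesgue_point:
  fixes f :: "real \<Rightarrow> real"
  assumes f: "\<And>a b. f absolutely_integrable_on {a..b}"
  shows "AE x in lborel. \<forall>e>0. \<exists>d>0. \<forall>r. 0 < r \<and> r < d \<longrightarrow>
    (\<integral>\<^sup>+t. ennreal \<bar>f t - f x\<bar> * indicator {x-r..x+r} t \<partial>lborel) \<le> ennreal (e * r)"
proof -
  have fq: "(\<lambda>t. \<bar>f t - q\<bar>) integrable_on {a..b}" for q a b
  proof -
    have "(\<lambda>t. f t - q) absolutely_integrable_on {a..b}"
      using f by (intro set_integral_diff) auto
    then show ?thesis by (simp add: absolutely_integrable_on_def)
  qed
  have "\<exists>N. negligible N \<and> (\<forall>x e. x \<notin> N \<longrightarrow> 0 < e \<longrightarrow> (\<exists>d>0. \<forall>h. 0 < h \<and> h < d \<longrightarrow>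
      \<bar>integral {x..x+h} (\<lambda>t. \<bar>f t - q\<bar>) / h - \<bar>f x - q\<bar>\<bar> < e \<and>
      \<bar>integral {x-h..x} (\<lambda>t. \<bar>f t - q\<bar>) / h - \<bar>f x - q\<bar>\<bar> < e))" for q
  proof -
    obtain N1 where N1: "negligible N1" "\<And>x e. x \<notin> N1 \<Longrightarrow> 0 < e \<Longrightarrow> \<exists>d>0. \<forall>h. 0 < h \<and> h < d \<longrightarrow>
      \<bar>integral {x..x+h} (\<lambda>t. \<bar>f t - q\<bar>) / h - \<bar>f x - q\<bar>\<bar> < e"
      using right_density[OF fq[of q]] by blast
    obtain N2 where N2: "negligible N2" "\<And>x e. x \<notin> N2 \<Longrightarrow> 0 < e \<Longrightarrow> \<exists>d>0. \<forall>h. 0 < h \<and> h < d \<longrightarrow>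
      \<bar>integral {x-h..x} (\<lambda>t. \<bar>f t - q\<bar>) / h - \<bar>f x - q\<bar>\<bar> < e"
      using left_density[OF fq[of q]] by blast
    show ?thesis
    proof (intro exI[of _ "N1 \<union> N2"] conjI allI impI)
      fix x e :: real assume x: "x \<notin> N1 \<union> N2" "0 < e"
      obtain d1 d2 where "d1 > 0" "\<forall>h. 0 < h \<and> h < d1 \<longrightarrow> \<bar>integral {x..x+h} (\<lambda>t. \<bar>f t - q\<bar>) / h - \<bar>f x - q\<bar>\<bar> < e"
        "d2 > 0" "\<forall>h. 0 < h \<and> h < d2 \<longrightarrow> \<bar>integral {x-h..x} (\<lambda>t. \<bar>f t - q\<bar>) / h - \<bar>f x - q\<bar>\<bar> < e"
        using N1(2)[of x e] N2(2)[of x e] x by auto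
      then show "\<exists>d>0. \<forall>h. 0 < h \<and> h < d \<longrightarrow>
         \<bar>integral {x..x+h} (\<lambda>t. \<bar>f t - q\<bar>) / h - \<bar>f x - q\<bar>\<bar> < e \<and>
         \<bar>integral {x-h..x} (\<lambda>t. \<bar>f t - q\<bar>) / h - \<bar>f x - q\<bar>\<bar> < e"
        by (intro exI[of _ "min d1 d2"]) auto
    qed (use N1 N2 in auto)
  qed
  then obtain N where N: "\<And>q. negligible (N q)" "\<And>q x e. x \<notin> N q \<Longrightarrow> 0 < e \<Longrightarrow> \<exists>d>0. \<forall>h. 0 < h \<and> h < d \<longrightarrow>
      \<bar>integral {x..x+h} (\<lambda>t. \<bar>f t - q\<bar>) / h - \<bar>f x - q\<bar>\<bar> < e \<and>
      \<bar>integral {x-h..x} (\<lambda>t. \<bar>f t - q\<bar>) / h - \<bar>f x - q\<bar>\<bar> < e"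
    by metis
  have "AE x in lebesgue. x \<notin> N q" for q
    using N(1)[of q] by (simp add: negligible_iff_null_sets AE_not_in)
  then have "AE x in lborel. x \<notin> N q" for q
    by (simp add: AE_completion_iff)
  then have "AE x in lborel. \<forall>q\<in>\<rat>. x \<notin> N q"
    by (intro AE_ball_countable') (auto simp: countable_rat)
  then show ?thesis
  proof eventually_elim
    case (elim x)
    show ?case
    proof (intro allI impI)
      fix e :: real assume e: "e > 0"
      \<comment> \<open>Each half interval has average at most \<open>e/8 + e/8\<close>, and
        replacing \<open>q\<close> by \<open>f x\<close> costs \<open>2 r * e/8\<close> more: in all
        \<open>3/4 * e * r\<close>.\<close>
      obtain q where q: "q \<in> \<rat>" "f x < q" "q < f x + e / 8"
        using Rats_dense_in_real[of "f x" "f x + e / 8"] e by auto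
      have "x \<notin> N q" using elim q by auto
      with e obtain d where d: "d > 0" "\<forall>h. 0 < h \<and> h < d \<longrightarrow>
         \<bar>integral {x..x+h} (\<lambda>t. \<bar>f t - q\<bar>) / h - \<bar>f x - q\<bar>\<bar> < e / 8 \<and>
         \<bar>integral {x-h..x} (\<lambda>t. \<bar>f t - q\<bar>) / h - \<bar>f x - q\<bar>\<bar> < e / 8"
        using N(2)[of x q "e / 8"] by auto
      show "\<exists>d>0. \<forall>r. 0 < r \<and> r < d \<longrightarrow>
        (\<integral>\<^sup>+t. ennreal \<bar>f t - f x\<bar> * indicator {x-r..x+r} t \<partial>lborel) \<le> ennreal (e * r)"
      proof (intro exI[of _ d] conjI allI impI d)
        fix r assume r: "0 < r \<and> r < d"
        have R: "integral {x..x+r} (\<lambda>t. \<bar>f t - q\<bar>) \<le> e / 4 * r"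
        proof -
          have "\<bar>integral {x..x+r} (\<lambda>t. \<bar>f t - q\<bar>) / r - \<bar>f x - q\<bar>\<bar> < e / 8" using d(2) r by blast
          then have "integral {x..x+r} (\<lambda>t. \<bar>f t - q\<bar>) / r \<le> e / 4" using q by linarith
          then show ?thesis using r by (simp add: pos_divide_le_eq)
        qed
        have L: "integral {x-r..x} (\<lambda>t. \<bar>f t - q\<bar>) \<le> e / 4 * r"
        proof -
          have "\<bar>integral {x-r..x} (\<lambda>t. \<bar>f t - q\<bar>) / r - \<bar>f x - q\<bar>\<bar> < e / 8" using d(2) r by blast
          then have "integral {x-r..x} (\<lambda>t. \<bar>f t - q\<bar>) / r \<le> e / 4" using q by linarith
          then show ?thesis using r by (simp add: pos_divide_le_eq)
        qed
        have eq: "integral {x-r..x} (\<lambda>t. \<bar>f t - q\<bar>) + integral {x..x+r} (\<lambda>t. \<bar>f t - q\<bar>) = integral {x-r..x+r} (\<lambda>t. \<bar>f t - q\<bar>)"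
          using r fq by (intro Henstock_Kurzweil_Integration.integral_combine) auto
        have "integral {x-r..x+r} (\<lambda>t. \<bar>f t - f x\<bar>) \<le> integral {x-r..x+r} (\<lambda>t. \<bar>f t - q\<bar> + e / 8)"
          using q by (intro integral_le fq integrable_add) auto
        also have "\<dots> = integral {x-r..x+r} (\<lambda>t. \<bar>f t - q\<bar>) + 2 * r * (e / 8)"
          using r by (subst integral_add) (auto intro: fq)
        also have "\<dots> \<le> e / 4 * r + e / 4 * r + 2 * r * (e / 8)" using L R eq by linarith
        also have "\<dots> \<le> e * r" using e r by (simp add: field_simps)
        finally have le: "integral {x-r..x+r} (\<lambda>t. \<bar>f t - f x\<bar>) \<le> e * r" .
        have "(\<integral>\<^sup>+t. ennreal \<bar>f t - f x\<bar> * indicator {x-r..x+r} t \<partial>lborel) = ennreal (integral {x-r..x+r} (\<lambda>t. \<bar>f t - f x\<bar>))"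
          by (intro nn_integral_has_integral_lebesgue' integrable_integral fq) auto
        then show "(\<integral>\<^sup>+t. ennreal \<bar>f t - f x\<bar> * indicator {x-r..x+r} t \<partial>lborel) \<le> ennreal (e * r)"
          using le by (simp add: ennreal_leI)
      qed
    qed
  qed
qed

section \<open>From averages over intervals to Poisson integrals\<close>

lemma nn_integral_inverse_cube:
  assumes "c > 0" "a \<ge> 0"
  shows "(\<integral>\<^sup>+r. ennreal (2 * a / r^3) * indicator {c..} r \<partial>lborel) = ennreal (a / c^2)"
proof -
  have "(\<integral>\<^sup>+r. ennreal (2 * a / r^3) * indicator {c..} r \<partial>lborel) = ennreal (0 - (- (a / c^2)))"
  proof (rule nn_integral_FTC_atLeast)
    fix r assume "c \<le> r"
    then show "DERIV (\<lambda>r. - (a / r^2)) r :> 2 * a / r^3"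
      using assms by (auto intro!: derivative_eq_intros simp: power2_eq_square power3_eq_cube divide_simps)
    show "0 \<le> 2 * a / r^3" using assms \<open>c \<le> r\<close> by simp
  next
    show "((\<lambda>r. - (a / r^2)) \<longlongrightarrow> 0) at_top" by real_asymp
  qed measurable
  then show ?thesis by simp
qed

lemma nn_integral_inverse_square:
  assumes "c > 0" "a \<ge> 0"
  shows "(\<integral>\<^sup>+r. ennreal (a / r^2) * indicator {c..} r \<partial>lborel) = ennreal (a / c)"
proof -
  have "(\<integral>\<^sup>+r. ennreal (a / r^2) * indicator {c..} r \<partial>lborel) = ennreal (0 - (- (a / c)))"
  proof (rule nn_integral_FTC_atLeast)
    fix r assume "c \<le> r"
    then show "DERIV (\<lambda>r. - (a / r)) r :> a / r^2"
      using assms by (auto intro!: derivative_eq_intros simp: power2_eq_square divide_simps)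
    show "0 \<le> a / r^2" using assms by simp
  next
    show "((\<lambda>r. - (a / r)) \<longlongrightarrow> 0) at_top" by real_asymp
  qed measurable
  then show ?thesis by simp
qed

text \<open>
  The kernel is at most \<open>a / (max a \<bar>t - x\<bar>)\<^sup>2 = \<integral> 2 a / r\<^sup>3 dr\<close> over \<open>r \<ge> max a \<bar>t - x\<bar>\<close>,
  a superposition of indicator functions of intervals centred at \<open>x\<close>.
\<close>
lemma poisson_average_le:
  fixes f :: "real \<Rightarrow> ennreal"
  assumes [measurable]: "f \<in> borel_measurable borel" and a: "a > 0" and d: "d > 0" and e: "e \<ge> 0"
    and avg: "\<And>r. 0 < r \<Longrightarrow> r \<le> d \<Longrightarrow> (\<integral>\<^sup>+t. f t * indicator {x-r..x+r} t \<partial>lborel) \<le> ennreal (e * r)"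
  shows "(\<integral>\<^sup>+t. ennreal (poisson a (t - x)) * f t * indicator {x-d..x+d} t \<partial>lborel) \<le> ennreal (2 * e)"
proof -
  \<comment> \<open>The radius is capped at \<open>d\<close>, beyond which \<open>avg\<close> says
    nothing. For \<open>t\<close> within \<open>d\<close> of \<open>x\<close> the cap is invisible:
    \<open>|t - x| <= min r d\<close> still means \<open>|t - x| <= r\<close>.\<close>
  let ?k = "\<lambda>t r. ennreal (2 * a / r^3) * indicator {a..} r * (f t * indicator {x - min r d..x + min r d} t)"
  have m[measurable]: "Measurable.pred (borel \<Otimes>\<^sub>M borel) (\<lambda>(t::real, r). t \<in> {x - min r d..x + min r d})"
    unfolding atLeastAtMost_iff by measurable
  have pw: "ennreal (poisson a (t - x)) * f t * indicator {x-d..x+d} t \<le> (\<integral>\<^sup>+r. ?k t r \<partial>lborel)" for t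
  proof (cases "t \<in> {x-d..x+d}")
    case True
    let ?c = "max a \<bar>t - x\<bar>"
    have c: "?c > 0" using a by auto
    have "poisson a (t - x) \<le> a / ?c^2"
    proof -
      have "?c^2 \<le> a^2 + (t - x)^2" by (auto simp: max_def)
      then show ?thesis unfolding poisson_def using a c by (intro divide_left_mono) (auto simp: add_pos_nonneg)
    qed
    then have "ennreal (poisson a (t - x)) \<le> (\<integral>\<^sup>+r. ennreal (2 * a / r^3) * indicator {?c..} r \<partial>lborel)"
      using nn_integral_inverse_cube[OF c, of a] a by (simp add: ennreal_leI)
    then have "ennreal (poisson a (t - x)) * f t \<le> (\<integral>\<^sup>+r. ennreal (2 * a / r^3) * indicator {?c..} r \<partial>lborel) * f t"
      by (rule mult_right_mono) simp
    also have "\<dots> = (\<integral>\<^sup>+r. ennreal (2 * a / r^3) * indicator {?c..} r * f t \<partial>lborel)"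
      by (rule nn_integral_multc[symmetric]) measurable
    also have "\<dots> = (\<integral>\<^sup>+r. ?k t r \<partial>lborel)"
      using True by (intro nn_integral_cong) (auto split: split_indicator)
    finally show ?thesis using True by simp
  qed simp
  have "(\<integral>\<^sup>+t. ennreal (poisson a (t - x)) * f t * indicator {x-d..x+d} t \<partial>lborel) \<le> (\<integral>\<^sup>+t. \<integral>\<^sup>+r. ?k t r \<partial>lborel \<partial>lborel)"
    by (intro nn_integral_mono pw)
  also have "\<dots> = (\<integral>\<^sup>+r. \<integral>\<^sup>+t. ?k t r \<partial>lborel \<partial>lborel)"
    by (rule lborel_pair.Fubini') measurable
  \<comment> \<open>Averages of size \<open>e * r\<close> against \<open>2 * a / r^3\<close> leave
    \<open>2 * a * e / r^2\<close>, whose integral over \<open>r >= a\<close> is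
    \<open>2 * e\<close>, with no trace of \<open>a\<close>.\<close>
  also have "\<dots> \<le> (\<integral>\<^sup>+r. ennreal (2 * a * e / r^2) * indicator {a..} r \<partial>lborel)"
  proof (rule nn_integral_mono)
    fix r :: real
    show "(\<integral>\<^sup>+t. ?k t r \<partial>lborel) \<le> ennreal (2 * a * e / r^2) * indicator {a..} r"
    proof (cases "a \<le> r")
      case True
      have "(\<integral>\<^sup>+t. ?k t r \<partial>lborel) = ennreal (2 * a / r^3) * indicator {a..} r * (\<integral>\<^sup>+t. f t * indicator {x - min r d..x + min r d} t \<partial>lborel)"
        by (rule nn_integral_cmult) measurable
      also have "\<dots> \<le> ennreal (2 * a / r^3) * ennreal (e * min r d)"
        using True a d avg[of "min r d"] by (simp add: mult_left_mono)
      also have "\<dots> \<le> ennreal (2 * a / r^3) * ennreal (e * r)"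
        using e by (intro mult_left_mono ennreal_leI) auto
      also have "\<dots> = ennreal (2 * a * e / r^2)"
        using True a e by (simp add: ennreal_mult[symmetric] power3_eq_cube power2_eq_square)
      finally show ?thesis using True by simp
    qed simp
  qed
  also have "\<dots> = ennreal (2 * e)"
    using nn_integral_inverse_square[OF a, of "2 * a * e"] a e by simp
  finally show ?thesis .
qed


lemma poisson_times_integrable:
  fixes f :: "real \<Rightarrow> real"
  assumes f: "integrable lborel (\<lambda>t. f t / (1 + t^2))" and [measurable]: "f \<in> borel_measurable borel" and a: "a > 0"
  shows "integrable lborel (\<lambda>t. poisson a (t - x) * f t)"
proof (rule Bochner_Integration.integrable_bound)
  show "integrable lborel (\<lambda>t. a * ((1 + 2 * x^2) / a^2 + 2) * (f t / (1 + t^2)))"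
    using f by (intro integrable_mult_right) auto
  show "AE t in lborel. norm (poisson a (t - x) * f t) \<le> norm (a * ((1 + 2 * x^2) / a^2 + 2) * (f t / (1 + t^2)))"
  proof (rule AE_I2)
    fix t :: real
    have "\<bar>poisson a (t - x)\<bar> * \<bar>f t\<bar> \<le> (a * ((1 + 2 * x^2) / a^2 + 2) * (1 / (1 + t^2))) * \<bar>f t\<bar>"
      using poisson_bound[of a a t x] poisson_nonneg[of a "t - x"] a by (intro mult_right_mono) auto
    also have "\<dots> = norm (a * ((1 + 2 * x^2) / a^2 + 2) * (f t / (1 + t^2)))"
      using a by (simp add: abs_mult)
    finally show "norm (poisson a (t - x) * f t) \<le> norm (a * ((1 + 2 * x^2) / a^2 + 2) * (f t / (1 + t^2)))"
      by (simp add: abs_mult)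
  qed
qed measurable

text \<open>Near \<open>x\<close> the Lebesgue point bound applies at every height; away from
  \<open>x\<close> the kernel is \<open>O(a)\<close> against the weight. The absolute deviation is
  recorded, and not only the limit of the Poisson integral, because it also controls the truncated
  principal value in \<open>truncation_diff_le\<close>.\<close>

lemma poisson_deviation_tendsto:
  fixes f :: "real \<Rightarrow> real"
  assumes f: "integrable lborel (\<lambda>t. f t / (1 + t^2))" and [measurable]: "f \<in> borel_measurable borel"
  shows "AE x in lborel. ((\<lambda>a. \<integral>\<^sup>+t. ennreal (poisson a (t - x) * \<bar>f t - f x\<bar>) \<partial>lborel) \<longlongrightarrow> 0) (at_right 0)"
proof -
  have "f absolutely_integrable_on {u..v}" for u v
  proof -
    have "integrable lborel (\<lambda>t. indicator {u..v} t *\<^sub>R f t)"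
    proof (rule Bochner_Integration.integrable_bound)
      let ?K = "1 + u^2 + v^2"
      show "integrable lborel (\<lambda>t. ?K * (f t / (1 + t^2)))" using f by (intro integrable_mult_right) auto
      show "AE t in lborel. norm (indicator {u..v} t *\<^sub>R f t) \<le> norm (?K * (f t / (1 + t^2)))"
      proof (rule AE_I2)
        fix t :: real
        have "1 + t^2 \<le> ?K" if "t \<in> {u..v}"
        proof (cases "t \<ge> 0")
          case True
          then have "t^2 \<le> v^2" using that by (intro power_mono) auto
          then show ?thesis using zero_le_power2[of u] by linarith
        next
          case False
          then have "(-t)^2 \<le> (-u)^2" using that by (intro power_mono) auto
          then have "t^2 \<le> u^2" by simp
          then show ?thesis using zero_le_power2[of v] by linarith
        qed
        moreover have "1 + t^2 > 0" by (simp add: add_pos_nonneg)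
        moreover have "?K > 0" by (simp add: add_pos_nonneg)
        ultimately have "\<bar>f t\<bar> * 1 \<le> \<bar>f t\<bar> * (?K / (1 + t^2))" if "t \<in> {u..v}"
          using that by (intro mult_left_mono) auto
        then show "norm (indicator {u..v} t *\<^sub>R f t) \<le> norm (?K * (f t / (1 + t^2)))"
          using \<open>?K > 0\<close> \<open>1 + t^2 > 0\<close> by (auto simp: abs_mult field_simps split: split_indicator)
      qed
    qed measurable
    then show ?thesis unfolding set_integrable_def by (rule integrable_completion[THEN iffD2, rotated]) measurable
  qed
  from AE_lebesgue_point[OF this] show ?thesis
  proof eventually_elim
    case (elim x)
    define g where "g t = \<bar>f t - f x\<bar>" for t
    have [measurable]: "g \<in> borel_measurable borel" unfolding g_def by measurable
    define w where "w t = g t / (1 + t^2)" for t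
    have "integrable lborel (\<lambda>t. \<bar>f t / (1 + t^2) - f x * (1 / (1 + t^2))\<bar>)"
      using f has_bochner_integral_Cauchy_density[THEN integrable.intros]
      by (intro integrable_abs Bochner_Integration.integrable_diff integrable_mult_right) auto
    also have "(\<lambda>t. \<bar>f t / (1 + t^2) - f x * (1 / (1 + t^2))\<bar>) = w"
    proof
      fix t :: real
      have "1 + t^2 > 0" by (simp add: add_pos_nonneg)
      then show "\<bar>f t / (1 + t^2) - f x * (1 / (1 + t^2))\<bar> = w t"
        by (simp add: w_def g_def diff_divide_distrib[symmetric])
    qed
    finally have w: "integrable lborel w" .
    have [measurable]: "w \<in> borel_measurable borel" unfolding w_def by measurable
    have w0: "w t \<ge> 0" for t by (simp add: w_def g_def)
    define C where "C = (LBINT t. w t)"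
    have C: "(\<integral>\<^sup>+t. ennreal (w t) \<partial>lborel) = ennreal C" "C \<ge> 0"
      using w w0 by (simp_all add: C_def nn_integral_eq_integral)
    show ?case unfolding g_def[symmetric]
    proof (rule order_tendstoI)
      fix y :: ennreal assume "0 < y"
      then obtain z where z: "0 < z" "z < y" using dense by blast
      then have "z < top" using less_trans top.not_eq_extremum by fastforce
      define e where "e = enn2real z"
      have "ennreal e = z" using \<open>z < top\<close> by (simp add: e_def)
      then have e: "e > 0" "ennreal e < y" using z by (auto simp: e_def enn2real_positive_iff \<open>z < top\<close>)
      obtain d where d: "d > 0" "\<And>r. 0 < r \<and> r < d \<Longrightarrow>
         (\<integral>\<^sup>+t. ennreal (g t) * indicator {x-r..x+r} t \<partial>lborel) \<le> ennreal (e / 4 * r)"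
        using elim[rule_format, of "e / 4"] e unfolding g_def by auto
      \<comment> \<open>The split is at \<open>d / 2\<close>, since averages are controlled only for
        \<open>r < d\<close>. The near part contributes \<open>2 * (e / 4)\<close> and the far part
        \<open>a * K * C\<close>, each at most \<open>e / 2\<close>.\<close>
      define K where "K = (1 + 2 * x^2) / (d / 2)^2 + 2"
      have K: "K > 0" using d by (auto simp: K_def intro!: add_nonneg_pos)
      have "(\<integral>\<^sup>+t. ennreal (poisson a (t - x) * g t) \<partial>lborel) < y" if a: "0 < a" "a * (K * C) < e / 2" for a
      proof -
        have "(\<integral>\<^sup>+t. ennreal (poisson a (t - x) * g t) \<partial>lborel) \<le>
          (\<integral>\<^sup>+t. ennreal (poisson a (t - x)) * ennreal (g t) * indicator {x-d/2..x+d/2} t + ennreal (a * K) * ennreal (w t) \<partial>lborel)"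
        proof (rule nn_integral_mono)
          fix t :: real
          have g0: "g t \<ge> 0" by (simp add: g_def)
          show "ennreal (poisson a (t - x) * g t) \<le> ennreal (poisson a (t - x)) * ennreal (g t) * indicator {x-d/2..x+d/2} t + ennreal (a * K) * ennreal (w t)"
          proof (cases "t \<in> {x-d/2..x+d/2}")
            case True
            then show ?thesis using poisson_nonneg[of a] a g0 by (simp add: ennreal_mult)
          next
            case False
            then have "\<bar>d/2\<bar> \<le> \<bar>t - x\<bar>" using d by auto
            then have "(d/2)^2 \<le> (t - x)^2" by (simp only: abs_le_square_iff)
            then have "(d/2)^2 \<le> a^2 + (t - x)^2" by (simp add: add_increasing)
            from poisson_bound[OF _ a(1) this] d have "poisson a (t - x) \<le> a * K * (1 / (1 + t^2))" by (simp add: K_def)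
            then have "poisson a (t - x) * g t \<le> a * K * (1 / (1 + t^2)) * g t" by (rule mult_right_mono[OF _ g0])
            then have "poisson a (t - x) * g t \<le> a * K * w t" by (simp add: w_def)
            then show ?thesis using False a K w0 by (simp add: ennreal_mult[symmetric] ennreal_leI)
          qed
        qed
        also have "\<dots> = (\<integral>\<^sup>+t. ennreal (poisson a (t - x)) * ennreal (g t) * indicator {x-d/2..x+d/2} t \<partial>lborel)
           + (\<integral>\<^sup>+t. ennreal (a * K) * ennreal (w t) \<partial>lborel)"
          by (intro nn_integral_add) measurable
        also have "(\<integral>\<^sup>+t. ennreal (a * K) * ennreal (w t) \<partial>lborel) = ennreal (a * K * C)"
          using C a K by (simp add: nn_integral_cmult ennreal_mult)
        also have "(\<integral>\<^sup>+t. ennreal (poisson a (t - x)) * ennreal (g t) * indicator {x-d/2..x+d/2} t \<partial>lborel) \<le> ennreal (2 * (e / 4))"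
          using a d e by (intro poisson_average_le d(2)) auto
        also have "ennreal (2 * (e / 4)) + ennreal (a * K * C) = ennreal (2 * (e / 4) + a * K * C)"
          using e a K C by (intro ennreal_plus[symmetric]) auto
        also have "\<dots> \<le> ennreal e" using a by (intro ennreal_leI) (simp add: mult.assoc)
        finally show ?thesis using e by (auto intro: le_less_trans add_mono)
      qed
      moreover have "eventually (\<lambda>a. 0 < a \<and> a * (K * C) < e / 2) (at_right 0)"
      proof (intro eventually_conj eventually_at_right_less)
        have "((\<lambda>a. a * (K * C)) \<longlongrightarrow> 0 * (K * C)) (at_right 0)" by (intro tendsto_intros)
        from order_tendstoD(2)[OF this, of "e / 2"] e show "eventually (\<lambda>a. a * (K * C) < e / 2) (at_right 0)" by simp
      qed
      ultimately show "eventually (\<lambda>a. (\<integral>\<^sup>+t. ennreal (poisson a (t - x) * g t) \<partial>lborel) < y) (at_right 0)"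
        by (auto elim: eventually_mono)
    qed auto
  qed
qed

lemma poisson_tendsto_of_deviation:
  fixes f :: "real \<Rightarrow> real"
  assumes f: "integrable lborel (\<lambda>t. f t / (1 + t^2))" and [measurable]: "f \<in> borel_measurable borel"
    and dev: "((\<lambda>a. \<integral>\<^sup>+t. ennreal (poisson a (t - x) * \<bar>f t - f x\<bar>) \<partial>lborel) \<longlongrightarrow> 0) (at_right 0)"
  shows "((\<lambda>a. LBINT t. poisson a (t - x) * f t) \<longlongrightarrow> pi * f x) (at_right 0)"
proof -
  have bd: "ennreal \<bar>(LBINT t. poisson a (t - x) * f t) - pi * f x\<bar> \<le> (\<integral>\<^sup>+t. ennreal (poisson a (t - x) * \<bar>f t - f x\<bar>) \<partial>lborel)"
    if a: "a > 0" for a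
  proof -
    note P = has_bochner_integral_poisson[OF a, of x]
    note i1 = poisson_times_integrable[OF f assms(2) a, of x]
    have i2: "integrable lborel (\<lambda>t. poisson a (t - x) * f x)" using integrable.intros[OF P] by simp
    have "(LBINT t. poisson a (t - x) * (f t - f x)) = (LBINT t. poisson a (t - x) * f t) - pi * f x"
      unfolding right_diff_distrib using i1 i2 has_bochner_integral_integral_eq[OF P] by simp
    moreover have "ennreal \<bar>LBINT t. poisson a (t - x) * (f t - f x)\<bar> \<le> (\<integral>\<^sup>+t. ennreal (norm (poisson a (t - x) * (f t - f x))) \<partial>lborel)"
      using integral_norm_bound_ennreal[of lborel "\<lambda>t. poisson a (t - x) * (f t - f x)"] i1 i2
      by (simp add: right_diff_distrib)
    moreover have "norm (poisson a (t - x) * (f t - f x)) = poisson a (t - x) * \<bar>f t - f x\<bar>" for t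
      using poisson_nonneg[of a] a by (simp add: abs_mult)
    ultimately show ?thesis by simp
  qed
  have "((\<lambda>a. ennreal \<bar>(LBINT t. poisson a (t - x) * f t) - pi * f x\<bar>) \<longlongrightarrow> 0) (at_right 0)"
    using eventually_at_right_less[of 0]
    by (intro tendsto_sandwich[OF _ _ tendsto_const dev]) (auto elim!: eventually_mono intro: bd)
  then have "((\<lambda>a. \<bar>(LBINT t. poisson a (t - x) * f t) - pi * f x\<bar>) \<longlongrightarrow> 0) (at_right 0)"
    by (simp add: ennreal_0[symmetric] tendsto_ennreal_iff del: ennreal_0)
  then show ?thesis using tendsto_rabs_zero_iff LIM_zero_iff by blast
qed

section \<open>Cauchy transforms\<close>

lemma lebesgue_integral_exhaustion_interval:
  fixes f :: "real \<Rightarrow> 'a::euclidean_space"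
  assumes f: "integrable lborel f" and I: "\<And>R. 0 < R \<Longrightarrow> (f has_integral I R) {-R..R}" and lim: "(I \<longlongrightarrow> l) at_top"
  shows "(LBINT x. f x) = l"
proof (rule tendsto_unique[OF _ _ lim])
  have "((\<lambda>R. LBINT x. indicator {-R..R} x *\<^sub>R f x) \<longlongrightarrow> (LBINT x. f x)) at_top"
  proof (rule integral_dominated_convergence_at_top[where w="\<lambda>x. norm (f x)"])
    show "AE x in lborel. ((\<lambda>R. indicator {-R..R} x *\<^sub>R f x) \<longlongrightarrow> f x) at_top"
    proof (intro AE_I2 tendsto_eventually)
      fix x :: real
      show "eventually (\<lambda>R. indicator {-R..R} x *\<^sub>R f x = f x) at_top"
        using eventually_ge_at_top[of "\<bar>x\<bar>"] by eventually_elim (auto split: split_indicator)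
    qed
  qed (use f in \<open>auto split: split_indicator\<close>)
  moreover have "(LBINT x. indicator {-R..R} x *\<^sub>R f x) = I R" if "0 < R" for R
  proof -
    have "set_integrable lborel {-R..R} f"
      unfolding set_integrable_def using f by (intro integrable_mult_indicator) auto
    from set_borel_integral_eq_integral(2)[OF this] I[OF that] show ?thesis
      by (simp add: set_lebesgue_integral_def integral_unique)
  qed
  then have "eventually (\<lambda>R. (LBINT x. indicator {-R..R} x *\<^sub>R f x) = I R) at_top"
    by (rule eventually_mono[OF eventually_gt_at_top])
  ultimately show "(I \<longlongrightarrow> (LBINT x. f x)) at_top"
    using Lim_transform_eventually by blast
qed simp

text \<open>Half the logarithm of the squared modulus together with an arctangent is an
  antiderivative on the whole line, with no branch of the complex logarithm to choose.\<close>

lemma resolvent_has_integral: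
  fixes p :: complex
  assumes "Im p \<noteq> 0" "0 \<le> R"
  shows "((\<lambda>x. 1 / (of_real x - p)) has_integral
    (Complex (ln ((R - Re p)^2 + (Im p)^2) / 2 - ln ((-R - Re p)^2 + (Im p)^2) / 2)
       (arctan ((R - Re p) / Im p) - arctan ((-R - Re p) / Im p)))) {-R..R}"
proof -
  define u b where "u x = x - Re p" and "b = Im p" for x
  have b: "b \<noteq> 0" using assms by (simp add: b_def)
  have w: "(u x)^2 + b^2 > 0" for x using b by (simp add: sum_power2_gt_zero_iff)
  let ?F = "\<lambda>x. complex_of_real (ln ((u x)^2 + b^2) / 2) + \<i> * of_real (arctan (u x / b))"
  have "((\<lambda>x. 1 / (complex_of_real x - p)) has_integral ?F R - ?F (-R)) {-R..R}"
  proof (rule fundamental_theorem_of_calculus)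
    fix x
    have e: "1 / (complex_of_real x - p) = of_real (u x / ((u x)^2 + b^2)) + \<i> * of_real (b / ((u x)^2 + b^2))"
    proof -
      have "complex_of_real x - p = Complex (u x) (-b)" by (simp add: u_def b_def complex_eq_iff)
      then show ?thesis using w[of x]
        by (simp add: complex_eq_iff Re_divide Im_divide power2_eq_square)
    qed
    have 1: "((\<lambda>x. ln ((u x)^2 + b^2) / 2) has_vector_derivative u x / ((u x)^2 + b^2)) (at x within {-R..R})"
    proof -
      have "((\<lambda>x. (u x)^2 + b^2) has_real_derivative 2 * u x) (at x within {-R..R})"
        unfolding u_def by (auto intro!: derivative_eq_intros)
      from DERIV_cdivide[OF DERIV_chain2[OF DERIV_ln_divide[OF w[of x]] this], of 2]
      have "((\<lambda>x. ln ((u x)^2 + b^2) / 2) has_real_derivative (1 / ((u x)^2 + b^2) * (2 * u x)) / 2) (at x within {-R..R})" .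
      moreover have "(1 / W * (2 * U)) / 2 = U / W" for U W :: real by simp
      ultimately show ?thesis by (simp only: has_real_derivative_iff_has_vector_derivative)
    qed
    have "1 / b * inverse (1 + (u x / b)^2) = b / ((u x)^2 + b^2)"
    proof -
      have "1 + (u x / b)^2 = ((u x)^2 + b^2) / b^2" using b by (simp add: add_divide_distrib power_divide)
      then show ?thesis using b by (simp add: power2_eq_square)
    qed
    moreover have "((\<lambda>x. arctan (u x / b)) has_real_derivative 1 / b * inverse (1 + (u x / b)^2)) (at x within {-R..R})"
      unfolding u_def using b by (auto intro!: derivative_eq_intros)
    ultimately have 2: "((\<lambda>x. arctan (u x / b)) has_vector_derivative b / ((u x)^2 + b^2)) (at x within {-R..R})"
      unfolding has_real_derivative_iff_has_vector_derivative[symmetric] by simp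
    show "(?F has_vector_derivative 1 / (complex_of_real x - p)) (at x within {-R..R})"
      unfolding e by (intro has_vector_derivative_add has_vector_derivative_mult_right has_vector_derivative_of_real
          1[folded has_real_derivative_iff_has_vector_derivative] 2[folded has_real_derivative_iff_has_vector_derivative])
  qed (use assms in auto)
  also have "?F R - ?F (-R) = Complex (ln ((R - Re p)^2 + (Im p)^2) / 2 - ln ((-R - Re p)^2 + (Im p)^2) / 2)
       (arctan ((R - Re p) / Im p) - arctan ((-R - Re p) / Im p))"
    by (simp add: complex_eq_iff u_def b_def)
  finally show ?thesis .
qed

lemma resolvent_asymp:
  fixes p :: complex
  assumes "Im p \<noteq> 0"
  shows "((\<lambda>R. Complex (ln ((R - Re p)^2 + (Im p)^2) / 2 - ln ((-R - Re p)^2 + (Im p)^2) / 2)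
       (arctan ((R - Re p) / Im p) - arctan ((-R - Re p) / Im p))) \<longlongrightarrow> \<i> * (pi * sgn (Im p))) at_top"
proof -
  define a b c where "a = Re p" and "b = Im p" and "c = (Im p)^2"
  have "c > 0" using assms by (simp add: c_def)
  then have 1: "((\<lambda>R. ln ((R - a)^2 + c) / 2 - ln ((-R - a)^2 + c) / 2) \<longlongrightarrow> 0) at_top"
    by real_asymp
  have 2: "((\<lambda>R. arctan ((R - a) / b) - arctan ((-R - a) / b)) \<longlongrightarrow> pi * sgn b) at_top"
  proof (cases "b > 0")
    case True
    then have "((\<lambda>R. arctan ((R - a) / b) - arctan ((-R - a) / b)) \<longlongrightarrow> pi) at_top" by real_asymp
    then show ?thesis using True by simp
  next
    case False
    then have b: "b < 0" using assms by (simp add: b_def)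
    then have "((\<lambda>R. arctan ((R - a) / b) - arctan ((-R - a) / b)) \<longlongrightarrow> -pi) at_top" by real_asymp
    then show ?thesis using b by simp
  qed
  have "\<i> * (pi * sgn (Im p)) = Complex 0 (pi * sgn b)" by (simp add: b_def complex_eq_iff)
  then show ?thesis using tendsto_Complex[OF 1 2] by (simp add: a_def b_def c_def)
qed

text \<open>
  The conjugate Poisson kernel plus \<open>\<i>\<close> times the Poisson kernel, both without the usual factor \<open>1/\<pi>\<close>.
\<close>
definition cauchy_kernel :: "real \<Rightarrow> real \<Rightarrow> complex" where
  "cauchy_kernel a u = 1 / (of_real u - \<i> * of_real a)"

lemma borel_measurable_cauchy_kernel [measurable]: "cauchy_kernel a \<in> borel_measurable borel"
  unfolding cauchy_kernel_def by measurable

lemma cauchy_kernel_denom: "a \<noteq> 0 \<Longrightarrow> complex_of_real u - \<i> * of_real a \<noteq> 0"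
  by (simp add: complex_eq_iff)

lemma cauchy_kernel_Re_Im:
  "Re (cauchy_kernel a u) = u / (a^2 + u^2)" "Im (cauchy_kernel a u) = a / (a^2 + u^2)"
  by (simp_all add: cauchy_kernel_def Re_divide Im_divide add.commute)

lemma cnj_cauchy_kernel: "cnj (cauchy_kernel a u) = cauchy_kernel (-a) u"
  by (simp add: cauchy_kernel_def)

lemma cauchy_kernel_norm_le:
  assumes "a > 0" shows "norm (cauchy_kernel a u) \<le> 1 / a"
proof -
  have "a \<le> \<bar>Im (complex_of_real u - \<i> * of_real a)\<bar>" using assms by simp
  also have "\<dots> \<le> norm (complex_of_real u - \<i> * of_real a)" by (rule abs_Im_le_cmod)
  finally show ?thesis using assms unfolding cauchy_kernel_def norm_divide by (simp add: frac_le)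
qed

lemma norm_cauchy_kernel_le:
  assumes "a \<noteq> 0" "\<bar>t\<bar> \<le> L"
  shows "norm (cauchy_kernel a (t - x)) \<le> (1 + (1 + L) / \<bar>a\<bar>) / (1 + \<bar>x\<bar>)"
proof -
  define v where "v = complex_of_real (t - x) - \<i> * of_real a"
  have v: "norm v > 0" using cauchy_kernel_denom[OF assms(1)] by (simp add: v_def)
  have "\<bar>t - x\<bar> \<le> norm v" "\<bar>a\<bar> \<le> norm v"
    using abs_Re_le_cmod[of v] abs_Im_le_cmod[of v] by (auto simp: v_def)
  have "1 + \<bar>x\<bar> \<le> (1 + L) + \<bar>t - x\<bar>" using assms by linarith
  also have "1 + L \<le> (1 + L) / \<bar>a\<bar> * norm v"
  proof -
    have "(1 + L) / \<bar>a\<bar> * \<bar>a\<bar> \<le> (1 + L) / \<bar>a\<bar> * norm v"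
      using assms \<open>\<bar>a\<bar> \<le> norm v\<close> by (intro mult_left_mono) auto
    then show ?thesis using assms by simp
  qed
  also have "\<bar>t - x\<bar> \<le> norm v" by fact
  finally have "1 + \<bar>x\<bar> \<le> (1 + (1 + L) / \<bar>a\<bar>) * norm v" by (simp add: algebra_simps)
  then have "1 / norm v \<le> (1 + (1 + L) / \<bar>a\<bar>) / (1 + \<bar>x\<bar>)"
    using v by (simp add: field_simps)
  then show ?thesis by (simp add: cauchy_kernel_def v_def norm_divide)
qed

lemma inverse_square_le_Cauchy_density:
  "1 / ((1 + \<bar>x\<bar>) * (1 + \<bar>x\<bar>)) \<le> 1 / (1 + x^2)" for x :: real
  by (intro divide_left_mono mult_pos_pos) (auto simp: add_pos_nonneg algebra_simps power2_eq_square)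

text \<open>A single kernel decays only like \<open>1/|x|\<close>, so the pairings below involve two
  factors of this decay.\<close>

lemma integrable_of_decay:
  fixes f h :: "real \<Rightarrow> complex"
  assumes [measurable]: "f \<in> borel_measurable borel" "h \<in> borel_measurable borel"
    and f: "\<And>x. norm (f x) \<le> c / (1 + \<bar>x\<bar>)" and h: "\<And>x. norm (h x) \<le> d / (1 + \<bar>x\<bar>)"
  shows "integrable lborel (\<lambda>x. f x * h x)" "norm (f x * h x) \<le> c * d * (1 / (1 + x^2))"
proof -
  have c: "c \<ge> 0" using f[of 0] norm_ge_zero[of "f 0"] by (metis abs_zero add_0_right div_by_1 order_trans)
  have d: "d \<ge> 0" using h[of 0] norm_ge_zero[of "h 0"] by (metis abs_zero add_0_right div_by_1 order_trans)
  have le: "norm (f x * h x) \<le> c * d * (1 / (1 + x^2))" for x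
  proof -
    have "norm (f x * h x) \<le> (c / (1 + \<bar>x\<bar>)) * (d / (1 + \<bar>x\<bar>))"
      unfolding norm_mult using f h c by (intro mult_mono) auto
    also have "\<dots> = c * d * (1 / ((1 + \<bar>x\<bar>) * (1 + \<bar>x\<bar>)))" by simp
    also have "\<dots> \<le> c * d * (1 / (1 + x^2))"
      using c d by (intro mult_left_mono inverse_square_le_Cauchy_density) auto
    finally show ?thesis .
  qed
  then show "norm (f x * h x) \<le> c * d * (1 / (1 + x^2))" .
  show "integrable lborel (\<lambda>x. f x * h x)"
  proof (rule Bochner_Integration.integrable_bound)
    show "integrable lborel (\<lambda>x::real. c * d * (1 / (1 + x^2)))"
      using has_bochner_integral_Cauchy_density[THEN integrable.intros] by (intro integrable_mult_right) auto
    show "AE x in lborel. norm (f x * h x) \<le> norm (c * d * (1 / (1 + x^2)))"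
      using le c d by (intro AE_I2) (simp add: abs_mult)
  qed measurable
qed

lemma cauchy_kernel_prod_integrable:
  assumes "a \<noteq> 0" "b \<noteq> 0"
  shows "integrable lborel (\<lambda>x. cauchy_kernel a (t - x) * cauchy_kernel b (s - x))"
  by (rule integrable_of_decay(1)[OF _ _ norm_cauchy_kernel_le[OF assms(1) order_refl] norm_cauchy_kernel_le[OF assms(2) order_refl]]) measurable

text \<open>Partial fractions and \<open>resolvent_asymp\<close> replace the residue theorem:
  heights of equal sign give 0, opposite signs give a kernel at the added height.
  \<open>a \<noteq> b\<close> keeps the two poles distinct for all \<open>t\<close> and
  \<open>s\<close>.\<close>

lemma cauchy_kernel_prod_integral:
  assumes "a \<noteq> 0" "b \<noteq> 0" "a \<noteq> b"
  shows "(LBINT x. cauchy_kernel a (t - x) * cauchy_kernel b (s - x))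
       = \<i> * (pi * (sgn b - sgn a)) * cauchy_kernel (a - b) (t - s)"
proof -
  define p q where "p = Complex t (-a)" and "q = Complex s (-b)"
  have k: "cauchy_kernel a (t - x) = - (1 / (of_real x - p))" "cauchy_kernel b (s - x) = - (1 / (of_real x - q))" for x
  proof -
    have "complex_of_real (t - x) - \<i> * a = - (of_real x - p)" "complex_of_real (s - x) - \<i> * b = - (of_real x - q)"
      by (auto simp: complex_eq_iff p_def q_def)
    then show "cauchy_kernel a (t - x) = - (1 / (of_real x - p))" "cauchy_kernel b (s - x) = - (1 / (of_real x - q))"
      unfolding cauchy_kernel_def by (simp_all only: divide_minus_right)
  qed
  have ne: "complex_of_real x - p \<noteq> 0" "complex_of_real x - q \<noteq> 0" "p - q \<noteq> 0" for x
    using assms by (auto simp: complex_eq_iff p_def q_def)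
  have e: "cauchy_kernel a (t - x) * cauchy_kernel b (s - x) = (1 / (p - q)) * (1 / (of_real x - p) - 1 / (of_real x - q))" for x
    unfolding k using ne by (simp add: field_simps)
  define G where "G z R = Complex (ln ((R - Re z)^2 + (Im z)^2) / 2 - ln ((-R - Re z)^2 + (Im z)^2) / 2)
       (arctan ((R - Re z) / Im z) - arctan ((-R - Re z) / Im z))" for z :: complex and R :: real
  have imp: "Im p \<noteq> 0" "Im q \<noteq> 0" using assms by (auto simp: p_def q_def)
  have "(LBINT x. cauchy_kernel a (t - x) * cauchy_kernel b (s - x)) = (1 / (p - q)) * (\<i> * (pi * sgn (Im p)) - \<i> * (pi * sgn (Im q)))"
  proof (rule lebesgue_integral_exhaustion_interval)
    show "((\<lambda>x. cauchy_kernel a (t - x) * cauchy_kernel b (s - x)) has_integral (1 / (p - q)) * (G p R - G q R)) {-R..R}" if "0 < R" for R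
      unfolding e G_def using that imp by (intro has_integral_mult_right has_integral_diff resolvent_has_integral) auto
    show "((\<lambda>R. (1 / (p - q)) * (G p R - G q R)) \<longlongrightarrow> (1 / (p - q)) * (\<i> * (pi * sgn (Im p)) - \<i> * (pi * sgn (Im q)))) at_top"
      unfolding G_def by (intro tendsto_intros resolvent_asymp imp)
  qed (rule cauchy_kernel_prod_integrable[OF assms(1,2)])
  also have "1 / (p - q) = cauchy_kernel (a - b) (t - s)"
  proof -
    have "p - q = of_real (t - s) - \<i> * of_real (a - b)" by (auto simp: complex_eq_iff p_def q_def)
    then show ?thesis unfolding cauchy_kernel_def by simp
  qed
  also have "\<i> * (pi * sgn (Im p)) - \<i> * (pi * sgn (Im q)) = \<i> * (pi * (sgn b - sgn a))"
    by (simp add: p_def q_def sgn_minus algebra_simps)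
  finally show ?thesis by (simp add: mult_ac)
qed

lemma odd_kernel_integral:
  fixes k :: "real \<Rightarrow> real"
  assumes "\<And>v. k (-v) = - k v"
  shows "(LBINT t. k (t - x)) = 0"
proof -
  have "(LBINT t. k (t - x)) = (LBINT t. k ((2 * x + (-1) * t) - x))"
    using lborel_integral_real_affine[of "-1" "\<lambda>t. k (t - x)" "2 * x"] by simp
  also have "\<dots> = (LBINT t. - k (t - x))"
  proof -
    have "k ((2 * x + (-1) * t) - x) = - k (t - x)" for t
      using assms[of "t - x"] by (simp add: algebra_simps)
    then show ?thesis by simp
  qed
  finally show ?thesis by simp
qed

lemma integrable_pair_mult:
  fixes f h :: "real \<Rightarrow> real"
  assumes "integrable lborel f" "integrable lborel h"
  shows "integrable (lborel \<Otimes>\<^sub>M lborel) (\<lambda>(x, y). f x * h y)"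
proof (rule lborel_pair.Fubini_integrable)
  have [measurable]: "f \<in> borel_measurable borel" "h \<in> borel_measurable borel" using assms by auto
  show "(\<lambda>(x, y). f x * h y) \<in> borel_measurable (lborel \<Otimes>\<^sub>M lborel)" by measurable
  have "(LBINT y. norm (f x * h y)) = \<bar>f x\<bar> * (LBINT y. \<bar>h y\<bar>)" for x
    by (simp add: abs_mult)
  then show "integrable lborel (\<lambda>x. LBINT y. norm (case (x, y) of (x, y) \<Rightarrow> f x * h y))"
    using assms by simp
  show "AE x in lborel. integrable lborel (\<lambda>y. case (x, y) of (x, y) \<Rightarrow> f x * h y)"
    using assms by simp
qed

lemma integrable_indicator_Icc: "integrable lborel (indicator {a..b} :: real \<Rightarrow> real)"
  by (intro integrable_real_indicator) (auto simp: emeasure_lborel_Icc_eq)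

text \<open>Borel measurability allows Fubini on \<open>lborel\<close> throughout;
  \<open>bounded_support_representative\<close> supplies such a function for a Lebesgue measurable
  one. The bounds are parameters because the distribution function is a second instance with other
  bounds.\<close>

locale bounded_support =
  fixes g :: "real \<Rightarrow> real" and M L :: real
  assumes borel [measurable]: "g \<in> borel_measurable borel"
    and bound: "\<bar>g t\<bar> \<le> M" and support: "\<bar>t\<bar> > L \<Longrightarrow> g t = 0"
    and M_pos: "M > 0" and L_pos: "L > 0"
begin

lemma abs_le_indicator: "\<bar>g t\<bar> \<le> M * indicator {-L..L} t"
  using bound[of t] support[of t] by (auto split: split_indicator)

lemma integrable_mult_bounded:
  fixes h :: "real \<Rightarrow> 'a::{banach, second_countable_topology, real_normed_field}"
  assumes [measurable]: "h \<in> borel_measurable borel" and h: "\<And>t. \<bar>t\<bar> \<le> L \<Longrightarrow> norm (h t) \<le> C"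
  shows "integrable lborel (\<lambda>t. of_real (g t) * h t)"
    and "norm (LBINT t. of_real (g t) * h t) \<le> 2 * L * M * C"
proof -
  have C: "C \<ge> 0" using order_trans[OF norm_ge_zero h[of 0]] L_pos by simp
  have b: "norm (of_real (g t) * h t) \<le> M * C * indicator {-L..L} t" for t
    using bound[of t] support[of t] h[of t] C M_pos
    by (auto simp: norm_mult split: split_indicator intro: mult_mono)
  have i: "integrable lborel (\<lambda>t. M * C * indicator {-L..L} t :: real)"
    by (intro integrable_mult_right integrable_indicator_Icc)
  show I: "integrable lborel (\<lambda>t. of_real (g t) * h t)"
    by (rule Bochner_Integration.integrable_bound[OF i]) (auto intro!: AE_I2 order_trans[OF b])
  have "norm (LBINT t. of_real (g t) * h t) \<le> (LBINT t. M * C * indicator {-L..L} t)"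
    by (rule Bochner_Integration.integral_norm_bound_integral[OF I i]) (use b in auto)
  also have "\<dots> = 2 * L * M * C" using L_pos by simp
  finally show "norm (LBINT t. of_real (g t) * h t) \<le> 2 * L * M * C" .
qed

text \<open>As \<open>a\<close> decreases to 0 this tends almost everywhere to
  \<open>pi * (h + i g)\<close>, where \<open>h\<close> is the Hilbert transform of
  \<open>g\<close>. Negative heights give the complex conjugate, so that inner products become
  integrals of products.\<close>

definition cauchy_transform :: "real \<Rightarrow> real \<Rightarrow> complex" where
  "cauchy_transform a x = (LBINT t. of_real (g t) * cauchy_kernel a (t - x))"

lemma borel_measurable_cauchy_transform [measurable]: "cauchy_transform a \<in> borel_measurable borel"
  unfolding cauchy_transform_def by measurable

lemma cauchy_transform_integrable:
  "a \<noteq> 0 \<Longrightarrow> integrable lborel (\<lambda>t. of_real (g t) * cauchy_kernel a (t - x))"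
  by (rule integrable_mult_bounded(1)[OF _ norm_cauchy_kernel_le]) auto

lemma norm_cauchy_transform_le:
  assumes "a \<noteq> 0"
  shows "norm (cauchy_transform a x) \<le> (2 * L * M * (1 + (1 + L) / \<bar>a\<bar>)) / (1 + \<bar>x\<bar>)"
proof -
  have "norm (cauchy_transform a x) \<le> 2 * L * M * ((1 + (1 + L) / \<bar>a\<bar>) / (1 + \<bar>x\<bar>))"
    unfolding cauchy_transform_def
    by (rule integrable_mult_bounded(2)) (use norm_cauchy_kernel_le[OF assms] in auto)
  then show ?thesis by simp
qed

lemma cnj_cauchy_transform: "cnj (cauchy_transform a x) = cauchy_transform (-a) x"
proof -
  have "cnj (cauchy_transform a x) = (LBINT t. cnj (of_real (g t) * cauchy_kernel a (t - x)))"
    unfolding cauchy_transform_def by (rule Bochner_Integration.integral_cnj[symmetric])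
  then show ?thesis by (simp only: cauchy_transform_def complex_cnj_mult complex_cnj_complex_of_real cnj_cauchy_kernel)
qed

lemma cauchy_transform_pairing:
  assumes a: "a \<noteq> 0" and [measurable]: "B \<in> borel_measurable borel" and B: "\<And>x. norm (B x) \<le> c / (1 + \<bar>x\<bar>)"
  shows "integrable lborel (\<lambda>x. cauchy_transform a x * B x)"
    and "(LBINT x. cauchy_transform a x * B x) = (LBINT t. of_real (g t) * (LBINT x. cauchy_kernel a (t - x) * B x))"
proof -
  show "integrable lborel (\<lambda>x. cauchy_transform a x * B x)"
    by (rule integrable_of_decay(1)[OF _ _ norm_cauchy_transform_le[OF a] B]) measurable
  define d where "d = 1 + (1 + L) / \<bar>a\<bar>"
  let ?f = "\<lambda>t x. of_real (g t) * cauchy_kernel a (t - x) * B x"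
  have "integrable (lborel \<Otimes>\<^sub>M lborel) (case_prod ?f)"
  proof (rule Bochner_Integration.integrable_bound)
    show "integrable (lborel \<Otimes>\<^sub>M lborel) (\<lambda>(t, x). (M * indicator {-L..L} t) * (d * c * (1 / (1 + x^2))))"
      using has_bochner_integral_Cauchy_density[THEN integrable.intros]
      by (intro integrable_pair_mult integrable_mult_right integrable_indicator_Icc)
    show "case_prod ?f \<in> borel_measurable (lborel \<Otimes>\<^sub>M lborel)" by measurable
    have c: "c \<ge> 0" using B[of 0] norm_ge_zero[of "B 0"] by (metis abs_zero add_0_right div_by_1 order_trans)
    have d: "d \<ge> 0" using L_pos by (simp add: d_def)
    have "norm (?f t x) \<le> (M * indicator {-L..L} t) * (d * c * (1 / (1 + x^2)))" for t x
    proof (cases "\<bar>t\<bar> \<le> L")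
      case True
      have "norm (cauchy_kernel a (t - x) * B x) \<le> (d / (1 + \<bar>x\<bar>)) * (c / (1 + \<bar>x\<bar>))"
        unfolding norm_mult using norm_cauchy_kernel_le[OF a True] B d unfolding d_def by (intro mult_mono) auto
      also have "\<dots> = d * c * (1 / ((1 + \<bar>x\<bar>) * (1 + \<bar>x\<bar>)))" by simp
      also have "\<dots> \<le> d * c * (1 / (1 + x^2))"
        using c d by (intro mult_left_mono inverse_square_le_Cauchy_density) auto
      finally have "\<bar>g t\<bar> * norm (cauchy_kernel a (t - x) * B x) \<le> (M * indicator {-L..L} t) * (d * c * (1 / (1 + x^2)))"
        using abs_le_indicator[of t] M_pos by (intro mult_mono) auto
      then show ?thesis by (simp add: norm_mult mult.assoc)
    next
      case False
      then show ?thesis using support[of t] by (auto split: split_indicator)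
    qed
    then show "AE z in lborel \<Otimes>\<^sub>M lborel. norm (case_prod ?f z) \<le> norm (case z of (t, x) \<Rightarrow> (M * indicator {-L..L} t) * (d * c * (1 / (1 + x^2))))"
      by (intro AE_I2) (metis (mono_tags, lifting) abs_ge_self case_prod_conv order_trans real_norm_def surj_pair)
  qed
  have 1: "cauchy_transform a x * B x = (LBINT t. ?f t x)" for x
    unfolding cauchy_transform_def by (rule integral_mult_left_zero[symmetric])
  have 2: "of_real (g t) * (LBINT x. cauchy_kernel a (t - x) * B x) = (LBINT x. ?f t x)" for t
    unfolding mult.assoc by (rule integral_mult_right_zero[symmetric])
  from lborel_pair.Fubini_integral[OF \<open>integrable (lborel \<Otimes>\<^sub>M lborel) (case_prod ?f)\<close>]
  have "(LBINT x. LBINT t. ?f t x) = (LBINT t. LBINT x. ?f t x)" .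
  then show "(LBINT x. cauchy_transform a x * B x) = (LBINT t. of_real (g t) * (LBINT x. cauchy_kernel a (t - x) * B x))"
    by (simp only: 1 2)
qed

text \<open>\<open>cauchy_transform (-b)\<close> is the conjugate of
  \<open>cauchy_transform b\<close>, so this is an \<open>L^2\<close> inner product. Doing the
  \<open>x\<close>-integral first by \<open>cauchy_kernel_prod_integral\<close> leaves a dependence
  on \<open>a + b\<close> alone.\<close>

lemma cauchy_transform_correlation:
  assumes a: "a > 0" and b: "b > 0"
  shows "integrable lborel (\<lambda>x. cauchy_transform a x * cauchy_transform (-b) x)"
    and "(LBINT x. cauchy_transform a x * cauchy_transform (-b) x)
       = (LBINT t. of_real (g t) * (LBINT s. of_real (g s) * (- (2 * \<i> * pi) * cauchy_kernel (a + b) (t - s))))"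
proof -
  have b': "-b \<noteq> 0" and a': "a \<noteq> 0" using a b by auto
  note dec = norm_cauchy_transform_le[OF b']
  show "integrable lborel (\<lambda>x. cauchy_transform a x * cauchy_transform (-b) x)"
    by (rule cauchy_transform_pairing(1)[OF a' _ dec]) measurable
  have inner: "(LBINT x. cauchy_kernel a (t - x) * cauchy_transform (-b) x)
      = (LBINT s. of_real (g s) * (- (2 * \<i> * pi) * cauchy_kernel (a + b) (t - s)))" for t
  proof -
    have "(LBINT x. cauchy_transform (-b) x * cauchy_kernel a (t - x))
      = (LBINT s. of_real (g s) * (LBINT x. cauchy_kernel (-b) (s - x) * cauchy_kernel a (t - x)))"
      by (rule cauchy_transform_pairing(2)[OF b' _ norm_cauchy_kernel_le[OF a' order_refl]]) measurable
    moreover have "(LBINT x. cauchy_kernel (-b) (s - x) * cauchy_kernel a (t - x)) = - (2 * \<i> * pi) * cauchy_kernel (a + b) (t - s)" for s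
      using cauchy_kernel_prod_integral[of a "-b" t s] a b by (simp add: mult.commute)
    ultimately show ?thesis by (simp only: mult.commute[of "cauchy_kernel a _"])
  qed
  have "(LBINT x. cauchy_transform a x * cauchy_transform (-b) x)
     = (LBINT t. of_real (g t) * (LBINT x. cauchy_kernel a (t - x) * cauchy_transform (-b) x))"
    by (rule cauchy_transform_pairing(2)[OF a' _ dec]) measurable
  then show "(LBINT x. cauchy_transform a x * cauchy_transform (-b) x)
       = (LBINT t. of_real (g t) * (LBINT s. of_real (g s) * (- (2 * \<i> * pi) * cauchy_kernel (a + b) (t - s))))"
    by (simp only: inner)
qed

end

section \<open>Convergence of the Cauchy transforms as the height decreases\<close>

context bounded_support
begin

lemma integrable_mult_bounded_real:
  fixes h :: "real \<Rightarrow> real"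
  assumes "h \<in> borel_measurable borel" "\<And>t. \<bar>t\<bar> \<le> L \<Longrightarrow> \<bar>h t\<bar> \<le> C"
  shows "integrable lborel (\<lambda>t. g t * h t)" "\<bar>LBINT t. g t * h t\<bar> \<le> 2 * L * M * C"
  using integrable_mult_bounded[of h C] assms by auto

lemma weighted_integrable: "integrable lborel (\<lambda>t. g t / (1 + t^2))"
proof -
  have "integrable lborel (\<lambda>t. g t * (1 / (1 + t^2)))"
    by (rule integrable_mult_bounded_real(1)[where C=1]) (auto simp: add_pos_nonneg)
  then show ?thesis by simp
qed

lemma Im_cauchy_transform:
  assumes "a \<noteq> 0" shows "Im (cauchy_transform a x) = (LBINT t. poisson a (t - x) * g t)"
proof -
  have "Im (cauchy_transform a x) = (LBINT t. Im (of_real (g t) * cauchy_kernel a (t - x)))"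
    unfolding cauchy_transform_def by (rule integral_Im[symmetric, OF cauchy_transform_integrable[OF assms]])
  then show ?thesis by (simp add: cauchy_kernel_Re_Im poisson_def mult.commute)
qed

lemma Re_cauchy_transform:
  assumes "a \<noteq> 0"
  shows "integrable lborel (\<lambda>t. g t * ((t - x) / (a^2 + (t - x)^2)))"
    and "Re (cauchy_transform a x) = (LBINT t. g t * ((t - x) / (a^2 + (t - x)^2)))"
proof -
  have e: "g t * ((t - x) / (a^2 + (t - x)^2)) = Re (of_real (g t) * cauchy_kernel a (t - x))" for t
    by (simp add: cauchy_kernel_Re_Im)
  show "integrable lborel (\<lambda>t. g t * ((t - x) / (a^2 + (t - x)^2)))"
    unfolding e by (rule integrable_Re[OF cauchy_transform_integrable[OF assms]])
  show "Re (cauchy_transform a x) = (LBINT t. g t * ((t - x) / (a^2 + (t - x)^2)))"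
    unfolding e cauchy_transform_def by (rule integral_Re[symmetric, OF cauchy_transform_integrable[OF assms]])
qed

lemma abs_Im_cauchy_transform_le:
  assumes "a > 0" shows "\<bar>Im (cauchy_transform a x)\<bar> \<le> pi * M"
proof -
  note P = has_bochner_integral_poisson[OF assms, of x]
  have "norm (LBINT t. poisson a (t - x) * g t) \<le> (LBINT t. poisson a (t - x) * M)"
  proof (rule Bochner_Integration.integral_norm_bound_integral)
    show "integrable lborel (\<lambda>t. poisson a (t - x) * g t)"
      by (rule poisson_times_integrable[OF weighted_integrable borel assms])
    show "integrable lborel (\<lambda>t. poisson a (t - x) * M)" using integrable.intros[OF P] by simp
    show "norm (poisson a (t - x) * g t) \<le> poisson a (t - x) * M" for t
      using bound[of t] poisson_nonneg[of a "t - x"] assms by (simp add: abs_mult mult_left_mono)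
  qed
  also have "\<dots> = pi * M" using has_bochner_integral_integral_eq[OF P] by simp
  finally show ?thesis using assms by (simp add: Im_cauchy_transform)
qed

lemma Im_cauchy_transform_tendsto:
  "AE x in lborel. ((\<lambda>a. Im (cauchy_transform a x)) \<longlongrightarrow> pi * g x) (at_right 0)"
  using poisson_deviation_tendsto[OF weighted_integrable borel]
proof eventually_elim
  case (elim x)
  have "eventually (\<lambda>a. (LBINT t. poisson a (t - x) * g t) = Im (cauchy_transform a x)) (at_right 0)"
    using eventually_at_right_less[of 0] by eventually_elim (simp add: Im_cauchy_transform)
  with poisson_tendsto_of_deviation[OF weighted_integrable borel elim] show ?case
    by (rule Lim_transform_eventually)
qed

text \<open>The real part of the inner product of the transforms at two heights with sum
  \<open>c\<close>, see \<open>Re_correlation\<close>. In this form the limit at 0 is visible, since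
  \<open>Im (cauchy_transform c t)\<close> tends to \<open>pi * g t\<close>.\<close>

definition energy :: "real \<Rightarrow> real" where
  "energy c = 2 * pi * (LBINT t. g t * Im (cauchy_transform c t))"

lemma energy_tendsto: "(energy \<longlongrightarrow> 2 * pi * (LBINT t. g t * (pi * g t))) (at_right 0)"
  unfolding tendsto_at_iff_sequentially
proof (intro allI impI)
  fix X :: "nat \<Rightarrow> real" assume X: "\<forall>i. X i \<in> {0<..} - {0}" "X \<longlonglongrightarrow> 0"
  then have X0: "X i > 0" for i by auto
  have X1: "filterlim X (at_right 0) sequentially"
  proof -
    have "X i \<noteq> 0" for i using X0[of i] by simp
    then show ?thesis by (simp add: filterlim_at X(2) X0)
  qed
  have "(\<lambda>n. LBINT t. g t * Im (cauchy_transform (X n) t)) \<longlonglongrightarrow> (LBINT t. g t * (pi * g t))"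
  proof (rule integral_dominated_convergence[where w="\<lambda>t. (M * (pi * M)) * indicator {-L..L} t"])
    show "integrable lborel (\<lambda>t. (M * (pi * M)) * indicator {-L..L} t :: real)"
      by (intro integrable_mult_right integrable_indicator_Icc)
    show "AE t in lborel. (\<lambda>n. g t * Im (cauchy_transform (X n) t)) \<longlonglongrightarrow> g t * (pi * g t)"
      using Im_cauchy_transform_tendsto
      by eventually_elim (intro tendsto_mult tendsto_const filterlim_compose[OF _ X1])
    show "AE t in lborel. norm (g t * Im (cauchy_transform (X n) t)) \<le> (M * (pi * M)) * indicator {-L..L} t" for n
    proof (rule AE_I2)
      fix t
      have "\<bar>g t\<bar> * \<bar>Im (cauchy_transform (X n) t)\<bar> \<le> (M * indicator {-L..L} t) * (pi * M)"
        using abs_le_indicator[of t] abs_Im_cauchy_transform_le[OF X0, of n t] M_pos by (intro mult_mono) auto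
      then show "norm (g t * Im (cauchy_transform (X n) t)) \<le> (M * (pi * M)) * indicator {-L..L} t"
        by (simp add: abs_mult mult_ac)
    qed
  qed measurable
  then show "(energy \<circ> X) \<longlonglongrightarrow> 2 * pi * (LBINT t. g t * (pi * g t))"
    unfolding comp_def energy_def by (intro tendsto_intros)
qed

lemma Re_correlation:
  assumes "a > 0" "b > 0"
  shows "Re (LBINT x. cauchy_transform a x * cauchy_transform (-b) x) = energy (a + b)"
proof -
  let ?c = "a + b"
  have c: "?c > 0" "?c \<noteq> 0" using assms by auto
  have inner: "(LBINT s. of_real (g s) * (- (2 * \<i> * pi) * cauchy_kernel ?c (t - s))) = 2 * \<i> * pi * cnj (cauchy_transform ?c t)" for t
  proof -
    have "cauchy_kernel ?c (t - s) = - cauchy_kernel (- ?c) (s - t)" for s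
    proof -
      have "complex_of_real (t - s) - \<i> * ?c = - (of_real (s - t) - \<i> * of_real (- ?c))" by (simp add: algebra_simps)
      then show ?thesis unfolding cauchy_kernel_def by (simp only: divide_minus_right)
    qed
    then have "of_real (g s) * (- (2 * \<i> * pi) * cauchy_kernel ?c (t - s)) = (2 * \<i> * pi) * (of_real (g s) * cauchy_kernel (- ?c) (s - t))" for s
      by (simp add: mult_ac)
    then have "(LBINT s. of_real (g s) * (- (2 * \<i> * pi) * cauchy_kernel ?c (t - s))) = 2 * \<i> * pi * cauchy_transform (- ?c) t"
      unfolding cauchy_transform_def by (simp only: integral_mult_right_zero)
    then show ?thesis by (simp only: cnj_cauchy_transform)
  qed
  have "integrable lborel (\<lambda>t. of_real (g t) * (2 * \<i> * pi * cnj (cauchy_transform ?c t)))"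
  proof (rule integrable_mult_bounded(1))
    fix t
    have "norm (cauchy_transform ?c t) \<le> 2 * L * M * (1 + (1 + L) / \<bar>?c\<bar>) / (1 + \<bar>t\<bar>)"
      by (rule norm_cauchy_transform_le[OF c(2)])
    also have "\<dots> \<le> 2 * L * M * (1 + (1 + L) / \<bar>?c\<bar>) / 1"
      using L_pos M_pos by (intro divide_left_mono) auto
    finally show "norm (2 * \<i> * pi * cnj (cauchy_transform ?c t)) \<le> 2 * pi * (2 * L * M * (1 + (1 + L) / \<bar>?c\<bar>))"
      by (simp add: norm_mult)
  qed (unfold cnj_cauchy_transform, measurable)
  then have "Re (LBINT t. of_real (g t) * (2 * \<i> * pi * cnj (cauchy_transform ?c t)))
     = (LBINT t. Re (of_real (g t) * (2 * \<i> * pi * cnj (cauchy_transform ?c t))))"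
    by (rule integral_Re[symmetric])
  also have "\<dots> = (LBINT t. (2 * pi) * (g t * Im (cauchy_transform ?c t)))"
    by (intro Bochner_Integration.integral_cong) (auto simp: algebra_simps)
  also have "\<dots> = energy ?c" unfolding energy_def by (rule integral_mult_right_zero)
  finally show ?thesis unfolding cauchy_transform_correlation(2)[OF assms] inner .
qed

lemma L2_distance:
  assumes "a > 0" "b > 0"
  shows "integrable lborel (\<lambda>x. (norm (cauchy_transform a x - cauchy_transform b x))^2)"
    and "(LBINT x. (norm (cauchy_transform a x - cauchy_transform b x))^2) = energy (2 * a) - 2 * energy (a + b) + energy (2 * b)"
proof -
  let ?P = "\<lambda>a b x. cauchy_transform a x * cauchy_transform (-b) x"
  have e: "(norm (cauchy_transform a x - cauchy_transform b x))^2 = Re (?P a a x - ?P a b x - ?P b a x + ?P b b x)" for x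
    unfolding cnj_cauchy_transform[symmetric] cmod_power2 by (simp add: algebra_simps power2_eq_square)
  note i = cauchy_transform_correlation(1)
  have I: "integrable lborel (\<lambda>x. ?P a a x - ?P a b x - ?P b a x + ?P b b x)"
    using assms by (intro Bochner_Integration.integrable_add Bochner_Integration.integrable_diff i)
  show "integrable lborel (\<lambda>x. (norm (cauchy_transform a x - cauchy_transform b x))^2)"
    unfolding e by (rule integrable_Re[OF I])
  have "(LBINT x. (norm (cauchy_transform a x - cauchy_transform b x))^2) = Re (LBINT x. ?P a a x - ?P a b x - ?P b a x + ?P b b x)"
    unfolding e by (rule integral_Re[OF I])
  also have "(LBINT x. ?P a a x - ?P a b x - ?P b a x + ?P b b x)
     = (LBINT x. ?P a a x) - (LBINT x. ?P a b x) - (LBINT x. ?P b a x) + (LBINT x. ?P b b x)"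
    by (intro has_bochner_integral_integral_eq has_bochner_integral_add has_bochner_integral_diff
        has_bochner_integral_integrable i assms)
  also have "Re \<dots> = energy (2 * a) - 2 * energy (a + b) + energy (2 * b)"
    by (simp only: Re_correlation assms plus_complex.sel minus_complex.sel add.commute[of b a] mult_2[symmetric])
  finally show "(LBINT x. (norm (cauchy_transform a x - cauchy_transform b x))^2) = energy (2 * a) - 2 * energy (a + b) + energy (2 * b)" .
qed

text \<open>The three energies tend to one limit and their coefficients 1, -2, 1 add up to 0; the
  absolute values of the coefficients add up to 4, whence \<open>e / 4\<close>.\<close>

lemma L2_distance_small:
  assumes "e > 0"
  shows "\<exists>d>0. \<forall>a b. 0 < a \<and> a < d \<and> 0 < b \<and> b < d \<longrightarrow> (LBINT x. (norm (cauchy_transform a x - cauchy_transform b x))^2) \<le> e"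
proof -
  define l where "l = 2 * pi * (LBINT t. g t * (pi * g t))"
  have "eventually (\<lambda>c. dist (energy c) l < e / 4) (at_right 0)"
    using energy_tendsto assms unfolding l_def by (intro tendstoD) auto
  then obtain d where d: "d > 0" "\<And>c. 0 < c \<Longrightarrow> c < d \<Longrightarrow> dist (energy c) l < e / 4"
    unfolding eventually_at_right_field by auto
  show ?thesis
  proof (intro exI[of _ "d / 2"] conjI allI impI)
    fix a b :: real assume ab: "0 < a \<and> a < d / 2 \<and> 0 < b \<and> b < d / 2"
    then have "dist (energy (2 * a)) l < e / 4" "dist (energy (a + b)) l < e / 4" "dist (energy (2 * b)) l < e / 4"
      using d(2)[of "2 * a"] d(2)[of "a + b"] d(2)[of "2 * b"] by auto
    then have "energy (2 * a) - 2 * energy (a + b) + energy (2 * b) \<le> e" unfolding dist_real_def abs_less_iff by linarith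
    then show "(LBINT x. (norm (cauchy_transform a x - cauchy_transform b x))^2) \<le> e"
      using ab by (simp add: L2_distance)
  qed (use d in auto)
qed

text \<open>\<open>(1/4)^k\<close> for squared norms means \<open>2^(-k)\<close> for norms, fast
  enough for the increments to be absolutely summable almost everywhere.\<close>

lemma fast_L2_sequence:
  obtains b :: "nat \<Rightarrow> real" where "\<And>k. b k > 0" "b \<longlonglongrightarrow> 0"
    "\<And>k. (LBINT x. (norm (cauchy_transform (b (Suc k)) x - cauchy_transform (b k) x))^2) \<le> (1/4)^k"
proof -
  have "\<exists>d>0. \<forall>a b. 0 < a \<and> a < d \<and> 0 < b \<and> b < d \<longrightarrow> (LBINT x. (norm (cauchy_transform a x - cauchy_transform b x))^2) \<le> (1/4)^k" for k :: nat
    by (rule L2_distance_small) simp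
  then obtain d where d: "\<And>k::nat. d k > 0"
    "\<And>k a b. 0 < a \<Longrightarrow> a < d k \<Longrightarrow> 0 < b \<Longrightarrow> b < d k \<Longrightarrow> (LBINT x. (norm (cauchy_transform a x - cauchy_transform b x))^2) \<le> (1/4)^k"
    by metis
  have "\<exists>b. \<forall>n. (0 < b n \<and> b n < d n \<and> b n < 1 / real (Suc n)) \<and> b (Suc n) \<le> b n"
  proof (rule dependent_nat_choice)
    show "\<exists>x. 0 < x \<and> x < d 0 \<and> x < 1 / real (Suc 0)"
      using d(1)[of 0] by (intro exI[of _ "min (d 0) 1 / 2"]) (auto simp: min_def)
    fix x n assume "0 < x \<and> x < d n \<and> x < 1 / real (Suc n)"
    then have "0 < Min {x, d (Suc n), 1 / real (Suc (Suc n))}" using d(1)[of "Suc n"] by simp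
    then obtain y where "0 < y" "y < Min {x, d (Suc n), 1 / real (Suc (Suc n))}" using dense by blast
    then show "\<exists>y. (0 < y \<and> y < d (Suc n) \<and> y < 1 / real (Suc (Suc n))) \<and> y \<le> x" by auto
  qed
  then obtain b where b: "\<And>n. 0 < b n" "\<And>n. b n < d n" "\<And>n. b n < 1 / real (Suc n)" "\<And>n. b (Suc n) \<le> b n" by blast
  show thesis
  proof
    show "b \<longlonglongrightarrow> 0"
    proof (rule tendsto_sandwich[OF _ _ tendsto_const])
      show "(\<lambda>n. 1 / real (Suc n)) \<longlonglongrightarrow> 0" using LIMSEQ_Suc[OF lim_1_over_n] by simp
    qed (use b(1,3) in \<open>auto intro!: always_eventually less_imp_le simp del: of_nat_Suc\<close>)
    show "(LBINT x. (norm (cauchy_transform (b (Suc k)) x - cauchy_transform (b k) x))^2) \<le> (1/4)^k" for k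
      by (rule d(2)) (use b le_less_trans[OF b(4) b(2)] in auto)
  qed (use b in auto)
qed

lemma cauchy_transform_tendsto_shift:
  assumes "a > 0" "b \<longlonglongrightarrow> 0" "\<And>k::nat. b k > 0"
  shows "(\<lambda>k. cauchy_transform (a + b k) y) \<longlonglongrightarrow> cauchy_transform a y"
  unfolding cauchy_transform_def
proof (rule integral_dominated_convergence[where w="\<lambda>t. (M * (1 / a)) * indicator {-L..L} t"])
  show "integrable lborel (\<lambda>t. (M * (1 / a)) * indicator {-L..L} t :: real)"
    by (intro integrable_mult_right integrable_indicator_Icc)
  show "AE t in lborel. (\<lambda>k. of_real (g t) * cauchy_kernel (a + b k) (t - y)) \<longlonglongrightarrow> of_real (g t) * cauchy_kernel a (t - y)"
  proof (rule AE_I2)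
    fix t
    have "(\<lambda>k. a + b k) \<longlonglongrightarrow> a + 0" by (intro tendsto_intros assms)
    then show "(\<lambda>k. of_real (g t) * cauchy_kernel (a + b k) (t - y)) \<longlonglongrightarrow> of_real (g t) * cauchy_kernel a (t - y)"
      unfolding cauchy_kernel_def using assms(1) cauchy_kernel_denom[of a "t - y"] by (intro tendsto_intros) auto
  qed
  show "AE t in lborel. norm (of_real (g t) * cauchy_kernel (a + b k) (t - y)) \<le> (M * (1 / a)) * indicator {-L..L} t" for k
  proof (rule AE_I2)
    fix t
    have "a \<le> \<bar>Im (complex_of_real (t - y) - \<i> * of_real (a + b k))\<bar>" using assms(1) assms(3)[of k] by simp
    also have "\<dots> \<le> norm (complex_of_real (t - y) - \<i> * of_real (a + b k))" by (rule abs_Im_le_cmod)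
    finally have "norm (cauchy_kernel (a + b k) (t - y)) \<le> 1 / a"
      using assms(1) unfolding cauchy_kernel_def norm_divide by (simp add: frac_le)
    then have "\<bar>g t\<bar> * norm (cauchy_kernel (a + b k) (t - y)) \<le> (M * indicator {-L..L} t) * (1 / a)"
      using abs_le_indicator[of t] M_pos by (intro mult_mono) auto
    then show "norm (of_real (g t) * cauchy_kernel (a + b k) (t - y)) \<le> (M * (1 / a)) * indicator {-L..L} t"
      by (simp add: norm_mult mult_ac)
  qed
qed measurable

text \<open>Semigroup property: averaging the transform at height \<open>b\<close> with the Poisson
  kernel of height \<open>a\<close> raises it to height \<open>a + b\<close>. The condition
  \<open>b \<noteq> a\<close> comes from the partial fractions; it holds eventually when
  \<open>b\<close> tends to 0.\<close>

lemma poisson_cauchy_transform: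
  assumes a: "a > 0" and b: "b > 0" and ab: "b \<noteq> a"
  shows "integrable lborel (\<lambda>x. cauchy_transform b x * of_real (poisson a (x - y)))"
    and "(LBINT x. cauchy_transform b x * of_real (poisson a (x - y))) = pi * cauchy_transform (a + b) y"
proof -
  have imP: "Im (cauchy_kernel a (y - x)) = poisson a (x - y)" for x
    by (simp add: cauchy_kernel_Re_Im poisson_def power2_commute)
  have p: "complex_of_real (poisson a (x - y)) = (cauchy_kernel a (y - x) - cauchy_kernel (-a) (y - x)) / (2 * \<i>)" for x
  proof -
    have "(z - cnj z) / (2 * \<i>) = of_real (Im z)" for z :: complex
      by (simp add: complex_eq_iff Re_divide Im_divide)
    then show ?thesis unfolding cnj_cauchy_kernel[symmetric] by (simp only: imP)
  qed
  have dec: "norm (complex_of_real (poisson a (x - y))) \<le> (1 + (1 + \<bar>y\<bar>) / \<bar>a\<bar>) / (1 + \<bar>x\<bar>)" for x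
  proof -
    have "norm (complex_of_real (poisson a (x - y))) = \<bar>Im (cauchy_kernel a (y - x))\<bar>"
      unfolding imP by (simp only: norm_of_real)
    also have "\<dots> \<le> norm (cauchy_kernel a (y - x))" by (rule abs_Im_le_cmod)
    also have "\<dots> \<le> (1 + (1 + \<bar>y\<bar>) / \<bar>a\<bar>) / (1 + \<bar>x\<bar>)" using a by (intro norm_cauchy_kernel_le) auto
    finally show ?thesis .
  qed
  have b0: "b \<noteq> 0" using b by simp
  show "integrable lborel (\<lambda>x. cauchy_transform b x * of_real (poisson a (x - y)))"
    by (rule cauchy_transform_pairing(1)[OF b0 _ dec]) measurable
  have inner: "(LBINT x. cauchy_kernel b (t - x) * of_real (poisson a (x - y))) = pi * cauchy_kernel (a + b) (t - y)" for t
  proof -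
    have i: "integrable lborel (\<lambda>x. cauchy_kernel b (t - x) * cauchy_kernel a (y - x))"
      "integrable lborel (\<lambda>x. cauchy_kernel b (t - x) * cauchy_kernel (-a) (y - x))"
      using a b by (auto intro!: cauchy_kernel_prod_integrable)
    have "cauchy_kernel b (t - x) * of_real (poisson a (x - y))
      = (cauchy_kernel b (t - x) * cauchy_kernel a (y - x) - cauchy_kernel b (t - x) * cauchy_kernel (-a) (y - x)) / (2 * \<i>)" for x
      unfolding p by (simp add: right_diff_distrib)
    then have "(LBINT x. cauchy_kernel b (t - x) * of_real (poisson a (x - y)))
       = ((LBINT x. cauchy_kernel b (t - x) * cauchy_kernel a (y - x)) - (LBINT x. cauchy_kernel b (t - x) * cauchy_kernel (-a) (y - x))) / (2 * \<i>)"
      using i by simp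
    also have "\<dots> = pi * cauchy_kernel (a + b) (t - y)"
      using cauchy_kernel_prod_integral[of b a t y] cauchy_kernel_prod_integral[of b "-a" t y] a b ab
      by (simp add: add.commute)
    finally show ?thesis .
  qed
  have "(LBINT x. cauchy_transform b x * of_real (poisson a (x - y)))
     = (LBINT t. of_real (g t) * (LBINT x. cauchy_kernel b (t - x) * of_real (poisson a (x - y))))"
    by (rule cauchy_transform_pairing(2)[OF b0 _ dec]) measurable
  also have "\<dots> = (LBINT t. pi * (of_real (g t) * cauchy_kernel (a + b) (t - y)))"
    unfolding inner by (simp add: mult_ac)
  also have "\<dots> = pi * cauchy_transform (a + b) y"
    unfolding cauchy_transform_def by (rule integral_mult_right_zero)
  finally show "(LBINT x. cauchy_transform b x * of_real (poisson a (x - y))) = pi * cauchy_transform (a + b) y" .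
qed

text \<open>The truncated \<open>1/v\<close> minus the conjugate Poisson kernel is odd and bounded
  by \<open>poisson e\<close>, both inside and outside \<open>|v| <= e\<close>. Oddness makes its
  integral 0, so \<open>g x\<close> may be subtracted and only the deviation at \<open>x\<close>
  remains.\<close>

lemma truncation_diff_le:
  assumes e: "e > 0"
  shows "ennreal \<bar>(LINT t:{t. \<bar>t - x\<bar> > e}|lebesgue. g t / (t - x)) - Re (cauchy_transform e x)\<bar>
     \<le> (\<integral>\<^sup>+t. ennreal (poisson e (t - x) * \<bar>g t - g x\<bar>) \<partial>lborel)"
proof -
  define k where "k v = (if \<bar>v\<bar> > e then 1 / v else 0) - v / (e^2 + v^2)" for v :: real
  have [measurable]: "k \<in> borel_measurable borel" unfolding k_def by measurable
  have k_le: "\<bar>k v\<bar> \<le> poisson e v" for v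
  proof (cases "\<bar>v\<bar> > e")
    case True
    have w: "e^2 + v^2 > 0" using e by (simp add: add_pos_nonneg)
    have v: "v \<noteq> 0" using True e by auto
    have "k v = e^2 / (v * (e^2 + v^2))" using True w v by (simp add: k_def divide_simps) (simp add: algebra_simps power2_eq_square)
    then have "\<bar>k v\<bar> = e / \<bar>v\<bar> * (e / (e^2 + v^2))" using w by (simp add: abs_mult power2_eq_square)
    also have "\<dots> \<le> 1 * (e / (e^2 + v^2))" using True e w by (intro mult_right_mono) auto
    finally show ?thesis by (simp add: poisson_def)
  next
    case False
    have w: "e^2 + v^2 > 0" using e by (simp add: add_pos_nonneg)
    then show ?thesis using False by (simp add: k_def poisson_def divide_right_mono)
  qed
  have p_le: "poisson e v \<le> 1 / e" for v
  proof -
    have "e / (e^2 + v^2) \<le> e / e^2" using e by (intro divide_left_mono mult_pos_pos) (auto simp: add_pos_nonneg)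
    then show ?thesis using e by (simp add: poisson_def power2_eq_square)
  qed
  have k_odd: "k (-v) = - k v" for v by (auto simp: k_def)
  have trunc: "(LINT t:{t. \<bar>t - x\<bar> > e}|lebesgue. g t / (t - x)) = (LBINT t. g t * (if \<bar>t - x\<bar> > e then 1 / (t - x) else 0))"
  proof -
    have "(LINT t:{t. \<bar>t - x\<bar> > e}|lebesgue. g t / (t - x)) = (\<integral>t. g t * (if \<bar>t - x\<bar> > e then 1 / (t - x) else 0) \<partial>lebesgue)"
      unfolding set_lebesgue_integral_def by (intro Bochner_Integration.integral_cong) (auto split: split_indicator)
    also have "\<dots> = (LBINT t. g t * (if \<bar>t - x\<bar> > e then 1 / (t - x) else 0))"
      by (rule integral_completion) measurable
    finally show ?thesis .
  qed
  have i1: "integrable lborel (\<lambda>t. g t * (if \<bar>t - x\<bar> > e then 1 / (t - x) else 0))"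
    by (rule integrable_mult_bounded_real(1)[where C="1 / e"]) (use e in \<open>auto simp: frac_le\<close>)
  have P: "integrable lborel (\<lambda>t. poisson e (t - x))" using has_bochner_integral_poisson[OF e] by (rule integrable.intros)
  have i3: "integrable lborel (\<lambda>t. k (t - x))"
    by (rule Bochner_Integration.integrable_bound[OF P]) (auto intro!: AE_I2 order_trans[OF k_le])
  have i2: "integrable lborel (\<lambda>t. g t * k (t - x))"
    by (rule integrable_mult_bounded_real(1)[where C="1 / e"])
      (auto intro!: order_trans[OF k_le p_le])
  have "(LINT t:{t. \<bar>t - x\<bar> > e}|lebesgue. g t / (t - x)) - Re (cauchy_transform e x) = (LBINT t. g t * k (t - x))"
    unfolding trunc using Re_cauchy_transform[of e x] e i1 by (simp add: k_def right_diff_distrib)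
  also have "\<dots> = (LBINT t. (g t - g x) * k (t - x))"
    using i2 i3 odd_kernel_integral[of k x] k_odd by (simp add: left_diff_distrib)
  finally have eq: "(LINT t:{t. \<bar>t - x\<bar> > e}|lebesgue. g t / (t - x)) - Re (cauchy_transform e x) = (LBINT t. (g t - g x) * k (t - x))" .
  have "ennreal (norm (LBINT t. (g t - g x) * k (t - x))) \<le> (\<integral>\<^sup>+t. ennreal (norm ((g t - g x) * k (t - x))) \<partial>lborel)"
    using i2 i3 by (intro integral_norm_bound_ennreal) (simp add: left_diff_distrib)
  also have "\<dots> \<le> (\<integral>\<^sup>+t. ennreal (poisson e (t - x) * \<bar>g t - g x\<bar>) \<partial>lborel)"
    using k_le by (intro nn_integral_mono ennreal_leI) (simp add: abs_mult mult.commute[of "poisson e _"] mult_left_mono)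
  finally show ?thesis unfolding eq by simp
qed

end

section \<open>Boundary values\<close>

lemma AE_summable_of_summable_integral:
  fixes f :: "nat \<Rightarrow> real \<Rightarrow> real"
  assumes f: "\<And>k. integrable lborel (f k)" and s: "summable (\<lambda>k. LBINT x. \<bar>f k x\<bar>)"
  shows "AE x in lborel. summable (\<lambda>k. \<bar>f k x\<bar>)"
proof -
  have [measurable]: "f k \<in> borel_measurable borel" for k using borel_measurable_integrable[OF f[of k]] by simp
  have "(\<integral>\<^sup>+x. (\<Sum>k. ennreal \<bar>f k x\<bar>) \<partial>lborel) = (\<Sum>k. \<integral>\<^sup>+x. ennreal \<bar>f k x\<bar> \<partial>lborel)"
    by (rule nn_integral_suminf) measurable
  also have "\<dots> = (\<Sum>k. ennreal (LBINT x. \<bar>f k x\<bar>))"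
    using f by (simp add: nn_integral_eq_integral)
  also have "\<dots> \<noteq> \<infinity>" using s by (simp add: suminf_ennreal2)
  finally have "AE x in lborel. (\<Sum>k. ennreal \<bar>f k x\<bar>) \<noteq> \<infinity>"
    by (intro nn_integral_noteq_infinite) auto
  then show ?thesis
    by eventually_elim (auto intro: summable_suminf_not_top)
qed

context bounded_support
begin

text \<open>Boundary values of the real part are constructed without any principal value. The last
  property determines \<open>h\<close> through its Poisson integrals, which is enough to identify it
  with \<open>pi\<close> times the Hilbert transform at Lebesgue points.\<close>

lemma boundary_function:
  obtains h :: "real \<Rightarrow> real" where "h \<in> borel_measurable borel" "integrable lborel (\<lambda>x. h x / (1 + x^2))"
    "\<And>a y. a > 0 \<Longrightarrow> (LBINT x. poisson a (x - y) * h x) = pi * Re (cauchy_transform a y)"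
proof -
  obtain b where b: "\<And>k. b k > 0" "b \<longlonglongrightarrow> 0"
    "\<And>k. (LBINT x. (norm (cauchy_transform (b (Suc k)) x - cauchy_transform (b k) x))^2) \<le> (1/4)^k"
    using fast_L2_sequence by blast
  define w where "w x = 1 / (1 + x^2)" for x :: real
  have w: "0 < w x" "w x \<le> 1" for x by (auto simp: w_def add_pos_nonneg)
  have [measurable]: "w \<in> borel_measurable borel" unfolding w_def by measurable
  have wI: "integrable lborel w" "(LBINT x. w x) = pi"
    using has_bochner_integral_Cauchy_density unfolding w_def[abs_def]
    by (auto dest: integrable.intros has_bochner_integral_integral_eq)
  \<comment> \<open>The weight \<open>1/(1 + x^2)\<close> turns convergence in \<open>L^2\<close>
    into convergence in \<open>L^1\<close>; it is removed again in \<open>h\<close>.\<close>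
  define F where "F k x = w x * Re (cauchy_transform (b k) x)" for k x
  define D where "D k x = F (Suc k) x - F k x" for k x
  define n where "n k x = norm (cauchy_transform (b (Suc k)) x - cauchy_transform (b k) x)" for k x
  have [measurable]: "F k \<in> borel_measurable borel" "D k \<in> borel_measurable borel" for k
    unfolding F_def D_def by measurable
  have D_le: "\<bar>D k x\<bar> \<le> 2^k / 2 * (n k x)^2 + (1/2)^k / 2 * w x" for k x
  proof -
    have "\<bar>Re (cauchy_transform (b (Suc k)) x) - Re (cauchy_transform (b k) x)\<bar> \<le> n k x"
      unfolding n_def minus_complex.sel[symmetric] by (rule abs_Re_le_cmod)
    moreover have "D k x = w x * (Re (cauchy_transform (b (Suc k)) x) - Re (cauchy_transform (b k) x))"
      by (simp add: D_def F_def right_diff_distrib)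
    ultimately have "\<bar>D k x\<bar> \<le> w x * n k x" using w[of x] by (simp add: abs_mult)
    \<comment> \<open>Young's inequality with parameter \<open>2^k\<close>: since the integral of
      \<open>(n k x)^2\<close> is at most \<open>4^(-k)\<close>, both terms integrate to multiples
      of \<open>2^(-k)\<close>.\<close>
    also have "w x * n k x \<le> 2^k / 2 * (n k x)^2 + (1/2)^k / 2 * (w x)^2"
    proof -
      have "0 \<le> (1/2)^k / 2 * (2^k * n k x - w x)^2" by simp
      also have "\<dots> = ((1/2)^k * 2^k) * (2^k / 2 * (n k x)^2) - ((1/2)^k * 2^k) * (w x * n k x) + (1/2)^k / 2 * (w x)^2"
        by (simp add: power2_eq_square algebra_simps)
      also have "(1/2)^k * 2^k = (1::real)" by (simp flip: power_mult_distrib)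
      finally show ?thesis by simp
    qed
    also have "(w x)^2 \<le> w x" using w[of x] by (simp add: power2_eq_square mult_left_le)
    finally show ?thesis by (simp add: mult_left_mono)
  qed
  have EI: "integrable lborel (\<lambda>x. 2^k / 2 * (n k x)^2 + (1/2)^k / 2 * w x)" for k
    unfolding n_def using wI b by (intro Bochner_Integration.integrable_add integrable_mult_right L2_distance(1))
  have DI: "integrable lborel (D k)" for k
    by (rule Bochner_Integration.integrable_bound[OF EI[of k]]) (auto intro!: AE_I2 order_trans[OF D_le])
  have Dint: "(LBINT x. \<bar>D k x\<bar>) \<le> (1 + pi) / 2 * (1/2)^k" for k
  proof -
    have i: "integrable lborel (\<lambda>x. (n k x)^2)" unfolding n_def using b by (intro L2_distance(1))
    have "(LBINT x. \<bar>D k x\<bar>) \<le> (LBINT x. 2^k / 2 * (n k x)^2 + (1/2)^k / 2 * w x)"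
      using DI D_le EI by (intro integral_mono) auto
    also have "\<dots> = 2^k / 2 * (LBINT x. (n k x)^2) + (1/2)^k / 2 * pi"
      using i wI by simp
    also have "\<dots> \<le> 2^k / 2 * (1/4)^k + (1/2)^k / 2 * pi"
      using b(3)[of k] unfolding n_def by (intro add_right_mono mult_left_mono) auto
    also have "2^k / 2 * (1/4)^k = (1/2)^k / (2::real)"
      by (simp add: power_divide power_mult_distrib[symmetric] field_simps)
    finally show ?thesis by (simp add: field_simps)
  qed
  have geo: "summable (\<lambda>k. (1 + pi) / 2 * (1/2)^k)" by (intro summable_mult summable_geometric) simp
  have Ds: "summable (\<lambda>k. LBINT x. \<bar>D k x\<bar>)"
    by (rule summable_comparison_test'[OF geo, of 0]) (use Dint in auto)
  have AEs: "AE x in lborel. summable (\<lambda>k. \<bar>D k x\<bar>)"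
    by (rule AE_summable_of_summable_integral[OF DI Ds])
  have SI: "integrable lborel (\<lambda>x. \<Sum>k. D k x)"
    by (rule integrable_suminf[OF DI]) (use AEs Ds in auto)
  have GI: "integrable lborel (\<lambda>x. \<Sum>k. \<bar>D k x\<bar>)"
    by (rule integrable_suminf[OF integrable_abs[OF DI]]) (use AEs Ds in auto)
  have FI: "integrable lborel (F k)" for k
  proof -
    have b0: "b k \<noteq> 0" using b(1)[of k] by simp
    have "norm (complex_of_real (w x)) \<le> 2 / (1 + \<bar>x\<bar>)" for x
    proof -
      have "1 + \<bar>x\<bar> \<le> 2 * (1 + x^2)"
      proof -
        have "2 * \<bar>x\<bar> \<le> 1 + x^2" using zero_le_power2[of "\<bar>x\<bar> - 1"] by (simp add: power2_eq_square algebra_simps)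
        moreover have "2 * y \<le> 1 + q \<Longrightarrow> 0 \<le> q \<Longrightarrow> 1 + y \<le> 2 * (1 + q)" for y q :: real by simp
        ultimately show ?thesis using zero_le_power2[of x] by blast
      qed
      then have "2 / (2 * (1 + x^2)) \<le> 2 / (1 + \<bar>x\<bar>)"
        by (intro divide_left_mono mult_pos_pos) (auto simp: add_pos_nonneg)
      moreover have "2 / (2 * r) = 1 / r" for r :: real by simp
      then have "2 / (2 * (1 + x^2)) = w x" unfolding w_def by blast
      ultimately show ?thesis using w[of x] by (simp only: norm_of_real abs_of_pos)
    qed
    from cauchy_transform_pairing(1)[OF b0 _ this]
    have "integrable lborel (\<lambda>x. cauchy_transform (b k) x * of_real (w x))" by simp
    from integrable_Re[OF this] show ?thesis by (simp add: F_def[abs_def] mult.commute)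
  qed
  define H where "H x = F 0 x + (\<Sum>k. D k x)" for x
  have HI: "integrable lborel H" unfolding H_def[abs_def] using FI SI by (intro Bochner_Integration.integrable_add)
  have [measurable]: "H \<in> borel_measurable borel" using borel_measurable_integrable[OF HI] by simp
  define h where "h x = H x * (1 + x^2)" for x
  have hH: "h x / (1 + x^2) = H x" for x
  proof -
    have "1 + x^2 \<noteq> 0" using add_pos_nonneg[of 1 "x^2"] by auto
    then show ?thesis by (simp add: h_def)
  qed
  have tel: "F m x = F 0 x + (\<Sum>k<m. D k x)" for m x
  proof -
    have "(\<Sum>k<m. D k x) = F m x - F 0 x"
      unfolding D_def by (rule sum_lessThan_telescope)
    then show ?thesis by linarith
  qed
  have AElim: "AE x in lborel. (\<lambda>m. F m x) \<longlonglongrightarrow> H x \<and> (\<forall>m. \<bar>F m x\<bar> \<le> \<bar>F 0 x\<bar> + (\<Sum>k. \<bar>D k x\<bar>))"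
    using AEs
  proof eventually_elim
    case (elim x)
    have "(\<lambda>m. F 0 x + (\<Sum>k<m. D k x)) \<longlonglongrightarrow> H x"
      unfolding H_def by (intro tendsto_add tendsto_const summable_LIMSEQ summable_rabs_cancel[OF elim])
    moreover have "\<bar>F m x\<bar> \<le> \<bar>F 0 x\<bar> + (\<Sum>k. \<bar>D k x\<bar>)" for m
    proof -
      have "\<bar>F m x\<bar> \<le> \<bar>F 0 x\<bar> + (\<Sum>k<m. \<bar>D k x\<bar>)"
        unfolding tel[of m] using sum_abs[of "\<lambda>k. D k x" "{..<m}"] by linarith
      also have "(\<Sum>k<m. \<bar>D k x\<bar>) \<le> (\<Sum>k. \<bar>D k x\<bar>)" by (intro sum_le_suminf elim) auto
      finally show ?thesis by simp
    qed
    ultimately show ?case by (simp add: tel[symmetric])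
  qed
  show thesis
  proof (rule that[of h])
    show "h \<in> borel_measurable borel" unfolding h_def by measurable
    show "integrable lborel (\<lambda>x. h x / (1 + x^2))" unfolding hH by (rule HI)
    fix a y :: real assume a: "a > 0"
    define K where "K = a * ((1 + 2 * y^2) / a^2 + 2)"
    define u where "u x = poisson a (x - y) * (1 + x^2)" for x
    have u: "\<bar>u x\<bar> \<le> K" for x
    proof -
      have p: "1 + x^2 > 0" by (simp add: add_pos_nonneg)
      have "poisson a (x - y) * (1 + x^2) \<le> K * (1 / (1 + x^2)) * (1 + x^2)"
        unfolding K_def using poisson_bound[of a a x y] a p by (intro mult_right_mono) auto
      then show ?thesis using p poisson_nonneg[of a "x - y"] a by (simp add: u_def)
    qed
    have uF: "u x * F m x = poisson a (x - y) * Re (cauchy_transform (b m) x)" for x m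
    proof -
      have "1 + x^2 \<noteq> 0" using add_pos_nonneg[of 1 "x^2"] by auto
      then show ?thesis by (simp add: u_def F_def w_def)
    qed
    \<comment> \<open>The Poisson integral of the transform at height \<open>b m\<close> is known
      from the semigroup property, and both sides of that identity converge as \<open>m\<close>
      grows. The series of the \<open>|D k x|\<close> dominates all \<open>F m\<close>.\<close>
    have "(\<lambda>m. LBINT x. u x * F m x) \<longlonglongrightarrow> (LBINT x. u x * H x)"
    proof (rule integral_dominated_convergence[where w="\<lambda>x. K * (\<bar>F 0 x\<bar> + (\<Sum>k. \<bar>D k x\<bar>))"])
      show "(\<lambda>x. u x * H x) \<in> borel_measurable lborel" "(\<lambda>x. u x * F m x) \<in> borel_measurable lborel" for m
        unfolding u_def by measurable
      show "integrable lborel (\<lambda>x. K * (\<bar>F 0 x\<bar> + (\<Sum>k. \<bar>D k x\<bar>)))"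
        using FI GI by (intro integrable_mult_right Bochner_Integration.integrable_add integrable_abs)
      show "AE x in lborel. (\<lambda>m. u x * F m x) \<longlonglongrightarrow> u x * H x"
        using AElim by eventually_elim (intro tendsto_intros, auto)
      show "AE x in lborel. norm (u x * F m x) \<le> K * (\<bar>F 0 x\<bar> + (\<Sum>k. \<bar>D k x\<bar>))" for m
        using AElim by eventually_elim (use u in \<open>auto simp: abs_mult intro!: mult_mono intro: order_trans[OF abs_ge_zero]\<close>)
    qed
    moreover have "(\<lambda>m. LBINT x. u x * F m x) \<longlonglongrightarrow> pi * Re (cauchy_transform a y)"
    proof (rule Lim_transform_eventually)
      show "(\<lambda>m. pi * Re (cauchy_transform (a + b m) y)) \<longlonglongrightarrow> pi * Re (cauchy_transform a y)"
        by (intro tendsto_intros cauchy_transform_tendsto_shift a b)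
      have "eventually (\<lambda>m. b m < a) sequentially" using order_tendstoD(2)[OF b(2) a] .
      then show "eventually (\<lambda>m. pi * Re (cauchy_transform (a + b m) y) = (LBINT x. u x * F m x)) sequentially"
      proof eventually_elim
        case (elim m)
        then have ne: "b m \<noteq> a" by simp
        note pc = poisson_cauchy_transform[OF a b(1) ne, of y]
        have "(LBINT x. Re (cauchy_transform (b m) x * of_real (poisson a (x - y)))) = Re (pi * cauchy_transform (a + b m) y)"
          unfolding pc(2)[symmetric] by (rule integral_Re[OF pc(1)])
        then show ?case unfolding uF by (simp add: mult.commute)
      qed
    qed
    ultimately have "(LBINT x. u x * H x) = pi * Re (cauchy_transform a y)" by (rule LIMSEQ_unique)
    then show "(LBINT x. poisson a (x - y) * h x) = pi * Re (cauchy_transform a y)"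
      by (simp add: u_def h_def mult_ac)
  qed
qed

text \<open>At common Lebesgue points of \<open>g\<close> and \<open>h\<close> the truncated
  integral differs from \<open>Re (cauchy_transform e x)\<close> by an amount tending to 0, and the
  latter is a Poisson average of \<open>h\<close>. So the limit in \<open>hilbert_transform\<close>
  is proved to exist there, and an unspecified value can occur only on a null set.\<close>

lemma hilbert_transform_eq_boundary_function:
  assumes [measurable]: "h \<in> borel_measurable borel" and hI: "integrable lborel (\<lambda>x. h x / (1 + x^2))"
    and h: "\<And>a y. a > 0 \<Longrightarrow> (LBINT x. poisson a (x - y) * h x) = pi * Re (cauchy_transform a y)"
  shows "AE x in lborel. hilbert_transform g x = h x / pi"
  using poisson_deviation_tendsto[OF weighted_integrable borel] poisson_deviation_tendsto[OF hI assms(1)]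
proof eventually_elim
  case (elim x)
  let ?T = "\<lambda>e. LINT t:{t. \<bar>t - x\<bar> > e}|lebesgue. g t / (t - x)"
  have "((\<lambda>a. (LBINT t. poisson a (t - x) * h t) / pi) \<longlongrightarrow> pi * h x / pi) (at_right 0)"
    by (intro tendsto_intros poisson_tendsto_of_deviation[OF hI assms(1) elim(2)]) auto
  then have C0: "((\<lambda>a. (LBINT t. poisson a (t - x) * h t) / pi) \<longlongrightarrow> h x) (at_right 0)"
    by simp
  have C: "((\<lambda>a. Re (cauchy_transform a x)) \<longlongrightarrow> h x) (at_right 0)"
  proof (rule Lim_transform_eventually[OF C0])
    show "eventually (\<lambda>a. (LBINT t. poisson a (t - x) * h t) / pi = Re (cauchy_transform a x)) (at_right 0)"
      using eventually_at_right_less[of 0] by eventually_elim (simp add: h)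
  qed
  have "((\<lambda>e. ennreal \<bar>?T e - Re (cauchy_transform e x)\<bar>) \<longlongrightarrow> 0) (at_right 0)"
    using eventually_at_right_less[of 0]
    by (intro tendsto_sandwich[OF _ _ tendsto_const elim(1)]) (auto elim!: eventually_mono intro: truncation_diff_le)
  then have "((\<lambda>e. \<bar>?T e - Re (cauchy_transform e x)\<bar>) \<longlongrightarrow> 0) (at_right 0)"
    by (simp add: ennreal_0[symmetric] tendsto_ennreal_iff del: ennreal_0)
  then have "((\<lambda>e. ?T e - Re (cauchy_transform e x)) \<longlongrightarrow> 0) (at_right 0)"
    by (simp add: tendsto_rabs_zero_iff)
  from tendsto_add[OF this C] have "(?T \<longlongrightarrow> h x) (at_right 0)" by simp
  then have "Lim (at_right 0) ?T = h x" by (intro tendsto_Lim) auto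
  then show ?case by (simp add: hilbert_transform_def)
qed

text \<open>Poisson averaging does not increase the \<open>L^1\<close> norm, by Tonelli and the mass
  of the kernel. The bound holds in \<open>[0, \<infinity>]\<close> and is uniform in
  \<open>a\<close>.\<close>

lemma nn_integral_Re_cauchy_transform_le:
  assumes a: "a > 0"
  shows "(\<integral>\<^sup>+x. ennreal \<bar>Re (cauchy_transform a x)\<bar> \<partial>lborel) \<le> ennreal pi * L1_norm (hilbert_transform g)"
proof -
  obtain h where h: "h \<in> borel_measurable borel" "integrable lborel (\<lambda>x. h x / (1 + x^2))"
    "\<And>a y. a > 0 \<Longrightarrow> (LBINT x. poisson a (x - y) * h x) = pi * Re (cauchy_transform a y)"
    using boundary_function by blast
  note [measurable] = h(1)
  have "AE x in lebesgue. hilbert_transform g x = h x / pi"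
    using hilbert_transform_eq_boundary_function[OF h] by (rule AE_completion)
  then have "AE x in lebesgue. ennreal \<bar>hilbert_transform g x\<bar> = ennreal \<bar>h x / pi\<bar>"
    by eventually_elim simp
  then have "L1_norm (hilbert_transform g) = (\<integral>\<^sup>+x. ennreal \<bar>h x / pi\<bar> \<partial>lebesgue)"
    unfolding L1_norm_def by (rule nn_integral_cong_AE)
  also have "\<dots> = (\<integral>\<^sup>+x. ennreal \<bar>h x / pi\<bar> \<partial>lborel)" by (rule nn_integral_completion)
  finally have "ennreal pi * L1_norm (hilbert_transform g) = (\<integral>\<^sup>+x. ennreal pi * ennreal \<bar>h x / pi\<bar> \<partial>lborel)"
    by (simp add: nn_integral_cmult)
  also have "\<dots> = (\<integral>\<^sup>+x. ennreal \<bar>h x\<bar> \<partial>lborel)"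
    by (intro nn_integral_cong) (simp add: ennreal_mult[symmetric])
  finally have L1: "ennreal pi * L1_norm (hilbert_transform g) = (\<integral>\<^sup>+x. ennreal \<bar>h x\<bar> \<partial>lborel)" .
  have "(\<integral>\<^sup>+y. ennreal \<bar>Re (cauchy_transform a y)\<bar> \<partial>lborel) \<le> (\<integral>\<^sup>+y. \<integral>\<^sup>+x. ennreal (poisson a (x - y) / pi) * ennreal \<bar>h x\<bar> \<partial>lborel \<partial>lborel)"
  proof (rule nn_integral_mono)
    fix y
    have i: "integrable lborel (\<lambda>x. (poisson a (x - y) * h x) / pi)"
      using poisson_times_integrable[OF h(2,1) a] by (intro integrable_divide) auto
    have "Re (cauchy_transform a y) = (LBINT x. (poisson a (x - y) * h x) / pi)"
      using h(3)[OF a, of y] by simp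
    then have "ennreal \<bar>Re (cauchy_transform a y)\<bar> \<le> (\<integral>\<^sup>+x. ennreal (norm ((poisson a (x - y) * h x) / pi)) \<partial>lborel)"
      using integral_norm_bound_ennreal[OF i] by simp
    also have "\<dots> = (\<integral>\<^sup>+x. ennreal (poisson a (x - y) / pi) * ennreal \<bar>h x\<bar> \<partial>lborel)"
      using poisson_nonneg[of a] a by (intro nn_integral_cong) (simp add: abs_mult ennreal_mult[symmetric])
    finally show "ennreal \<bar>Re (cauchy_transform a y)\<bar> \<le> (\<integral>\<^sup>+x. ennreal (poisson a (x - y) / pi) * ennreal \<bar>h x\<bar> \<partial>lborel)" .
  qed
  also have "\<dots> = (\<integral>\<^sup>+x. \<integral>\<^sup>+y. ennreal (poisson a (x - y) / pi) * ennreal \<bar>h x\<bar> \<partial>lborel \<partial>lborel)"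
    by (rule lborel_pair.Fubini') measurable
  also have "\<dots> = (\<integral>\<^sup>+x. ennreal \<bar>h x\<bar> \<partial>lborel)"
  proof (rule nn_integral_cong)
    fix x
    have "(\<integral>\<^sup>+y. ennreal (poisson a (x - y) / pi) \<partial>lborel) = (\<integral>\<^sup>+y. ennreal (1 / pi) * ennreal (poisson a (y - x)) \<partial>lborel)"
      using poisson_minus[of a "_ - x"] poisson_nonneg[of a] a
      by (intro nn_integral_cong) (simp add: ennreal_mult[symmetric])
    also have "\<dots> = ennreal (1 / pi) * ennreal pi"
      by (subst nn_integral_cmult) (auto simp: nn_integral_poisson[OF a])
    also have "\<dots> = 1" by (simp add: ennreal_mult[symmetric])
    finally show "(\<integral>\<^sup>+y. ennreal (poisson a (x - y) / pi) * ennreal \<bar>h x\<bar> \<partial>lborel) = ennreal \<bar>h x\<bar>"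
      by (subst nn_integral_multc) auto
  qed
  finally show ?thesis by (simp add: L1)
qed

end

section \<open>Jensen's inequality for the Cauchy transform\<close>

text \<open>At \<open>l = 0\<close> the convention \<open>ln 0 = 0\<close> makes the left side
  \<open>ennreal D\<close>, while \<open>y n < 1\<close> eventually makes the terms on the right at
  least that. So Fatou's lemma tolerates zeros of the limit.\<close>

lemma ennreal_minus_ln_le_liminf:
  fixes y :: "nat \<Rightarrow> real"
  assumes y: "\<And>n. 0 \<le> y n" "y \<longlonglongrightarrow> l"
  shows "ennreal (D - ln l) \<le> liminf (\<lambda>n. ennreal (D - ln (y n)))"
proof (cases "l = 0")
  case False
  have "(\<lambda>n. ennreal (D - ln (y n))) \<longlonglongrightarrow> ennreal (D - ln l)"
    by (intro tendsto_ennrealI tendsto_diff tendsto_const tendsto_ln y False)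
  then show ?thesis by (simp add: lim_imp_Liminf)
next
  case True
  have "eventually (\<lambda>n. y n < 1) sequentially"
    using order_tendstoD(2)[OF y(2), of 1] True by simp
  then have "eventually (\<lambda>n. ennreal (D - ln l) \<le> ennreal (D - ln (y n))) sequentially"
  proof eventually_elim
    case (elim n)
    have "ln (y n) \<le> 0" using elim y(1)[of n] by (cases "y n = 0") auto
    then show ?case using True by (intro ennreal_leI) simp
  qed
  then show ?thesis by (rule Liminf_bounded)
qed

lemma ln_norm_le:
  fixes z :: "'a::real_normed_algebra_1"
  shows "ln (norm (1 + z)) \<le> norm z"
proof (cases "1 + z = 0")
  case False
  then have "ln (norm (1 + z)) \<le> norm (1 + z) - 1" by (intro ln_le_minus_one) simp
  also have "\<dots> \<le> norm z" using norm_triangle_ineq[of 1 z] by simp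
  finally show ?thesis .
qed simp

context bounded_support
begin

text \<open>\<open>2 * L * M\<close> bounds the integral of \<open>|g|\<close>; the rest is the
  constant of \<open>cauchy_kernel_diff_le\<close>. The slack from \<open>L\<close> to
  \<open>L + 1\<close> accommodates points displaced by the discretisation.\<close>

definition decay_const :: "real \<Rightarrow> real" where
  "decay_const a = 2 * L * M * ((L + 1) * (1 + (2 + L) / a)^2)"

text \<open>The resolvent identity writes the difference as \<open>- t\<close> times a product of
  two kernels, which gains one order of decay.\<close>

lemma cauchy_kernel_diff_le:
  assumes a: "a > 0" and t: "\<bar>t\<bar> \<le> L + 1"
  shows "norm (cauchy_kernel a (t - x) - cauchy_kernel a (- x)) \<le> (L + 1) * (1 + (2 + L) / a)^2 * (1 / (1 + x^2))"
proof -
  have nz: "complex_of_real (t - x) - \<i> * a \<noteq> 0" "complex_of_real (0 - x) - \<i> * a \<noteq> 0"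
    using cauchy_kernel_denom[of a] a by auto
  have e: "cauchy_kernel a (t - x) - cauchy_kernel a (- x) = - of_real t * (cauchy_kernel a (t - x) * cauchy_kernel a (0 - x))"
    using nz unfolding cauchy_kernel_def by (simp add: field_simps)
  define d where "d = 1 + (1 + (L + 1)) / \<bar>a\<bar>"
  have n: "norm (cauchy_kernel a (t - x)) \<le> d / (1 + \<bar>x\<bar>)" "norm (cauchy_kernel a (0 - x)) \<le> d / (1 + \<bar>x\<bar>)"
    unfolding d_def by (rule norm_cauchy_kernel_le; use a t L_pos in simp)+
  have d0: "d \<ge> 0" using L_pos by (simp add: d_def)
  have "norm (cauchy_kernel a (t - x) * cauchy_kernel a (0 - x)) \<le> (d / (1 + \<bar>x\<bar>)) * (d / (1 + \<bar>x\<bar>))"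
    unfolding norm_mult using n d0 by (intro mult_mono) auto
  also have "\<dots> = d^2 * (1 / ((1 + \<bar>x\<bar>) * (1 + \<bar>x\<bar>)))" by (simp add: power2_eq_square)
  also have "\<dots> \<le> d^2 * (1 / (1 + x^2))" by (intro mult_left_mono inverse_square_le_Cauchy_density) auto
  finally have "\<bar>t\<bar> * norm (cauchy_kernel a (t - x) * cauchy_kernel a (0 - x)) \<le> (L + 1) * (d^2 * (1 / (1 + x^2)))"
    using t L_pos by (intro mult_mono) auto
  then have "norm (cauchy_kernel a (t - x) - cauchy_kernel a (- x)) \<le> (L + 1) * (d^2 * (1 / (1 + x^2)))"
    unfolding e norm_mult[of "- of_real t"] by simp
  moreover have "d = 1 + (2 + L) / a" using a by (simp add: d_def)
  ultimately show ?thesis by (simp only: mult.assoc)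
qed

text \<open>With mass 0 this gives an integrable majorant for the logarithm; with nonzero mass it
  isolates the tail that contradicts integrability in
  \<open>integral_zero_of_hilbert_integrable\<close>. The map \<open>\<tau>\<close> covers both the
  identity and the rounding to a grid.\<close>

lemma perturbed_transform_decay:
  assumes a: "a > 0" and [measurable]: "\<tau> \<in> borel_measurable borel" and \<tau>: "\<And>t. \<bar>t\<bar> \<le> L \<Longrightarrow> \<bar>\<tau> t\<bar> \<le> L + 1"
  shows "norm ((LBINT t. of_real (g t) * cauchy_kernel a (\<tau> t - x)) - of_real (LBINT t. g t) * cauchy_kernel a (- x))
    \<le> decay_const a * (1 / (1 + x^2))"
proof -
  have i1: "integrable lborel (\<lambda>t. of_real (g t) * cauchy_kernel a (\<tau> t - x))"
    by (rule integrable_mult_bounded(1)[where C="(1 + (1 + (L + 1)) / \<bar>a\<bar>) / (1 + \<bar>x\<bar>)"])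
      (measurable, rule norm_cauchy_kernel_le, use a \<tau> in auto)
  have i2: "integrable lborel (\<lambda>t. of_real (g t) * cauchy_kernel a (- x))"
    by (rule integrable_mult_bounded(1)[where C="norm (cauchy_kernel a (- x))"]) auto
  have "(LBINT t. of_real (g t) * cauchy_kernel a (- x)) = of_real (LBINT t. g t) * cauchy_kernel a (- x)"
    by (simp only: integral_mult_left_zero integral_complex_of_real)
  then have "(LBINT t. of_real (g t) * cauchy_kernel a (\<tau> t - x)) - of_real (LBINT t. g t) * cauchy_kernel a (- x)
     = (LBINT t. of_real (g t) * (cauchy_kernel a (\<tau> t - x) - cauchy_kernel a (- x)))"
    using Bochner_Integration.integral_diff[OF i1 i2] by (simp only: right_diff_distrib)
  also have "norm \<dots> \<le> 2 * L * M * ((L + 1) * (1 + (2 + L) / a)^2 * (1 / (1 + x^2)))"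
    by (rule integrable_mult_bounded(2)) (use a \<tau> cauchy_kernel_diff_le in auto)
  finally show ?thesis by (simp add: decay_const_def)
qed

text \<open>
  Replacing \<open>t\<close> by a step function of \<open>t\<close> in the kernel turns the Cauchy transform into a rational
  function, to which the rational case applies; Fatou's lemma passes to the limit.
\<close>
lemma jensen_cauchy_transform:
  fixes D :: "real \<Rightarrow> real"
  assumes a: "a > 0" and g0: "(LBINT t. g t) = 0"
    and D: "integrable lborel D" "\<And>x. \<bar>r\<bar> * (decay_const a * (1 / (1 + x^2))) \<le> D x"
  shows "(\<integral>\<^sup>+x. ennreal (D x - ln (cmod (1 + \<i> * of_real r * cauchy_transform a x))) \<partial>lborel) \<le> ennreal (LBINT x. D x)"
proof -
  have [measurable]: "D \<in> borel_measurable borel" using borel_measurable_integrable[OF D(1)] by simp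
  define \<tau> where "\<tau> n t = of_int \<lfloor>real (Suc n) * t\<rfloor> / real (Suc n)" for n and t :: real
  have [measurable]: "\<tau> n \<in> borel_measurable borel" for n unfolding \<tau>_def by measurable
  have \<tau>_near: "\<bar>\<tau> n t - t\<bar> \<le> 1 / real (Suc n)" for n t
  proof -
    have "\<bar>of_int \<lfloor>real (Suc n) * t\<rfloor> - real (Suc n) * t\<bar> \<le> 1" by linarith
    moreover have "\<tau> n t - t = (of_int \<lfloor>real (Suc n) * t\<rfloor> - real (Suc n) * t) / real (Suc n)"
      by (simp add: \<tau>_def diff_divide_distrib del: of_nat_Suc)
    ultimately show ?thesis by (simp add: divide_right_mono del: of_nat_Suc)
  qed
  have \<tau>_bound: "\<bar>\<tau> n t\<bar> \<le> L + 1" if "\<bar>t\<bar> \<le> L" for n t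
  proof -
    have "1 / real (Suc n) \<le> 1" by simp
    then show ?thesis using \<tau>_near[of n t] that by linarith
  qed
  define V where "V n x = (LBINT t. of_real (g t) * cauchy_kernel a (\<tau> n t - x))" for n x
  have [measurable]: "V n \<in> borel_measurable borel" for n unfolding V_def by measurable
  have V_decay: "norm (V n x) \<le> decay_const a * (1 / (1 + x^2))" for n x
    using perturbed_transform_decay[where x=x and \<tau>="\<tau> n", OF a _ \<tau>_bound] g0 unfolding V_def by simp
  have V_lim: "(\<lambda>n. V n x) \<longlonglongrightarrow> cauchy_transform a x" for x
    unfolding V_def cauchy_transform_def
  proof (rule integral_dominated_convergence[where w="\<lambda>t. (M * (1 / a)) * indicator {-L..L} t"])
    show "integrable lborel (\<lambda>t. (M * (1 / a)) * indicator {-L..L} t :: real)"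
      by (intro integrable_mult_right integrable_indicator_Icc)
    show "AE t in lborel. (\<lambda>n. of_real (g t) * cauchy_kernel a (\<tau> n t - x)) \<longlonglongrightarrow> of_real (g t) * cauchy_kernel a (t - x)"
    proof (rule AE_I2)
      fix t
      have "(\<lambda>n. \<tau> n t - t) \<longlonglongrightarrow> 0"
      proof (rule Lim_null_comparison)
        show "eventually (\<lambda>n. norm (\<tau> n t - t) \<le> 1 / real (Suc n)) sequentially"
          using \<tau>_near by (simp del: of_nat_Suc)
        show "(\<lambda>n. 1 / real (Suc n)) \<longlonglongrightarrow> 0" using LIMSEQ_Suc[OF lim_1_over_n] by simp
      qed
      then have "(\<lambda>n. \<tau> n t) \<longlonglongrightarrow> t" by (simp add: LIM_zero_iff)
      then show "(\<lambda>n. of_real (g t) * cauchy_kernel a (\<tau> n t - x)) \<longlonglongrightarrow> of_real (g t) * cauchy_kernel a (t - x)"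
        unfolding cauchy_kernel_def using a cauchy_kernel_denom[of a "t - x"] by (intro tendsto_intros) auto
    qed
    show "AE t in lborel. norm (of_real (g t) * cauchy_kernel a (\<tau> n t - x)) \<le> (M * (1 / a)) * indicator {-L..L} t" for n
    proof (rule AE_I2)
      fix t
      have "\<bar>g t\<bar> * norm (cauchy_kernel a (\<tau> n t - x)) \<le> (M * indicator {-L..L} t) * (1 / a)"
        using abs_le_indicator[of t] M_pos cauchy_kernel_norm_le[OF a] by (intro mult_mono) auto
      then show "norm (of_real (g t) * cauchy_kernel a (\<tau> n t - x)) \<le> (M * (1 / a)) * indicator {-L..L} t"
        by (simp add: norm_mult mult_ac)
    qed
  qed measurable
  have step: "(\<integral>\<^sup>+x. ennreal (D x - ln (cmod (1 + \<i> * of_real r * V n x))) \<partial>lborel) \<le> ennreal (LBINT x. D x)" for n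
  proof -
    define J where "J = (\<lambda>k. of_int k / real (Suc n)) ` {\<lfloor>- real (Suc n) * L\<rfloor>..\<lfloor>real (Suc n) * L\<rfloor>}"
    have J: "finite J" by (simp add: J_def)
    have \<tau>J: "\<tau> n t \<in> J" if "\<bar>t\<bar> \<le> L" for t
    proof -
      have "- (real (Suc n) * L) \<le> real (Suc n) * t" "real (Suc n) * t \<le> real (Suc n) * L"
        using mult_left_mono[of "-L" t "real (Suc n)"] mult_left_mono[of t L "real (Suc n)"] that by auto
      then have "\<lfloor>real (Suc n) * t\<rfloor> \<in> {\<lfloor>- real (Suc n) * L\<rfloor>..\<lfloor>real (Suc n) * L\<rfloor>}"
        by (auto intro!: floor_mono simp del: of_nat_Suc)
      then show ?thesis unfolding J_def \<tau>_def by blast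
    qed
    define m where "m j = (LBINT t. g t * indicator {t. \<tau> n t = j} t)" for j
    have mi: "integrable lborel (\<lambda>t. g t * indicator {t. \<tau> n t = j} t)" for j
      by (rule integrable_mult_bounded_real(1)[where C=1]) (auto split: split_indicator)
    have dec: "of_real (g t) * c (\<tau> n t) = (\<Sum>j\<in>J. of_real (g t * indicator {t. \<tau> n t = j} t) * c j)" for t and c :: "real \<Rightarrow> complex"
    proof (cases "\<bar>t\<bar> \<le> L")
      case True
      have "(\<Sum>j\<in>J. of_real (g t * indicator {t. \<tau> n t = j} t) * c j) = (\<Sum>j\<in>J. if j = \<tau> n t then of_real (g t) * c j else 0)"
        by (intro sum.cong) auto
      then show ?thesis using \<tau>J[OF True] J by simp
    next
      case False
      then show ?thesis using support[of t] by simp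
    qed
    have Vsum: "(LBINT t. of_real (g t) * c (\<tau> n t)) = (\<Sum>j\<in>J. of_real (m j) * c j)" for c :: "real \<Rightarrow> complex"
    proof -
      have "integrable lborel (\<lambda>t. of_real (g t * indicator {t. \<tau> n t = j} t) * c j)" for j
        using mi by (intro integrable_mult_left integrable_of_real)
      then have "(LBINT t. of_real (g t) * c (\<tau> n t)) = (\<Sum>j\<in>J. LBINT t. of_real (g t * indicator {t. \<tau> n t = j} t) * c j)"
        unfolding dec by (intro Bochner_Integration.integral_sum)
      also have "\<dots> = (\<Sum>j\<in>J. of_real (m j) * c j)"
        unfolding m_def by (simp only: integral_mult_left_zero integral_complex_of_real)
      finally show ?thesis .
    qed
    \<comment> \<open>The constant \<open>c = 1\<close> shows that rounding preserves the total mass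
      0, which \<open>jensen_rational\<close> requires of the residues.\<close>
    have "complex_of_real (\<Sum>j\<in>J. m j) = of_real (LBINT t. g t)"
      using Vsum[of "\<lambda>_. 1"] by (simp only: mult_1_right of_real_sum integral_complex_of_real)
    then have "(\<Sum>j\<in>J. m j) = 0" unfolding g0 of_real_0 of_real_eq_0_iff .
    then have m0: "(\<Sum>j\<in>J. r * m j) = 0" by (simp add: sum_distrib_left[symmetric])
    have ck: "cauchy_kernel a (j - x) = - (1 / (of_real x - Complex j (-a)))" for j x
    proof -
      have "complex_of_real (j - x) - \<i> * a = - (of_real x - Complex j (-a))" by (auto simp: complex_eq_iff)
      then show ?thesis unfolding cauchy_kernel_def by (simp only: divide_minus_right)
    qed
    have VW: "1 + \<i> * of_real r * V n x = 1 - \<i> * (\<Sum>j\<in>J. of_real (r * m j) / (of_real x - Complex j (-a)))" for x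
    proof -
      have "of_real r * V n x = - (\<Sum>j\<in>J. of_real (r * m j) / (of_real x - Complex j (-a)))"
        unfolding V_def Vsum[of "\<lambda>j. cauchy_kernel a (j - x)"] unfolding ck sum_distrib_left sum_negf[symmetric] by (intro sum.cong) auto
      then show ?thesis by (simp add: mult.assoc)
    qed
    have "ln (cmod (1 + \<i> * of_real r * V n x)) \<le> D x" for x
    proof -
      have "ln (cmod (1 + \<i> * of_real r * V n x)) \<le> norm (\<i> * of_real r * V n x)" by (rule ln_norm_le)
      also have "\<dots> = \<bar>r\<bar> * norm (V n x)" by (simp add: norm_mult)
      also have "\<dots> \<le> \<bar>r\<bar> * (decay_const a * (1 / (1 + x^2)))" by (intro mult_left_mono V_decay) auto
      also have "\<dots> \<le> D x" by (rule D)
      finally show ?thesis .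
    qed
    with jensen_rational[OF J m0 a D(1)] show ?thesis unfolding VW by blast
  qed
  have "(\<integral>\<^sup>+x. ennreal (D x - ln (cmod (1 + \<i> * of_real r * cauchy_transform a x))) \<partial>lborel)
     \<le> (\<integral>\<^sup>+x. liminf (\<lambda>n. ennreal (D x - ln (cmod (1 + \<i> * of_real r * V n x)))) \<partial>lborel)"
    by (intro nn_integral_mono ennreal_minus_ln_le_liminf tendsto_norm tendsto_add tendsto_mult tendsto_const V_lim) auto
  also have "\<dots> \<le> liminf (\<lambda>n. \<integral>\<^sup>+x. ennreal (D x - ln (cmod (1 + \<i> * of_real r * V n x))) \<partial>lborel)"
    by (rule nn_integral_liminf) measurable
  also have "\<dots> \<le> liminf (\<lambda>n::nat. ennreal (LBINT x. D x))"
    by (intro Liminf_mono always_eventually allI step)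
  also have "\<dots> = ennreal (LBINT x. D x)" by (simp add: Liminf_const)
  finally show ?thesis .
qed

text \<open>The Poisson kernel itself decays quadratically, which gives a constant uniform in
  \<open>a \<le> 1\<close>. Within \<open>|x| <= 2 L\<close> the bound \<open>pi * M\<close>
  suffices; beyond it \<open>|t - x|\<close> is at least \<open>L\<close> and at least
  \<open>|x| / 2\<close>.\<close>

lemma Im_cauchy_transform_decay:
  assumes a: "0 < a" "a \<le> 1"
  shows "\<bar>Im (cauchy_transform a x)\<bar> \<le> ((pi * M) * (1 + 4 * L^2) + 2 * L * M * (4 + 1 / L^2)) * (1 / (1 + x^2))"
proof -
  have p: "1 + x^2 > 0" by (simp add: add_pos_nonneg)
  show ?thesis
  proof (cases "\<bar>x\<bar> \<le> 2 * L")
    case True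
    then have "x^2 \<le> 4 * L^2" using power_mono[of "\<bar>x\<bar>" "2 * L" 2] by simp
    then have "1 + x^2 \<le> 1 + 4 * L^2" by simp
    then have "(pi * M) * 1 \<le> (pi * M) * ((1 + 4 * L^2) * (1 / (1 + x^2)))"
      using p M_pos by (intro mult_left_mono) auto
    moreover have "0 \<le> 2 * L * M * (4 + 1 / L^2) * (1 / (1 + x^2))" using L_pos M_pos p by auto
    ultimately show ?thesis using abs_Im_cauchy_transform_le[OF a(1), of x]
      by (simp only: distrib_right mult.assoc mult_1_right)
  next
    case False
    have "\<bar>LBINT t. g t * poisson a (t - x)\<bar> \<le> 2 * L * M * ((4 + 1 / L^2) * (1 / (1 + x^2)))"
    proof (rule integrable_mult_bounded_real(2))
      fix t assume t: "\<bar>t\<bar> \<le> L"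
      have lin: "T \<le> L \<Longrightarrow> \<not> X \<le> 2 * L \<Longrightarrow> X - T \<le> Y \<Longrightarrow> X \<le> 2 * Y \<and> L \<le> Y" for X T Y :: real by auto
      from lin[OF t False abs_triangle_ineq2_sym] have tx: "\<bar>x\<bar> \<le> 2 * \<bar>t - x\<bar>" "L \<le> \<bar>t - x\<bar>" by auto
      from tx(1) have "\<bar>x\<bar>^2 \<le> (2 * \<bar>t - x\<bar>)^2" by (rule power_mono) auto
      then have x2: "x^2 \<le> 4 * (t - x)^2" by (simp add: power_mult_distrib)
      have "L^2 \<le> \<bar>t - x\<bar>^2" using L_pos tx(2) by (intro power_mono) auto
      then have "1 \<le> (t - x)^2 / L^2" using L_pos by simp
      then have "1 + x^2 \<le> (4 + 1 / L^2) * (t - x)^2" using x2 by (simp add: distrib_right)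
      also have "\<dots> \<le> (4 + 1 / L^2) * (a^2 + (t - x)^2)" using L_pos by (intro mult_left_mono) auto
      finally have le: "1 + x^2 \<le> (4 + 1 / L^2) * (a^2 + (t - x)^2)" .
      have w: "a^2 + (t - x)^2 > 0" using a by (simp add: add_pos_nonneg)
      have "poisson a (t - x) \<le> 1 / (a^2 + (t - x)^2)" unfolding poisson_def using a w by (intro divide_right_mono) auto
      also have "\<dots> \<le> (4 + 1 / L^2) * (1 / (1 + x^2))" using le w p by (simp add: divide_simps mult.commute)
      finally show "\<bar>poisson a (t - x)\<bar> \<le> (4 + 1 / L^2) * (1 / (1 + x^2))" using poisson_nonneg[of a] a by simp
    qed measurable
    moreover have "0 \<le> (pi * M) * (1 + 4 * L^2) * (1 / (1 + x^2))" using M_pos p by (simp add: add_nonneg_nonneg)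
    ultimately show ?thesis using a
      by (simp only: Im_cauchy_transform distrib_right mult.assoc mult.commute[of "poisson _ _"])
  qed
qed

end

text \<open>
  The value \<open>\<infinity>\<close> at \<open>p = 0\<close> absorbs the junk value \<open>ln 0 = 0\<close> in \<open>log_gap_ineq\<close> and does not change the
  integral over \<open>p\<close>.
\<close>
definition log_gap :: "real \<Rightarrow> real \<Rightarrow> ennreal" where
  "log_gap p h = (if p = 0 then \<infinity> else ennreal (ln (1 + h^2 / p^2) / 2))"

lemma borel_measurable_log_gap [measurable]:
  assumes [measurable]: "p \<in> borel_measurable N" "h \<in> borel_measurable N"
  shows "(\<lambda>x. log_gap (p x) (h x)) \<in> borel_measurable N"
  unfolding log_gap_def by measurable

lemma ln_cmod_Complex: "Complex p h \<noteq> 0 \<Longrightarrow> ln (cmod (Complex p h)) = ln (p^2 + h^2) / 2"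
proof -
  assume "Complex p h \<noteq> 0"
  then have "p^2 + h^2 > 0" by (auto simp: complex_eq_iff sum_power2_gt_zero_iff)
  then show ?thesis by (simp add: cmod_def ln_sqrt)
qed

lemma log_gap_eq:
  assumes "p \<noteq> 0" shows "log_gap p h = ennreal (ln (cmod (Complex p h)) - ln \<bar>p\<bar>)"
proof -
  have p2: "p^2 > 0" using assms by simp
  have "1 + h^2 / p^2 = (p^2 + h^2) / p^2" using p2 by (simp add: add_divide_distrib)
  moreover have "ln ((p^2 + h^2) / p^2) = ln (p^2 + h^2) - ln (p^2)"
    using p2 add_pos_nonneg[of "p^2" "h^2"] by (simp add: ln_div)
  moreover have "ln (p^2) = 2 * ln \<bar>p\<bar>"
  proof -
    have "ln (\<bar>p\<bar>^2) = real 2 * ln \<bar>p\<bar>" by (rule ln_realpow)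
    then show ?thesis by simp
  qed
  moreover have "Complex p h \<noteq> 0" using assms by (simp add: complex_eq_iff)
  ultimately show ?thesis using assms
    by (simp add: log_gap_def diff_divide_distrib ln_cmod_Complex)
qed

text \<open>The asymptotics for the zero \<open>c - i h\<close> against the real pole
  \<open>c\<close>: with one root each the divergent terms cancel, and \<open>pi * (|h| - 0)\<close>
  remains.\<close>

lemma nn_integral_log_gap: "(\<integral>\<^sup>+s. log_gap (s - c) h \<partial>lborel) = ennreal (pi * \<bar>h\<bar>)"
proof -
  let ?f = "\<lambda>s. ln (1 + h^2 / (s - c)^2) / 2"
  let ?A = "{#Complex c (- h)#}" and ?B = "{#complex_of_real c#}"
  define J where "J A R = (\<Sum>z\<in>#A. log_prim z R - log_prim z (-R))" for A R
  have f0: "?f s \<ge> 0" for s by (intro divide_nonneg_nonneg ln_ge_zero) auto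
  have fI: "(?f has_integral (J ?A R - J ?B R)) {-R..R}" if "0 < R" for R
  proof (rule has_integral_spike_finite[where S="{c}"])
    show "((\<lambda>x. (\<Sum>z\<in>#?A. ln (cmod (of_real x - z))) - (\<Sum>z\<in>#?B. ln (cmod (of_real x - z)))) has_integral (J ?A R - J ?B R)) {-R..R}"
      unfolding J_def using that by (intro has_integral_diff log_mset_has_integral) auto
    fix s assume s: "s \<in> {-R..R} - {c}"
    have "complex_of_real s - Complex c (- h) = Complex (s - c) h" by (simp add: complex_eq_iff)
    moreover have "cmod (complex_of_real s - of_real c) = \<bar>s - c\<bar>" by (simp only: of_real_diff[symmetric] norm_of_real)
    moreover have "ennreal (?f s) = ennreal (ln (cmod (Complex (s - c) h)) - ln \<bar>s - c\<bar>)"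
      using log_gap_eq[of "s - c" h] s by (simp add: log_gap_def)
    moreover have "ln \<bar>s - c\<bar> \<le> ln (cmod (Complex (s - c) h))"
      using s abs_Re_le_cmod[of "Complex (s - c) h"] by (intro ln_mono) auto
    ultimately show "?f s = (\<Sum>z\<in>#?A. ln (cmod (of_real s - z))) - (\<Sum>z\<in>#?B. ln (cmod (of_real s - z)))"
      using f0[of s] by simp
  qed auto
  have "((\<lambda>R. J ?A R - J ?B R) \<longlongrightarrow> pi * (\<Sum>z\<in>#?A. \<bar>Im z\<bar>) - pi * (\<Sum>z\<in>#?B. \<bar>Im z\<bar>)) at_top"
    using tendsto_diff[OF log_mset_asymp[of ?A] log_mset_asymp[of ?B]] by (simp add: J_def algebra_simps)
  then have lim: "((\<lambda>R. J ?A R - J ?B R) \<longlongrightarrow> pi * \<bar>h\<bar>) at_top" by simp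
  have "(\<integral>\<^sup>+s. log_gap (s - c) h \<partial>lborel) = (\<integral>\<^sup>+s. ennreal (?f s) \<partial>lborel)"
  proof (rule nn_integral_cong_AE)
    show "AE s in lborel. log_gap (s - c) h = ennreal (?f s)"
      using AE_lborel_singleton[of c] by eventually_elim (simp add: log_gap_def)
  qed
  also have "\<dots> = ennreal (pi * \<bar>h\<bar>)"
    by (rule nn_integral_exhaustion_interval[OF _ f0 fI lim]) measurable
  finally show ?thesis .
qed

text \<open>For \<open>z = pi * (h + i g)\<close> one has
  \<open>1 + i z / (pi s) = (p + i h) / s\<close> with \<open>p = s - g\<close>, and for
  \<open>p \<noteq> 0\<close> the gap is exactly the difference between \<open>ln |p + i h|\<close>
  and \<open>ln |p|\<close>. The identity becomes an inequality because \<open>ennreal\<close> cuts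
  off negative values.\<close>

lemma log_gap_ineq:
  fixes z :: complex
  assumes s: "s \<noteq> 0"
  shows "ennreal (D - ln \<bar>1 - (Im z / pi) / s\<bar>)
    \<le> ennreal (D - ln (cmod (1 + \<i> * of_real (1 / (pi * s)) * z))) + log_gap (s - Im z / pi) (Re z / pi)"
proof (cases "s - Im z / pi = 0")
  case False
  define p h where "p = s - Im z / pi" and "h = Re z / pi"
  have p: "p \<noteq> 0" using False by (simp add: p_def)
  have "1 + \<i> * of_real (1 / (pi * s)) * z = Complex p h / of_real s"
    using s by (simp add: complex_eq_iff p_def h_def field_simps Re_divide Im_divide power2_eq_square)
  then have "cmod (1 + \<i> * of_real (1 / (pi * s)) * z) = cmod (Complex p h) / \<bar>s\<bar>"
    by (simp add: norm_divide)
  moreover have pos: "cmod (Complex p h) > 0" using p by (simp add: complex_eq_iff)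
  ultimately have 1: "ln (cmod (1 + \<i> * of_real (1 / (pi * s)) * z)) = ln (cmod (Complex p h)) - ln \<bar>s\<bar>"
    using s by (simp add: ln_div)
  have "\<bar>1 - (Im z / pi) / s\<bar> = \<bar>p\<bar> / \<bar>s\<bar>"
    using s unfolding p_def abs_divide[symmetric] by (simp add: diff_divide_distrib)
  then have 2: "ln \<bar>1 - (Im z / pi) / s\<bar> = ln \<bar>p\<bar> - ln \<bar>s\<bar>" using p s by (simp add: ln_div)
  have ge: "ln \<bar>p\<bar> \<le> ln (cmod (Complex p h))" using p abs_Re_le_cmod[of "Complex p h"] by (intro ln_mono) auto
  have "ennreal (D - ln \<bar>1 - (Im z / pi) / s\<bar>) = ennreal ((D - ln (cmod (1 + \<i> * of_real (1 / (pi * s)) * z))) + (ln (cmod (Complex p h)) - ln \<bar>p\<bar>))"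
    unfolding 1 2 by (simp add: algebra_simps)
  also have "\<dots> \<le> ennreal (D - ln (cmod (1 + \<i> * of_real (1 / (pi * s)) * z))) + ennreal (ln (cmod (Complex p h)) - ln \<bar>p\<bar>)"
  proof -
    have "ennreal (u + v) \<le> ennreal u + ennreal v" if "v \<ge> 0" for u v
    proof (cases "u \<ge> 0")
      case False
      then have "ennreal (u + v) \<le> ennreal v" by (intro ennreal_leI) simp
      then show ?thesis by (simp add: add_increasing)
    qed (use that in simp)
    then show ?thesis using ge by simp
  qed
  finally show ?thesis using log_gap_eq[OF p, of h] by (simp add: p_def h_def)
qed (simp add: log_gap_def)

section \<open>The negative part of the logarithmic integral\<close>

context bounded_support
begin

text \<open>
  Unlike \<open>decay_const a\<close>, this constant does not grow as \<open>a\<close> tends to 0, which Fatou's lemma requires of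
  the majorant; the \<open>a\<close>-dependent one needed for Jensen's inequality cancels.
\<close>
definition uniform_const :: real where
  "uniform_const = ((pi * M) * (1 + 4 * L^2) + 2 * L * M * (4 + 1 / L^2)) / pi"

text \<open>Jensen's inequality at height \<open>a\<close>, shifted by the integral of
  \<open>D\<close> on both sides so that no signed logarithmic integral has to exist.\<close>

lemma log_integral_le:
  assumes a: "0 < a" "a \<le> 1" and g0: "(LBINT t. g t) = 0" and s: "s \<noteq> 0"
  defines "D \<equiv> \<lambda>x. uniform_const / \<bar>s\<bar> * (1 / (1 + x^2))"
  shows "(\<integral>\<^sup>+x. ennreal (D x - ln \<bar>1 - (Im (cauchy_transform a x) / pi) / s\<bar>) \<partial>lborel)
    \<le> ennreal (LBINT x. D x) + (\<integral>\<^sup>+x. log_gap (s - Im (cauchy_transform a x) / pi) (Re (cauchy_transform a x) / pi) \<partial>lborel)"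
proof -
  define r where "r = 1 / (pi * s)"
  define E where "E x = \<bar>r\<bar> * (decay_const a * (1 / (1 + x^2)))" for x :: real
  have cd: "integrable lborel (\<lambda>x::real. 1 / (1 + x^2))" using has_bochner_integral_Cauchy_density by (rule integrable.intros)
  have DI: "integrable lborel D" unfolding D_def by (intro integrable_mult_right cd)
  have EI: "integrable lborel E" unfolding E_def by (intro integrable_mult_right cd)
  have [measurable]: "D \<in> borel_measurable borel" "E \<in> borel_measurable borel"
    using borel_measurable_integrable[OF DI] borel_measurable_integrable[OF EI] by auto
  have uc: "uniform_const \<ge> 0" unfolding uniform_const_def using M_pos L_pos by (simp add: add_nonneg_nonneg)
  have D0: "D x \<ge> 0" for x unfolding D_def using uc by (simp add: add_nonneg_nonneg)
  have dc: "decay_const a \<ge> 0" unfolding decay_const_def using a L_pos M_pos by simp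
  have E0: "E x \<ge> 0" for x unfolding E_def using dc by (simp add: add_nonneg_nonneg)
  let ?G = "\<lambda>x. Im (cauchy_transform a x) / pi" and ?H = "\<lambda>x. Re (cauchy_transform a x) / pi"
  have lnD: "ln \<bar>1 - ?G x / s\<bar> \<le> D x" for x
  proof -
    have "ln \<bar>1 - ?G x / s\<bar> \<le> \<bar>?G x / s\<bar>" using ln_norm_le[of "- (?G x / s)"] by simp
    also have "\<dots> = \<bar>Im (cauchy_transform a x)\<bar> / (pi * \<bar>s\<bar>)" by (simp add: abs_mult)
    also have "\<dots> \<le> ((pi * M) * (1 + 4 * L^2) + 2 * L * M * (4 + 1 / L^2)) * (1 / (1 + x^2)) / (pi * \<bar>s\<bar>)"
      using s by (intro divide_right_mono Im_cauchy_transform_decay a) auto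
    also have "\<dots> = D x" by (simp add: D_def uniform_const_def)
    finally show ?thesis .
  qed
  have "(\<integral>\<^sup>+x. ennreal (D x - ln \<bar>1 - ?G x / s\<bar>) \<partial>lborel) + (\<integral>\<^sup>+x. ennreal (E x) \<partial>lborel)
      = (\<integral>\<^sup>+x. ennreal (D x - ln \<bar>1 - ?G x / s\<bar>) + ennreal (E x) \<partial>lborel)"
    by (rule nn_integral_add[symmetric]) measurable
  also have "\<dots> = (\<integral>\<^sup>+x. ennreal ((D x + E x) - ln \<bar>1 - ?G x / s\<bar>) \<partial>lborel)"
    using lnD E0 by (intro nn_integral_cong) (simp add: ennreal_plus[symmetric] algebra_simps del: ennreal_plus)
  also have "\<dots> \<le> (\<integral>\<^sup>+x. ennreal ((D x + E x) - ln (cmod (1 + \<i> * of_real r * cauchy_transform a x))) + log_gap (s - ?G x) (?H x) \<partial>lborel)"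
    unfolding r_def by (intro nn_integral_mono log_gap_ineq s)
  also have "\<dots> = (\<integral>\<^sup>+x. ennreal ((D x + E x) - ln (cmod (1 + \<i> * of_real r * cauchy_transform a x))) \<partial>lborel) + (\<integral>\<^sup>+x. log_gap (s - ?G x) (?H x) \<partial>lborel)"
    by (rule nn_integral_add) measurable
  also have "(\<integral>\<^sup>+x. ennreal ((D x + E x) - ln (cmod (1 + \<i> * of_real r * cauchy_transform a x))) \<partial>lborel) \<le> ennreal (LBINT x. D x + E x)"
  proof (rule jensen_cauchy_transform[OF a(1) g0])
    show "\<bar>r\<bar> * (decay_const a * (1 / (1 + x^2))) \<le> D x + E x" for x using D0[of x] by (simp add: E_def)
  qed (intro Bochner_Integration.integrable_add DI EI)
  also have "ennreal (LBINT x. D x + E x) = ennreal (LBINT x. D x) + ennreal (LBINT x. E x)"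
    using DI EI D0 E0 by (simp add: integral_nonneg)
  also have "(\<integral>\<^sup>+x. ennreal (E x) \<partial>lborel) = ennreal (LBINT x. E x)"
    using EI E0 by (simp add: nn_integral_eq_integral)
  finally have "ennreal (LBINT x. E x) + (\<integral>\<^sup>+x. ennreal (D x - ln \<bar>1 - ?G x / s\<bar>) \<partial>lborel)
    \<le> ennreal (LBINT x. E x) + (ennreal (LBINT x. D x) + (\<integral>\<^sup>+x. log_gap (s - ?G x) (?H x) \<partial>lborel))"
    by (simp add: add_ac)
  then show ?thesis by (simp add: ennreal_add_left_cancel_le)
qed

text \<open>A finite norm makes \<open>Re (cauchy_transform 1 x)\<close> integrable. Up to a
  quadratically decaying error it is \<open>- I * x / (1 + x^2)\<close>, with \<open>I\<close> the
  integral of \<open>g\<close>, and the absolute integral of \<open>x / (1 + x^2)\<close> diverges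
  logarithmically.\<close>

lemma integral_zero_of_hilbert_integrable:
  assumes "L1_norm (hilbert_transform g) < \<infinity>"
  shows "(LBINT t. g t) = 0"
proof (rule ccontr)
  define I where "I = (LBINT t. g t)"
  assume "(LBINT t. g t) \<noteq> 0"
  then have I: "I \<noteq> 0" by (simp add: I_def)
  have "(\<integral>\<^sup>+x. ennreal \<bar>Re (cauchy_transform 1 x)\<bar> \<partial>lborel) < \<infinity>"
  proof (rule le_less_trans[OF nn_integral_Re_cauchy_transform_le])
    show "ennreal pi * L1_norm (hilbert_transform g) < \<infinity>" using assms by (simp add: ennreal_mult_less_top)
  qed simp
  then have CI: "integrable lborel (\<lambda>x. Re (cauchy_transform 1 x))"
    by (intro integrableI_bounded) auto
  let ?q = "\<lambda>x::real. x / (1 + x^2)"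
  have b: "\<bar>I * ?q x\<bar> \<le> \<bar>Re (cauchy_transform 1 x)\<bar> + decay_const 1 * (1 / (1 + x^2))" for x
  proof -
    have "norm (cauchy_transform 1 x - of_real I * cauchy_kernel 1 (- x)) \<le> decay_const 1 * (1 / (1 + x^2))"
      using perturbed_transform_decay[of 1 "\<lambda>t. t" x] by (simp add: cauchy_transform_def I_def)
    moreover have "\<bar>Re (cauchy_transform 1 x - of_real I * cauchy_kernel 1 (- x))\<bar> \<le> norm (cauchy_transform 1 x - of_real I * cauchy_kernel 1 (- x))"
      by (rule abs_Re_le_cmod)
    moreover have "Re (cauchy_transform 1 x - of_real I * cauchy_kernel 1 (- x)) = Re (cauchy_transform 1 x) + I * ?q x"
      by (simp add: cauchy_kernel_Re_Im)
    ultimately show ?thesis by linarith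
  qed
  have QI: "integrable lborel (\<lambda>x. I * ?q x)"
  proof (rule Bochner_Integration.integrable_bound)
    show "integrable lborel (\<lambda>x. \<bar>Re (cauchy_transform 1 x)\<bar> + decay_const 1 * (1 / (1 + x^2)))"
      using CI has_bochner_integral_Cauchy_density[THEN integrable.intros]
      by (intro Bochner_Integration.integrable_add integrable_abs integrable_mult_right) auto
    show "AE x in lborel. norm (I * ?q x) \<le> norm (\<bar>Re (cauchy_transform 1 x)\<bar> + decay_const 1 * (1 / (1 + x^2)))"
      using b by (intro AE_I2) (metis abs_ge_self order_trans real_norm_def)
  qed measurable
  have "integrable lborel (\<lambda>x. (1 / I) * (I * ?q x))" by (rule integrable_mult_right[OF QI])
  moreover have "(1 / I) * (I * q) = q" for q using I by simp
  ultimately have qI: "integrable lborel ?q" by (simp only:)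
  define B where "B = (LBINT x. \<bar>?q x\<bar>)"
  have le: "ln (1 + R^2) / 2 \<le> B" if R: "R > 0" for R
  proof -
    have "(?q has_integral (ln (1 + R^2) / 2 - ln (1 + 0^2) / 2)) {0..R}"
    proof (rule fundamental_theorem_of_calculus)
      fix x :: real
      have p: "1 + x^2 > 0" by (simp add: add_pos_nonneg)
      have "((\<lambda>x. 1 + x^2) has_real_derivative 2 * x) (at x within {0..R})" by (auto intro!: derivative_eq_intros)
      from DERIV_cdivide[OF DERIV_chain2[OF DERIV_ln_divide[OF p] this], of 2]
      have "((\<lambda>x. ln (1 + x^2) / 2) has_real_derivative (1 / (1 + x^2) * (2 * x)) / 2) (at x within {0..R})" .
      moreover have "(1 / W * (2 * U)) / 2 = U / W" for U W :: real by simp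
      ultimately show "((\<lambda>x. ln (1 + x^2) / 2) has_vector_derivative ?q x) (at x within {0..R})"
        by (simp only: has_real_derivative_iff_has_vector_derivative)
    qed (use R in auto)
    then have "ennreal (ln (1 + R^2) / 2) = (\<integral>\<^sup>+x. ennreal (?q x) * indicator {0..R} x \<partial>lborel)"
      using nn_integral_has_integral_lebesgue'[of "{0..R}" ?q "ln (1 + R^2) / 2"] by simp
    also have "\<dots> \<le> (\<integral>\<^sup>+x. ennreal \<bar>?q x\<bar> \<partial>lborel)"
      by (intro nn_integral_mono) (auto split: split_indicator)
    also have "\<dots> = ennreal B" using qI unfolding B_def by (intro nn_integral_eq_integral integrable_abs) auto
    finally have "ennreal (ln (1 + R^2) / 2) \<le> ennreal B" .
    moreover have "B \<ge> 0" unfolding B_def by (intro Bochner_Integration.integral_nonneg) auto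
    ultimately show ?thesis by (simp add: ennreal_le_iff)
  qed
  have "filterlim (\<lambda>R::real. ln (1 + R^2) / 2) at_top at_top" by real_asymp
  then have "eventually (\<lambda>R::real. B < ln (1 + R^2) / 2) at_top" by (simp add: filterlim_at_top_dense)
  then have "eventually (\<lambda>R::real. False) at_top" using eventually_gt_at_top[of 0]
    by eventually_elim (use le in force)
  then show False by simp
qed

text \<open>Fatou's lemma twice: in \<open>x\<close> for fixed \<open>s\<close>, with the majorant
  \<open>D\<close>, to reach \<open>g\<close> itself; then in \<open>s\<close>, where the gaps
  integrate exactly.\<close>

lemma negative_part_log_integral_le:
  "(\<integral>\<^sup>+s. ennreal (- (LBINT x. ln \<bar>1 - g x / s\<bar>)) \<partial>lborel) \<le> ennreal pi * L1_norm (hilbert_transform g)"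
proof (cases "L1_norm (hilbert_transform g) < \<infinity>")
  case False
  then have "L1_norm (hilbert_transform g) = \<infinity>" by (simp add: less_top[symmetric])
  then show ?thesis by (simp add: ennreal_mult_top)
next
  case True
  note g0 = integral_zero_of_hilbert_integrable[OF True]
  define a where "a n = 1 / real (Suc n)" for n
  have a: "0 < a n" "a n \<le> 1" for n by (auto simp: a_def)
  have a0: "filterlim a (at_right 0) sequentially"
  proof -
    have "a \<longlonglongrightarrow> 0" unfolding a_def[abs_def] using LIMSEQ_Suc[OF lim_1_over_n] by simp
    moreover have "a n \<noteq> 0" for n using a(1)[of n] by simp
    ultimately show ?thesis by (simp add: filterlim_at a)
  qed
  let ?G = "\<lambda>n x. Im (cauchy_transform (a n) x) / pi" and ?H = "\<lambda>n x. Re (cauchy_transform (a n) x) / pi"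
  define A where "A n s = (\<integral>\<^sup>+x. log_gap (s - ?G n x) (?H n x) \<partial>lborel)" for n s
  have [measurable]: "A n \<in> borel_measurable borel" for n unfolding A_def by measurable
  have pw: "ennreal (- (LBINT x. ln \<bar>1 - g x / s\<bar>)) \<le> liminf (\<lambda>n. A n s)" for s
  proof (cases "s \<noteq> 0 \<and> integrable lborel (\<lambda>x. ln \<bar>1 - g x / s\<bar>) \<and> (LBINT x. ln \<bar>1 - g x / s\<bar>) < 0")
    case False
    \<comment> \<open>The excluded cases give a nonnegative value: at \<open>s = 0\<close> division
      by 0 turns the integrand into \<open>ln 1\<close>, and the integral of a non-integrable
      function is 0.\<close>
    then have "(LBINT x. ln \<bar>1 - g x / s\<bar>) \<ge> 0"
      by (cases "s = 0") (auto simp: not_integrable_integral_eq not_less)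
    then show ?thesis by (simp add: ennreal_neg)
  next
    case True
    define u where "u = (LBINT x. ln \<bar>1 - g x / s\<bar>)"
    have s: "s \<noteq> 0" and uI: "integrable lborel (\<lambda>x. ln \<bar>1 - g x / s\<bar>)" and u: "u < 0" using True by (auto simp: u_def)
    define D where "D x = uniform_const / \<bar>s\<bar> * (1 / (1 + x^2))" for x :: real
    have DI: "integrable lborel D" unfolding D_def[abs_def]
      using has_bochner_integral_Cauchy_density by (intro integrable_mult_right) (rule integrable.intros)
    have [measurable]: "D \<in> borel_measurable borel" using borel_measurable_integrable[OF DI] by simp
    have uc: "uniform_const \<ge> 0" unfolding uniform_const_def using M_pos L_pos by (simp add: add_nonneg_nonneg)
    have D0: "D x \<ge> 0" for x unfolding D_def using uc by (simp add: add_nonneg_nonneg)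
    have "ennreal ((LBINT x. D x) - u) = ennreal (LBINT x. D x - ln \<bar>1 - g x / s\<bar>)"
      using DI uI by (simp add: u_def)
    also have "\<dots> \<le> (\<integral>\<^sup>+x. ennreal (D x - ln \<bar>1 - g x / s\<bar>) \<partial>lborel)"
    proof -
      have i: "integrable lborel (\<lambda>x. D x - ln \<bar>1 - g x / s\<bar>)" using DI uI by simp
      have "(LBINT x. D x - ln \<bar>1 - g x / s\<bar>) \<le> (LBINT x. max 0 (D x - ln \<bar>1 - g x / s\<bar>))"
        using i by (intro integral_mono integrable_max) auto
      then have "ennreal (LBINT x. D x - ln \<bar>1 - g x / s\<bar>) \<le> ennreal (LBINT x. max 0 (D x - ln \<bar>1 - g x / s\<bar>))"
        by (rule ennreal_leI)
      also have "\<dots> = (\<integral>\<^sup>+x. ennreal (max 0 (D x - ln \<bar>1 - g x / s\<bar>)) \<partial>lborel)"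
        using i by (intro nn_integral_eq_integral[symmetric] integrable_max) auto
      finally show ?thesis by (simp only: ennreal_max_0)
    qed
    also have "\<dots> \<le> (\<integral>\<^sup>+x. liminf (\<lambda>n. ennreal (D x - ln \<bar>1 - ?G n x / s\<bar>)) \<partial>lborel)"
    proof (rule nn_integral_mono_AE)
      show "AE x in lborel. ennreal (D x - ln \<bar>1 - g x / s\<bar>) \<le> liminf (\<lambda>n. ennreal (D x - ln \<bar>1 - ?G n x / s\<bar>))"
        using Im_cauchy_transform_tendsto
      proof eventually_elim
        case (elim x)
        have "(\<lambda>n. Im (cauchy_transform (a n) x)) \<longlonglongrightarrow> pi * g x" by (rule filterlim_compose[OF elim a0])
        then have "(\<lambda>n. ?G n x) \<longlonglongrightarrow> pi * g x / pi" by (intro tendsto_divide tendsto_const) auto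
        then have "(\<lambda>n. \<bar>1 - ?G n x / s\<bar>) \<longlonglongrightarrow> \<bar>1 - g x / s\<bar>"
          using s by (intro tendsto_rabs tendsto_diff tendsto_divide tendsto_const) auto
        then show ?case by (intro ennreal_minus_ln_le_liminf) auto
      qed
    qed
    also have "\<dots> \<le> liminf (\<lambda>n. \<integral>\<^sup>+x. ennreal (D x - ln \<bar>1 - ?G n x / s\<bar>) \<partial>lborel)"
      by (rule nn_integral_liminf) measurable
    also have "\<dots> \<le> liminf (\<lambda>n. ennreal (LBINT x. D x) + A n s)"
      using log_integral_le[OF a g0 s] unfolding A_def D_def[abs_def] by (intro Liminf_mono always_eventually allI)
    also have "\<dots> = ennreal (LBINT x. D x) + liminf (\<lambda>n. A n s)"
      using Liminf_add_const[of sequentially "\<lambda>n. A n s" "ennreal (LBINT x. D x)"] by (simp add: add.commute)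
    finally have "ennreal (LBINT x. D x) + ennreal (- u) \<le> ennreal (LBINT x. D x) + liminf (\<lambda>n. A n s)"
      using u D0 by (subst (asm) diff_conv_add_uminus, subst (asm) ennreal_plus) (auto intro: integral_nonneg)
    then show ?thesis by (simp add: ennreal_add_left_cancel_le u_def)
  qed
  have "(\<integral>\<^sup>+s. ennreal (- (LBINT x. ln \<bar>1 - g x / s\<bar>)) \<partial>lborel) \<le> (\<integral>\<^sup>+s. liminf (\<lambda>n. A n s) \<partial>lborel)"
    by (intro nn_integral_mono pw)
  also have "\<dots> \<le> liminf (\<lambda>n. \<integral>\<^sup>+s. A n s \<partial>lborel)" by (rule nn_integral_liminf) measurable
  also have "\<dots> \<le> liminf (\<lambda>n::nat. ennreal pi * L1_norm (hilbert_transform g))"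
  proof (intro Liminf_mono always_eventually allI)
    \<comment> \<open>Tonelli moves the \<open>s\<close>-integral inside; by
      \<open>nn_integral_log_gap\<close> each \<open>x\<close> contributes
      \<open>pi * |?H n x|\<close>, and the factor \<open>pi\<close> cancels the division in
      \<open>?H\<close>.\<close>
    fix n
    have "(\<integral>\<^sup>+s. A n s \<partial>lborel) = (\<integral>\<^sup>+x. \<integral>\<^sup>+s. log_gap (s - ?G n x) (?H n x) \<partial>lborel \<partial>lborel)"
      unfolding A_def by (rule lborel_pair.Fubini') measurable
    also have "\<dots> = (\<integral>\<^sup>+x. ennreal \<bar>Re (cauchy_transform (a n) x)\<bar> \<partial>lborel)"
      by (simp add: nn_integral_log_gap)
    also have "\<dots> \<le> ennreal pi * L1_norm (hilbert_transform g)" by (rule nn_integral_Re_cauchy_transform_le[OF a(1)])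
    finally show "(\<integral>\<^sup>+s. A n s \<partial>lborel) \<le> ennreal pi * L1_norm (hilbert_transform g)" .
  qed
  also have "\<dots> = ennreal pi * L1_norm (hilbert_transform g)" by (simp add: Liminf_const)
  finally show ?thesis .
qed

end

section \<open>Distribution functions\<close>

text \<open>Signed layer cake kernel: its integral in \<open>t\<close> is \<open>y\<close>, and for
  \<open>y = g x\<close> its integral in \<open>x\<close> is the signed distribution
  function.\<close>

definition layer :: "real \<Rightarrow> real \<Rightarrow> real" where
  "layer y t = (if 0 < t \<and> t < y then 1 else if y < t \<and> t < 0 then - 1 else 0)"

lemma borel_measurable_layer [measurable]:
  assumes [measurable]: "y \<in> borel_measurable N" "t \<in> borel_measurable N"
  shows "(\<lambda>x. layer (y x) (t x)) \<in> borel_measurable N"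
  unfolding layer_def by measurable

definition truncated_inverse :: "real \<Rightarrow> real \<Rightarrow> real" where
  "truncated_inverse e v = (if \<bar>v\<bar> > e then 1 / v else 0)"

lemma borel_measurable_truncated_inverse [measurable]: "truncated_inverse e \<in> borel_measurable borel"
  unfolding truncated_inverse_def by measurable

lemma abs_truncated_inverse_le: "e > 0 \<Longrightarrow> \<bar>truncated_inverse e v\<bar> \<le> 1 / e"
  by (auto simp: truncated_inverse_def frac_le)

text \<open>\<open>ln (max |t - s| e)\<close> is an antiderivative: constant where the kernel is cut
  off, and continuous at the two kinks, which are exempted from differentiability.\<close>

lemma truncated_inverse_integral:
  assumes e: "e > 0" and ab: "a \<le> b"
  shows "integrable lborel (\<lambda>t. indicator {a..b} t * truncated_inverse e (t - s))"
    and "(LBINT t. indicator {a..b} t * truncated_inverse e (t - s)) = ln (max \<bar>b - s\<bar> e) - ln (max \<bar>a - s\<bar> e)"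
proof -
  have "integrable lborel (\<lambda>t. (1 / e) * indicator {a..b} t :: real)"
    by (intro integrable_mult_right integrable_indicator_Icc)
  then show I: "integrable lborel (\<lambda>t. indicator {a..b} t * truncated_inverse e (t - s))"
    by (rule Bochner_Integration.integrable_bound)
      (use abs_truncated_inverse_le[OF e] e in \<open>auto intro!: AE_I2 split: split_indicator\<close>)
  have "((\<lambda>t. truncated_inverse e (t - s)) has_integral (ln (max \<bar>b - s\<bar> e) - ln (max \<bar>a - s\<bar> e))) {a..b}"
  proof (rule fundamental_theorem_of_calculus_interior_strong[where S="{s - e, s + e}"])
    have "max \<bar>t - s\<bar> e \<noteq> 0" for t using e by auto
    then show "continuous_on {a..b} (\<lambda>t. ln (max \<bar>t - s\<bar> e))" by (intro continuous_intros) auto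
    fix t assume t: "t \<in> {a<..<b} - {s - e, s + e}"
    consider "t > s + e" | "t < s - e" | "\<bar>t - s\<bar> < e" using t by force
    then show "((\<lambda>t. ln (max \<bar>t - s\<bar> e)) has_vector_derivative truncated_inverse e (t - s)) (at t)"
    proof cases
      case 1
      have "((\<lambda>t. ln (t - s)) has_real_derivative 1 / (t - s)) (at t)"
        using 1 e by (auto intro!: derivative_eq_intros)
      then have "((\<lambda>t. ln (max \<bar>t - s\<bar> e)) has_real_derivative 1 / (t - s)) (at t)"
        by (rule has_field_derivative_transform_within_open[where S="{s + e<..}"]) (use 1 e in auto)
      then show ?thesis using 1 e by (simp add: truncated_inverse_def has_real_derivative_iff_has_vector_derivative)
    next
      case 2
      have "((\<lambda>t. ln (s - t)) has_real_derivative 1 / (t - s)) (at t)"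
        using 2 e by (auto intro!: derivative_eq_intros simp: divide_simps)
      then have "((\<lambda>t. ln (max \<bar>t - s\<bar> e)) has_real_derivative 1 / (t - s)) (at t)"
        by (rule has_field_derivative_transform_within_open[where S="{..<s - e}"]) (use 2 e in auto)
      then show ?thesis using 2 e by (simp add: truncated_inverse_def has_real_derivative_iff_has_vector_derivative)
    next
      case 3
      have "((\<lambda>t. ln e) has_real_derivative 0) (at t)" by simp
      then have "((\<lambda>t. ln (max \<bar>t - s\<bar> e)) has_real_derivative 0) (at t)"
        by (rule has_field_derivative_transform_within_open[where S="ball s e"]) (use 3 in \<open>auto simp: dist_real_def abs_minus_commute\<close>)
      then show ?thesis using 3 by (simp add: truncated_inverse_def has_real_derivative_iff_has_vector_derivative)
    qed
  qed (use ab in auto)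
  moreover have "set_integrable lborel {a..b} (\<lambda>t. truncated_inverse e (t - s))"
    using I by (simp add: set_integrable_def)
  ultimately show "(LBINT t. indicator {a..b} t * truncated_inverse e (t - s)) = ln (max \<bar>b - s\<bar> e) - ln (max \<bar>a - s\<bar> e)"
    using set_borel_integral_eq_integral(2)[of "{a..b}" "\<lambda>t. truncated_inverse e (t - s)"]
    by (simp add: set_lebesgue_integral_def integral_unique)
qed

text \<open>The condition \<open>e \<le> |s|\<close> keeps the endpoint 0 out of the open truncation
  window, so that it contributes exactly \<open>ln |s|\<close>.\<close>

lemma layer_integral:
  assumes e: "e > 0" "e \<le> \<bar>s\<bar>"
  shows "(LBINT t. layer y t * truncated_inverse e (t - s)) = ln (max \<bar>y - s\<bar> e) - ln \<bar>s\<bar>"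
proof (cases "y \<ge> 0")
  case True
  have "(LBINT t. layer y t * truncated_inverse e (t - s)) = (LBINT t. indicator {0..y} t * truncated_inverse e (t - s))"
  proof (rule integral_cong_AE)
    show "AE t in lborel. layer y t * truncated_inverse e (t - s) = indicator {0..y} t * truncated_inverse e (t - s)"
      using AE_lborel_singleton[of 0] AE_lborel_singleton[of y]
      by eventually_elim (use True in \<open>auto simp: layer_def split: split_indicator\<close>)
  qed measurable
  then show ?thesis using truncated_inverse_integral(2)[OF e(1) True, of s] e by (simp add: max_def)
next
  case False
  have "(LBINT t. layer y t * truncated_inverse e (t - s)) = (LBINT t. - (indicator {y..0} t * truncated_inverse e (t - s)))"
  proof (rule integral_cong_AE)
    show "AE t in lborel. layer y t * truncated_inverse e (t - s) = - (indicator {y..0} t * truncated_inverse e (t - s))"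
      using AE_lborel_singleton[of 0] AE_lborel_singleton[of y]
      by eventually_elim (use False in \<open>auto simp: layer_def split: split_indicator\<close>)
  qed measurable
  then show ?thesis using truncated_inverse_integral(2)[OF e(1), of y 0 s] e False by (simp add: max_def)
qed

text \<open>The majorant \<open>2 * B - ln |v|\<close> has an explicit integral through
  \<open>log_prim 0\<close>: the logarithm is nonpositive for \<open>|v| < 1\<close> and at most
  \<open>B\<close> for the remaining \<open>v\<close>.\<close>

lemma abs_ln_integral_finite:
  "(\<integral>\<^sup>+v. ennreal \<bar>ln \<bar>v\<bar>\<bar> * indicator {-R..R} v \<partial>lborel) < \<infinity>"
proof (cases "R > 0")
  case True
  define B where "B = ln (1 + R)"
  have B: "B \<ge> 0" using True by (simp add: B_def)
  have le: "\<bar>ln \<bar>v\<bar>\<bar> \<le> 2 * B - ln \<bar>v\<bar>" if "v \<in> {-R..R}" for v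
  proof (cases "\<bar>v\<bar> \<ge> 1")
    case True
    then have "ln \<bar>v\<bar> \<le> B" "ln \<bar>v\<bar> \<ge> 0" unfolding B_def using that by (auto intro!: ln_mono)
    then show ?thesis by simp
  next
    case False
    then have "ln \<bar>v\<bar> \<le> 0" by (cases "v = 0") auto
    then show ?thesis using B by simp
  qed
  have "((\<lambda>v. 2 * B - ln (cmod (of_real v - 0))) has_integral (R - (-R)) *\<^sub>R (2 * B) - (log_prim 0 R - log_prim 0 (-R))) {-R..R}"
    using True by (intro has_integral_diff log_prim_has_integral) (auto intro!: has_integral_const_real[THEN has_integral_eq_rhs])
  then have I: "((\<lambda>v. 2 * B - ln \<bar>v\<bar>) has_integral (R - (-R)) *\<^sub>R (2 * B) - (log_prim 0 R - log_prim 0 (-R))) {-R..R}"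
    by simp
  have "(\<integral>\<^sup>+v. ennreal \<bar>ln \<bar>v\<bar>\<bar> * indicator {-R..R} v \<partial>lborel) \<le> (\<integral>\<^sup>+v. ennreal (2 * B - ln \<bar>v\<bar>) * indicator {-R..R} v \<partial>lborel)"
    using le by (intro nn_integral_mono) (auto intro!: ennreal_leI split: split_indicator)
  also have "\<dots> = ennreal ((R - (-R)) *\<^sub>R (2 * B) - (log_prim 0 R - log_prim 0 (-R)))"
    by (rule nn_integral_has_integral_lebesgue'[OF _ I]) (use le in \<open>force intro: order_trans[OF abs_ge_zero]\<close>)
  finally show ?thesis by (auto intro: le_less_trans)
next
  case False
  have "(\<integral>\<^sup>+v. ennreal \<bar>ln \<bar>v\<bar>\<bar> * indicator {-R..R} v \<partial>lborel) = (\<integral>\<^sup>+(v::real). 0 \<partial>lborel)"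
  proof (rule nn_integral_cong_AE)
    show "AE v in lborel. ennreal \<bar>ln \<bar>v\<bar>\<bar> * indicator {-R..R} v = 0"
      using AE_lborel_singleton[of 0] by eventually_elim (use False in \<open>auto split: split_indicator\<close>)
  qed
  then show ?thesis by simp
qed

lemma abs_ln_integral_shift_le:
  assumes "\<bar>y\<bar> \<le> M"
  shows "(\<integral>\<^sup>+s. ennreal \<bar>ln \<bar>y - s\<bar>\<bar> * indicator {-R..R} s \<partial>lborel) \<le> (\<integral>\<^sup>+v. ennreal \<bar>ln \<bar>v\<bar>\<bar> * indicator {-(R+M)..R+M} v \<partial>lborel)"
proof -
  have "(\<integral>\<^sup>+s. ennreal \<bar>ln \<bar>y - s\<bar>\<bar> * indicator {-R..R} s \<partial>lborel)
      = ennreal \<bar>1\<bar> * (\<integral>\<^sup>+v. ennreal \<bar>ln \<bar>y - (y + 1 * v)\<bar>\<bar> * indicator {-R..R} (y + 1 * v) \<partial>lborel)"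
    by (rule nn_integral_real_affine) auto
  also have "\<dots> = (\<integral>\<^sup>+v. ennreal \<bar>ln \<bar>v\<bar>\<bar> * indicator {-R..R} (y + v) \<partial>lborel)" by simp
  also have "\<dots> \<le> (\<integral>\<^sup>+v. ennreal \<bar>ln \<bar>v\<bar>\<bar> * indicator {-(R+M)..R+M} v \<partial>lborel)"
    using assms by (intro nn_integral_mono mult_left_mono) (auto split: split_indicator)
  finally show ?thesis .
qed

text \<open>The left side is the integral of \<open>ln |1 - y/s|\<close> over
  \<open>[-R, R]\<close>. With \<open>ln (1 + q) <= q\<close> at \<open>q = y/R\<close> and
  \<open>q = -y/R\<close>, the terms linear in \<open>y\<close> cancel by symmetry and the quadratic
  one remains.\<close>

lemma log_prim_symmetric_difference_le:
  assumes "\<bar>y\<bar> < R"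
  shows "(log_prim (of_real y) R - log_prim (of_real y) (-R)) - (log_prim 0 R - log_prim 0 (-R)) \<le> 2 * y^2 / R"
proof -
  have R: "R > 0" "R - y > 0" "R + y > 0" using assms by auto
  have sq: "ln (v^2) = 2 * ln \<bar>v\<bar>" for v :: real
  proof -
    have "ln (\<bar>v\<bar>^2) = real 2 * ln \<bar>v\<bar>" by (rule ln_realpow)
    then show ?thesis by simp
  qed
  have lp: "log_prim (of_real c) x = (x - c) * ln \<bar>x - c\<bar> - (x - c)" for c x
    by (simp add: log_prim_def sq)
  have e: "(log_prim (of_real y) R - log_prim (of_real y) (-R)) - (log_prim (of_real 0) R - log_prim (of_real 0) (-R))
     = (R - y) * ln (R - y) + (R + y) * ln (R + y) - 2 * R * ln R"
  proof -
    have "\<bar>R - y\<bar> = R - y" "\<bar>- R - y\<bar> = R + y" "\<bar>R - 0\<bar> = R" "\<bar>- R - 0\<bar> = R" using R by auto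
    then show ?thesis unfolding lp by (simp add: algebra_simps)
  qed
  have "ln (R - y) = ln R + ln (1 - y / R)" "ln (R + y) = ln R + ln (1 + y / R)"
  proof -
    have "R - y = R * (1 - y / R)" "R + y = R * (1 + y / R)" using R by (auto simp: field_simps)
    moreover have "1 - y / R > 0" "1 + y / R > 0" using R by (auto simp: field_simps)
    ultimately show "ln (R - y) = ln R + ln (1 - y / R)" "ln (R + y) = ln R + ln (1 + y / R)"
      using R by (metis ln_mult_pos)+
  qed
  moreover have "ln (1 - y / R) \<le> - (y / R)" "ln (1 + y / R) \<le> y / R"
    using ln_le_minus_one[of "1 - y / R"] ln_le_minus_one[of "1 + y / R"] R by (auto simp: field_simps)
  ultimately have "(R - y) * ln (R - y) \<le> (R - y) * (ln R - y / R)" "(R + y) * ln (R + y) \<le> (R + y) * (ln R + y / R)"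
    using R by (auto intro!: mult_left_mono)
  then have "(R - y) * ln (R - y) + (R + y) * ln (R + y) - 2 * R * ln R \<le> (R - y) * (ln R - y / R) + (R + y) * (ln R + y / R) - 2 * R * ln R"
    by simp
  also have "\<dots> = 2 * y^2 / R" using R by (simp add: field_simps power2_eq_square)
  finally show ?thesis using e by simp
qed

context bounded_support
begin

lemma signed_distribution_eq: "signed_distribution g t = (LBINT x. layer (g x) t)"
proof -
  have [measurable]: "{x. g x > t} \<in> sets borel" "{x. g x < t} \<in> sets borel" by measurable
  consider "t > 0" | "t < 0" | "t = 0" by linarith
  then show ?thesis
  proof cases
    case 1
    then have "(LBINT x. layer (g x) t) = (LBINT x. indicator {x. g x > t} x)"
      by (intro Bochner_Integration.integral_cong) (auto simp: layer_def)
    then show ?thesis using 1 by (simp add: signed_distribution_def)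
  next
    case 2
    then have "(LBINT x. layer (g x) t) = (LBINT x. - indicator {x. g x < t} x)"
      by (intro Bochner_Integration.integral_cong) (auto simp: layer_def)
    then show ?thesis using 2 by (simp add: signed_distribution_def)
  qed (simp add: signed_distribution_def layer_def)
qed

lemma abs_layer_le: "\<bar>layer (g x) t\<bar> \<le> indicator {-L..L} x * indicator {-M..M} t"
proof (cases "\<bar>x\<bar> > L")
  case True
  then show ?thesis using support[of x] by (auto simp: layer_def split: split_indicator)
next
  case False
  then have "x \<in> {-L..L}" by auto
  then have "indicat_real {-L..L} x = 1" by simp
  moreover have "-M \<le> g x" "g x \<le> M" using bound[of x] by (auto simp: abs_le_iff)
  ultimately show ?thesis using M_pos by (auto simp: layer_def split: split_indicator)
qed

text \<open>Height and support exchange roles: the length \<open>2 * L\<close> bounds the values,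
  and the bound \<open>M\<close> of \<open>g\<close> confines the support. This makes the step from
  \<open>N_g\<close> to \<open>g_d\<close> an instance of the step from \<open>g\<close> to
  \<open>N_g\<close>.\<close>

lemma bounded_support_signed_distribution: "bounded_support (signed_distribution g) (2 * L) M"
proof
  show "signed_distribution g \<in> borel_measurable borel"
    unfolding signed_distribution_eq[abs_def] by measurable
  have b: "\<bar>signed_distribution g t\<bar> \<le> 2 * L * indicator {-M..M} t" for t
  proof -
    have i: "integrable lborel (\<lambda>x. indicator {-L..L} x * indicator {-M..M} t :: real)"
      by (intro integrable_mult_left integrable_indicator_Icc)
    then have "integrable lborel (\<lambda>x. layer (g x) t)"
      by (rule Bochner_Integration.integrable_bound) (auto intro!: AE_I2 order_trans[OF abs_layer_le])
    then have "norm (LBINT x. layer (g x) t) \<le> (LBINT x. indicator {-L..L} x * indicator {-M..M} t)"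
      using i abs_layer_le by (intro Bochner_Integration.integral_norm_bound_integral) auto
    also have "\<dots> = 2 * L * indicator {-M..M} t" using L_pos by simp
    finally show ?thesis by (simp add: signed_distribution_eq)
  qed
  show "\<bar>signed_distribution g t\<bar> \<le> 2 * L" for t
    using b[of t] L_pos by (auto split: split_indicator_asm)
  show "signed_distribution g t = 0" if "\<bar>t\<bar> > M" for t
    using b[of t] that by (auto split: split_indicator_asm)
qed (use M_pos L_pos in auto)

text \<open>Layer cake and Fubini. The truncation keeps the kernel bounded, so absolute
  integrability is immediate and the singularity is met only in the limit of
  \<open>e\<close>.\<close>

lemma truncated_distribution_integral:
  assumes e: "e > 0" "e \<le> \<bar>s\<bar>"
  shows "(LINT t:{t. \<bar>t - s\<bar> > e}|lebesgue. signed_distribution g t / (t - s))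
    = (LBINT x. ln (max \<bar>g x - s\<bar> e) - ln \<bar>s\<bar>)"
proof -
  interpret N: bounded_support "signed_distribution g" "2 * L" M by (rule bounded_support_signed_distribution)
  let ?f = "\<lambda>x t. layer (g x) t * truncated_inverse e (t - s)"
  have "(LINT t:{t. \<bar>t - s\<bar> > e}|lebesgue. signed_distribution g t / (t - s))
      = (\<integral>t. signed_distribution g t * truncated_inverse e (t - s) \<partial>lebesgue)"
    unfolding set_lebesgue_integral_def
    by (intro Bochner_Integration.integral_cong) (auto simp: truncated_inverse_def split: split_indicator)
  also have "\<dots> = (LBINT t. signed_distribution g t * truncated_inverse e (t - s))"
    by (rule integral_completion) measurable
  also have "\<dots> = (LBINT t. LBINT x. ?f x t)"
    unfolding signed_distribution_eq by (simp only: integral_mult_left_zero)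
  also have "\<dots> = (LBINT x. LBINT t. ?f x t)"
  proof (rule lborel_pair.Fubini_integral, rule Bochner_Integration.integrable_bound)
    show "integrable (lborel \<Otimes>\<^sub>M lborel) (\<lambda>(x, t). indicat_real {-L..L} x * ((1 / e) * indicat_real {-M..M} t))"
      by (intro integrable_pair_mult integrable_mult_right integrable_indicator_Icc)
    have "\<bar>?f x t\<bar> \<le> indicator {-L..L} x * ((1 / e) * indicator {-M..M} t)" for x t
    proof -
      have "\<bar>?f x t\<bar> \<le> (indicator {-L..L} x * indicator {-M..M} t) * (1 / e)"
        unfolding abs_mult using abs_layer_le abs_truncated_inverse_le[OF e(1)] by (intro mult_mono) auto
      then show ?thesis by (simp add: mult_ac)
    qed
    then show "AE z in lborel \<Otimes>\<^sub>M lborel. norm (case_prod ?f z) \<le> norm (case z of (x, t) \<Rightarrow> indicat_real {-L..L} x * ((1 / e) * indicat_real {-M..M} t))"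
      by (intro AE_I2) (metis (mono_tags, lifting) abs_ge_self case_prod_conv order_trans real_norm_def surj_pair)
  qed measurable
  also have "\<dots> = (LBINT x. ln (max \<bar>g x - s\<bar> e) - ln \<bar>s\<bar>)"
    by (simp add: layer_integral[OF e])
  finally show ?thesis .
qed

lemma abs_log_kernel_le: "\<bar>ln \<bar>1 - g x / s\<bar>\<bar> \<le> indicator {-L..L} x * (\<bar>ln \<bar>g x - s\<bar>\<bar> + \<bar>ln \<bar>s\<bar>\<bar>)"
proof (cases "s = 0 \<or> g x = s \<or> g x = 0")
  case False
  have "\<bar>1 - g x / s\<bar> = \<bar>g x - s\<bar> / \<bar>s\<bar>" using False unfolding abs_divide[symmetric] by (simp add: diff_divide_distrib abs_minus_commute)
  then have "ln \<bar>1 - g x / s\<bar> = ln \<bar>g x - s\<bar> - ln \<bar>s\<bar>" using False by (simp add: ln_div)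
  moreover have "\<bar>x\<bar> \<le> L" using False support[of x] by (meson not_less)
  then have "x \<in> {-L..L}" by (simp add: abs_le_iff)
  ultimately show ?thesis by (simp add: abs_triangle_ineq4)
qed (auto split: split_indicator)

text \<open>For a single \<open>s\<close> the level set may have positive measure and the logarithm
  may fail to be integrable. Tonelli excludes both almost everywhere: for fixed \<open>x\<close> the
  point \<open>s = g x\<close> is null, and \<open>ln |g x - s|\<close> is integrable over bounded
  intervals of \<open>s\<close>, uniformly in \<open>x\<close>.\<close>

lemma AE_log_integrable:
  "AE s in lborel. s \<noteq> 0 \<and> (AE x in lborel. g x \<noteq> s) \<and> integrable lborel (\<lambda>x. indicator {-L..L} x * \<bar>ln \<bar>g x - s\<bar>\<bar>)"
proof -
  have 0: "(\<integral>\<^sup>+s. (if g x = s then 1 else 0 :: ennreal) \<partial>lborel) = 0" for x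
  proof -
    have "(\<integral>\<^sup>+s. (if g x = s then 1 else 0 :: ennreal) \<partial>lborel) = (\<integral>\<^sup>+(s::real). 0 \<partial>lborel)"
    proof (rule nn_integral_cong_AE)
      show "AE s in lborel. (if g x = s then 1 else 0 :: ennreal) = 0"
        using AE_lborel_singleton[of "g x"] by eventually_elim auto
    qed
    then show ?thesis by simp
  qed
  have "(\<integral>\<^sup>+s. \<integral>\<^sup>+x. (if g x = s then 1 else 0 :: ennreal) \<partial>lborel \<partial>lborel)
    = (\<integral>\<^sup>+x. \<integral>\<^sup>+s. (if g x = s then 1 else 0 :: ennreal) \<partial>lborel \<partial>lborel)"
    by (rule lborel_pair.Fubini') measurable
  also have "\<dots> = 0" unfolding 0 by simp
  finally have "AE s in lborel. (\<integral>\<^sup>+x. (if g x = s then 1 else 0 :: ennreal) \<partial>lborel) = 0"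
    by (subst (asm) nn_integral_0_iff_AE) measurable
  then have 1: "AE s in lborel. AE x in lborel. g x \<noteq> s"
  proof eventually_elim
    case (elim s)
    then have "AE x in lborel. (if g x = s then 1 else 0 :: ennreal) = 0"
      by (subst (asm) nn_integral_0_iff_AE) measurable
    then show ?case by eventually_elim (auto split: if_splits)
  qed
  have "AE s in lborel. s \<in> {-real n..real n} \<longrightarrow> integrable lborel (\<lambda>x. indicator {-L..L} x * \<bar>ln \<bar>g x - s\<bar>\<bar>)" for n :: nat
  proof -
    let ?R = "real n"
    let ?C = "\<integral>\<^sup>+v. ennreal \<bar>ln \<bar>v\<bar>\<bar> * indicator {-(?R+M)..?R+M} v \<partial>lborel"
    have "(\<integral>\<^sup>+s. \<integral>\<^sup>+x. indicator {-L..L} x * (ennreal \<bar>ln \<bar>g x - s\<bar>\<bar> * indicator {-?R..?R} s) \<partial>lborel \<partial>lborel)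
      = (\<integral>\<^sup>+x. \<integral>\<^sup>+s. indicator {-L..L} x * (ennreal \<bar>ln \<bar>g x - s\<bar>\<bar> * indicator {-?R..?R} s) \<partial>lborel \<partial>lborel)"
      by (rule lborel_pair.Fubini') measurable
    also have "\<dots> = (\<integral>\<^sup>+x. indicator {-L..L} x * (\<integral>\<^sup>+s. ennreal \<bar>ln \<bar>g x - s\<bar>\<bar> * indicator {-?R..?R} s \<partial>lborel) \<partial>lborel)"
      by (intro nn_integral_cong nn_integral_cmult) measurable
    also have "\<dots> \<le> (\<integral>\<^sup>+x. indicator {-L..L} x * ?C \<partial>lborel)"
      by (intro nn_integral_mono mult_left_mono abs_ln_integral_shift_le bound) auto
    also have "\<dots> = ennreal (2 * L) * ?C"
      using L_pos by (simp add: nn_integral_multc)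
    also have "\<dots> < \<infinity>" using abs_ln_integral_finite[of "?R + M"] by (simp add: ennreal_mult_less_top)
    finally have "AE s in lborel. (\<integral>\<^sup>+x. indicator {-L..L} x * (ennreal \<bar>ln \<bar>g x - s\<bar>\<bar> * indicator {-?R..?R} s) \<partial>lborel) \<noteq> \<infinity>"
      by (intro nn_integral_noteq_infinite) auto
    then show ?thesis
    proof eventually_elim
      case (elim s)
      show ?case
      proof (intro impI integrableI_bounded)
        assume s: "s \<in> {-?R..?R}"
        have "(\<integral>\<^sup>+x. ennreal (norm (indicator {-L..L} x * \<bar>ln \<bar>g x - s\<bar>\<bar>)) \<partial>lborel)
          = (\<integral>\<^sup>+x. indicator {-L..L} x * (ennreal \<bar>ln \<bar>g x - s\<bar>\<bar> * indicator {-?R..?R} s) \<partial>lborel)"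
          using s by (intro nn_integral_cong) (auto split: split_indicator)
        then show "(\<integral>\<^sup>+x. ennreal (norm (indicator {-L..L} x * \<bar>ln \<bar>g x - s\<bar>\<bar>)) \<partial>lborel) < \<infinity>"
          using elim by (simp add: less_top[symmetric])
      qed measurable
    qed
  qed
  then have "AE s in lborel. \<forall>n::nat. s \<in> {-real n..real n} \<longrightarrow> integrable lborel (\<lambda>x. indicator {-L..L} x * \<bar>ln \<bar>g x - s\<bar>\<bar>)"
    unfolding AE_all_countable by blast
  then show ?thesis using 1 AE_lborel_singleton[of 0]
  proof eventually_elim
    case (elim s)
    obtain n :: nat where "\<bar>s\<bar> \<le> real n" using real_arch_simple by blast
    then have "s \<in> {-real n..real n}" by (simp add: abs_le_iff)
    then show ?case using elim by blast
  qed
qed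

end

section \<open>The logarithmic integral as the Hilbert transform of the distribution
  function\<close>

context bounded_support
begin

definition log_integral :: "real \<Rightarrow> real" where
  "log_integral s = (LBINT x. ln \<bar>1 - g x / s\<bar>)"

lemma borel_measurable_log_integral [measurable]: "log_integral \<in> borel_measurable borel"
  unfolding log_integral_def[abs_def] by measurable

lemma AE_hilbert_signed_distribution:
  "AE s in lborel. hilbert_transform (signed_distribution g) s = log_integral s / pi"
  using AE_log_integrable
proof eventually_elim
  case (elim s)
  then have s: "s \<noteq> 0" and ne: "AE x in lborel. g x \<noteq> s"
    and I: "integrable lborel (\<lambda>x. indicator {-L..L} x * \<bar>ln \<bar>g x - s\<bar>\<bar>)" by auto
  \<comment> \<open>Capping the truncation at \<open>|s|\<close> makes \<open>layer_integral\<close>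
    applicable and the integrand vanish off the support; capping it at 1 gives
    \<open>|ln (max r e)| <= |ln r|\<close> for \<open>r > 0\<close>, hence one majorant for all
    \<open>e\<close>.\<close>
  define e0 where "e0 = min 1 \<bar>s\<bar>"
  have e0: "e0 > 0" "e0 \<le> 1" "e0 \<le> \<bar>s\<bar>" using s by (auto simp: e0_def)
  let ?f = "\<lambda>e x. ln (max \<bar>g x - s\<bar> (min e e0)) - ln \<bar>s\<bar>"
  have "((\<lambda>e. LBINT x. ?f e x) \<longlongrightarrow> log_integral s) (at_right 0)"
    unfolding tendsto_at_iff_sequentially
  proof (intro allI impI)
    fix X :: "nat \<Rightarrow> real" assume X: "\<forall>i. X i \<in> {0<..} - {0}" "X \<longlonglongrightarrow> 0"
    then have X0: "X i > 0" for i by auto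
    have "(\<lambda>n. LBINT x. ?f (X n) x) \<longlonglongrightarrow> log_integral s"
      unfolding log_integral_def
    proof (rule integral_dominated_convergence[where w="\<lambda>x. indicator {-L..L} x * \<bar>ln \<bar>g x - s\<bar>\<bar> + \<bar>ln \<bar>s\<bar>\<bar> * indicator {-L..L} x"])
      show "integrable lborel (\<lambda>x. indicator {-L..L} x * \<bar>ln \<bar>g x - s\<bar>\<bar> + \<bar>ln \<bar>s\<bar>\<bar> * indicator {-L..L} x)"
        by (intro Bochner_Integration.integrable_add I integrable_mult_right integrable_indicator_Icc)
      show "AE x in lborel. (\<lambda>n. ?f (X n) x) \<longlonglongrightarrow> ln \<bar>1 - g x / s\<bar>"
        using ne
      proof eventually_elim
        case (elim x)
        have "\<bar>1 - g x / s\<bar> = \<bar>g x - s\<bar> / \<bar>s\<bar>"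
          using s unfolding abs_divide[symmetric] by (simp add: diff_divide_distrib abs_minus_commute)
        then have l: "ln \<bar>1 - g x / s\<bar> = ln \<bar>g x - s\<bar> - ln \<bar>s\<bar>" using elim s by (simp add: ln_div)
        have "(\<lambda>n. max \<bar>g x - s\<bar> (min (X n) e0)) \<longlonglongrightarrow> max \<bar>g x - s\<bar> (min 0 e0)"
          by (intro tendsto_max tendsto_min tendsto_const X)
        then have "(\<lambda>n. max \<bar>g x - s\<bar> (min (X n) e0)) \<longlonglongrightarrow> \<bar>g x - s\<bar>" using e0 by simp
        then show ?case unfolding l using elim by (intro tendsto_diff tendsto_ln tendsto_const) auto
      qed
      show "AE x in lborel. norm (?f (X n) x) \<le> indicator {-L..L} x * \<bar>ln \<bar>g x - s\<bar>\<bar> + \<bar>ln \<bar>s\<bar>\<bar> * indicator {-L..L} x" for n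
        using ne
      proof eventually_elim
        case (elim x)
        define e where "e = min (X n) e0"
        have e: "e > 0" "e \<le> 1" "e \<le> \<bar>s\<bar>" using X0[of n] e0 by (auto simp: e_def)
        show ?case
        proof (cases "\<bar>x\<bar> > L")
          case True
          then have "g x = 0" by (rule support)
          then have "?f (X n) x = 0" using e(3) unfolding e_def[symmetric] by (simp add: max_def)
          then show ?thesis by simp
        next
          case False
          then have x: "x \<in> {-L..L}" by auto
          have "\<bar>ln (max \<bar>g x - s\<bar> e)\<bar> \<le> \<bar>ln \<bar>g x - s\<bar>\<bar>"
          proof (cases "\<bar>g x - s\<bar> \<ge> e")
            case False
            then have "ln \<bar>g x - s\<bar> \<le> ln e" "ln e \<le> 0" using elim e by (auto intro!: ln_mono)
            then show ?thesis using False by (simp add: max_def)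
          qed (simp add: max_def)
          then show ?thesis using x abs_triangle_ineq4[of "ln (max \<bar>g x - s\<bar> e)" "ln \<bar>s\<bar>"] unfolding e_def by simp
        qed
      qed
    qed measurable
    then show "((\<lambda>e. LBINT x. ?f e x) \<circ> X) \<longlonglongrightarrow> log_integral s" by (simp add: comp_def)
  qed
  moreover have "eventually (\<lambda>e. (LBINT x. ?f e x) = (LINT t:{t. \<bar>t - s\<bar> > e}|lebesgue. signed_distribution g t / (t - s))) (at_right 0)"
  proof -
    have "eventually (\<lambda>e. e < e0) (at_right 0)"
      unfolding eventually_at_right_field using e0 by (intro exI[of _ e0]) auto
    then show ?thesis using eventually_at_right_less[of 0]
    proof eventually_elim
      case (elim e)
      then have "e > 0" "e \<le> \<bar>s\<bar>" "min e e0 = e" using e0 by auto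
      then show ?case using truncated_distribution_integral[of e s] by simp
    qed
  qed
  ultimately have "((\<lambda>e. LINT t:{t. \<bar>t - s\<bar> > e}|lebesgue. signed_distribution g t / (t - s)) \<longlongrightarrow> log_integral s) (at_right 0)"
    by (rule Lim_transform_eventually)
  then have "Lim (at_right 0) (\<lambda>e. LINT t:{t. \<bar>t - s\<bar> > e}|lebesgue. signed_distribution g t / (t - s)) = log_integral s"
    by (intro tendsto_Lim) auto
  then show ?case by (simp add: hilbert_transform_def)
qed

lemma log_kernel_pair_integrable:
  "integrable (lborel \<Otimes>\<^sub>M lborel) (\<lambda>(s, x). indicator {-R..R} s * ln \<bar>1 - g x / s\<bar>)"
proof (rule integrableI_bounded)
  show "(\<lambda>(s, x). indicator {-R..R} s * ln \<bar>1 - g x / s\<bar>) \<in> borel_measurable (lborel \<Otimes>\<^sub>M lborel)" by measurable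
  define C where "C = (\<integral>\<^sup>+v. ennreal \<bar>ln \<bar>v\<bar>\<bar> * indicator {-(R+M)..R+M} v \<partial>lborel)"
  have C: "C < \<infinity>" unfolding C_def by (rule abs_ln_integral_finite)
  have z: "(\<integral>\<^sup>+s. ennreal \<bar>ln \<bar>s\<bar>\<bar> * indicator {-R..R} s \<partial>lborel) \<le> C"
    using abs_ln_integral_shift_le[of 0 M R] M_pos by (simp add: C_def)
  have "(\<integral>\<^sup>+z. ennreal (norm (case z of (s, x) \<Rightarrow> indicator {-R..R} s * ln \<bar>1 - g x / s\<bar>)) \<partial>(lborel \<Otimes>\<^sub>M lborel))
     = (\<integral>\<^sup>+s. \<integral>\<^sup>+x. ennreal \<bar>indicator {-R..R} s * ln \<bar>1 - g x / s\<bar>\<bar> \<partial>lborel \<partial>lborel)"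
    by (subst lborel.nn_integral_fst[symmetric]) (simp_all add: split_beta)
  also have "\<dots> = (\<integral>\<^sup>+x. \<integral>\<^sup>+s. ennreal \<bar>indicator {-R..R} s * ln \<bar>1 - g x / s\<bar>\<bar> \<partial>lborel \<partial>lborel)"
    by (rule lborel_pair.Fubini') measurable
  also have "\<dots> \<le> (\<integral>\<^sup>+x. indicator {-L..L} x * (C + C) \<partial>lborel)"
  proof (rule nn_integral_mono)
    fix x :: real
    have "(\<integral>\<^sup>+s. ennreal \<bar>indicator {-R..R} s * ln \<bar>1 - g x / s\<bar>\<bar> \<partial>lborel)
       \<le> (\<integral>\<^sup>+s. indicator {-L..L} x * (ennreal \<bar>ln \<bar>g x - s\<bar>\<bar> * indicator {-R..R} s + ennreal \<bar>ln \<bar>s\<bar>\<bar> * indicator {-R..R} s) \<partial>lborel)"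
    proof (rule nn_integral_mono)
      fix s
      have le: "\<bar>ln \<bar>1 - g x / s\<bar>\<bar> \<le> indicator {-L..L} x * (\<bar>ln \<bar>g x - s\<bar>\<bar> + \<bar>ln \<bar>s\<bar>\<bar>)"
        by (rule abs_log_kernel_le)
      show "ennreal \<bar>indicator {-R..R} s * ln \<bar>1 - g x / s\<bar>\<bar>
        \<le> indicator {-L..L} x * (ennreal \<bar>ln \<bar>g x - s\<bar>\<bar> * indicator {-R..R} s + ennreal \<bar>ln \<bar>s\<bar>\<bar> * indicator {-R..R} s)"
      proof (cases "s \<in> {-R..R} \<and> x \<in> {-L..L}")
        case True
        then have "ennreal \<bar>ln \<bar>1 - g x / s\<bar>\<bar> \<le> ennreal (\<bar>ln \<bar>g x - s\<bar>\<bar> + \<bar>ln \<bar>s\<bar>\<bar>)"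
          using le by (intro ennreal_leI) simp
        also have "\<dots> = ennreal \<bar>ln \<bar>g x - s\<bar>\<bar> + ennreal \<bar>ln \<bar>s\<bar>\<bar>" by (intro ennreal_plus) auto
        finally have *: "ennreal \<bar>ln \<bar>1 - g x / s\<bar>\<bar> \<le> ennreal \<bar>ln \<bar>g x - s\<bar>\<bar> + ennreal \<bar>ln \<bar>s\<bar>\<bar>" .
        have ind: "indicat_real {-R..R} s = 1" "indicator {-R..R} s = (1 :: ennreal)" "indicator {-L..L} x = (1 :: ennreal)"
          using True by simp_all
        show ?thesis using * by (simp only: ind mult_1_left mult_1_right)
      next
        case False
        have "indicat_real {-R..R} s * ln \<bar>1 - g x / s\<bar> = 0"
        proof (cases "s \<in> {-R..R}")
          case True
          with False have "indicat_real {-L..L} x = 0" by simp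
          then have "ln \<bar>1 - g x / s\<bar> = 0" using le by (simp only: mult_zero_left abs_le_zero_iff)
          then show ?thesis by (simp only: mult_zero_right)
        next
          case False
          then have "indicat_real {-R..R} s = 0" by simp
          then show ?thesis by (simp only: mult_zero_left)
        qed
        then show ?thesis by (simp only: abs_zero ennreal_0 zero_le)
      qed
    qed
    also have "\<dots> = indicator {-L..L} x * ((\<integral>\<^sup>+s. ennreal \<bar>ln \<bar>g x - s\<bar>\<bar> * indicator {-R..R} s \<partial>lborel) + (\<integral>\<^sup>+s. ennreal \<bar>ln \<bar>s\<bar>\<bar> * indicator {-R..R} s \<partial>lborel))"
      by (subst nn_integral_cmult, measurable, subst nn_integral_add, auto)
    also have "\<dots> \<le> indicator {-L..L} x * (C + C)"
      using abs_ln_integral_shift_le[OF bound, of x R] z unfolding C_def[symmetric] by (intro mult_left_mono add_mono) auto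
    finally show "(\<integral>\<^sup>+s. ennreal \<bar>indicator {-R..R} s * ln \<bar>1 - g x / s\<bar>\<bar> \<partial>lborel) \<le> indicator {-L..L} x * (C + C)" .
  qed
  also have "\<dots> = ennreal (2 * L) * (C + C)" using L_pos by (simp add: nn_integral_multc)
  also have "\<dots> < \<infinity>" using C by (simp add: ennreal_mult_less_top)
  finally show "(\<integral>\<^sup>+z. ennreal (norm (case z of (s, x) \<Rightarrow> indicator {-R..R} s * ln \<bar>1 - g x / s\<bar>)) \<partial>(lborel \<Otimes>\<^sub>M lborel)) < \<infinity>" .
qed

text \<open>Integrating in \<open>s\<close> first leaves explicit functions of \<open>g x\<close>;
  \<open>R > M\<close> keeps the singularity \<open>s = g x\<close> inside the interval, as
  \<open>log_prim_symmetric_difference_le\<close> requires.\<close>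

lemma log_integral_interval:
  assumes R: "R > M"
  shows "integrable lborel (\<lambda>s. indicator {-R..R} s * log_integral s)"
    and "(LBINT s. indicator {-R..R} s * log_integral s) \<le> 2 * L * (2 * M^2 / R)"
proof -
  let ?f = "\<lambda>s x. indicator {-R..R} s * ln \<bar>1 - g x / s\<bar>"
  have R0: "R > 0" using R M_pos by simp
  have e: "indicator {-R..R} s * log_integral s = (LBINT x. ?f s x)" for s
    unfolding log_integral_def by (rule integral_mult_right_zero[symmetric])
  note PI = log_kernel_pair_integrable[of R]
  show "integrable lborel (\<lambda>s. indicator {-R..R} s * log_integral s)"
    unfolding e using lborel_pair.integrable_fst'[OF PI] by simp
  have inner: "(LBINT s. ?f s x) \<le> 2 * M^2 / R * indicator {-L..L} x" if i: "integrable lborel (\<lambda>s. ?f s x)" for x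
  proof (cases "\<bar>x\<bar> > L")
    case True
    then have "g x = 0" by (rule support)
    then show ?thesis using True by (auto split: split_indicator)
  next
    case False
    define y where "y = g x"
    have y: "\<bar>y\<bar> < R" "\<bar>y\<bar> \<le> M" using bound[of x] R by (auto simp: y_def)
    have "((\<lambda>s. ln (cmod (of_real s - of_real y)) - ln (cmod (of_real s - 0))) has_integral
       (log_prim (of_real y) R - log_prim (of_real y) (-R)) - (log_prim 0 R - log_prim 0 (-R))) {-R..R}"
      using R0 by (intro has_integral_diff log_prim_has_integral) auto
    then have hi: "((\<lambda>s. ln \<bar>1 - g x / s\<bar>) has_integral
       (log_prim (of_real y) R - log_prim (of_real y) (-R)) - (log_prim 0 R - log_prim 0 (-R))) {-R..R}"
    proof (rule has_integral_spike_finite[rotated 2, where S="{0, y}"])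
      fix s assume s: "s \<in> {-R..R} - {0, y}"
      have "cmod (of_real s - of_real y) = \<bar>y - s\<bar>" by (simp only: of_real_diff[symmetric] norm_of_real abs_minus_commute)
      moreover have "\<bar>1 - g x / s\<bar> = \<bar>y - s\<bar> / \<bar>s\<bar>"
        using s unfolding abs_divide[symmetric] y_def by (simp add: diff_divide_distrib abs_minus_commute)
      ultimately show "ln \<bar>1 - g x / s\<bar> = ln (cmod (of_real s - of_real y)) - ln (cmod (of_real s - 0))"
        using s by (simp add: ln_div)
    qed simp
    have "set_integrable lborel {-R..R} (\<lambda>s. ln \<bar>1 - g x / s\<bar>)" using i by (simp add: set_integrable_def)
    from set_borel_integral_eq_integral(2)[OF this] integral_unique[OF hi]
    have "(LBINT s. ?f s x) = (log_prim (of_real y) R - log_prim (of_real y) (-R)) - (log_prim 0 R - log_prim 0 (-R))"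
      by (simp add: set_lebesgue_integral_def)
    also have "\<dots> \<le> 2 * y^2 / R" by (rule log_prim_symmetric_difference_le[OF y(1)])
    also have "y^2 \<le> M^2" using power_mono[OF y(2), of 2] by simp
    then have "2 * y^2 / R \<le> 2 * M^2 / R" using R0 by (intro divide_right_mono mult_left_mono) auto
    finally have "(LBINT s. ?f s x) \<le> 2 * M^2 / R" .
    moreover have "x \<in> {-L..L}" using False by auto
    ultimately show ?thesis by simp
  qed
  have "(LBINT s. indicator {-R..R} s * log_integral s) = (LBINT x. LBINT s. ?f s x)"
    unfolding e by (rule lborel_pair.Fubini_integral[OF PI, symmetric])
  also have "\<dots> \<le> (LBINT x. 2 * M^2 / R * indicator {-L..L} x)"
  proof (rule integral_mono_AE)
    have PI': "integrable (lborel \<Otimes>\<^sub>M lborel) (\<lambda>(x, s). ?f s x)"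
      using lborel_pair.integrable_product_swap[OF PI] by simp
    show "integrable lborel (\<lambda>x. LBINT s. ?f s x)" using lborel_pair.integrable_fst'[OF PI'] by simp
    show "integrable lborel (\<lambda>x. 2 * M^2 / R * indicat_real {-L..L} x)"
      by (intro integrable_mult_right integrable_indicator_Icc)
    have "AE x in lborel. integrable lborel (\<lambda>s. ?f s x)" using lborel_pair.AE_integrable_fst'[OF PI'] by simp
    then show "AE x in lborel. (LBINT s. ?f s x) \<le> 2 * M^2 / R * indicator {-L..L} x"
      by eventually_elim (rule inner)
  qed
  also have "\<dots> = 2 * L * (2 * M^2 / R)" using L_pos by simp
  finally show "(LBINT s. indicator {-R..R} s * log_integral s) \<le> 2 * L * (2 * M^2 / R)" .
qed

text \<open>\<open>log_integral\<close> is not known to be integrable over the line, so its two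
  parts are compared on bounded intervals, where it is; the surplus \<open>O(1/R)\<close> vanishes
  in the limit. Infinite values are allowed.\<close>

lemma positive_part_le_negative_part:
  "(\<integral>\<^sup>+s. ennreal (log_integral s) \<partial>lborel) \<le> (\<integral>\<^sup>+s. ennreal (- log_integral s) \<partial>lborel)" (is "?P \<le> ?N")
proof -
  let ?I = "\<lambda>n. {- (M + real (Suc n))..M + real (Suc n)}"
  have step: "(\<integral>\<^sup>+s. ennreal (log_integral s) * indicator (?I n) s \<partial>lborel) \<le> ?N + ennreal (2 * L * (2 * M^2 / (M + real (Suc n))))" for n
  proof -
    define R where "R = M + real (Suc n)"
    have R: "R > M" by (simp add: R_def)
    let ?v = "\<lambda>s. indicator {-R..R} s * log_integral s"
    note li = log_integral_interval[OF R]
    have i: "integrable lborel (\<lambda>s. max 0 (?v s))" "integrable lborel (\<lambda>s. max 0 (- ?v s))"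
      using li(1) by (intro integrable_max; simp)+
    have "(LBINT s. max 0 (?v s)) = (LBINT s. max 0 (- ?v s) + ?v s)"
      by (intro Bochner_Integration.integral_cong) auto
    also have "\<dots> = (LBINT s. max 0 (- ?v s)) + (LBINT s. ?v s)"
      using i li(1) by (intro Bochner_Integration.integral_add)
    also have "\<dots> \<le> (LBINT s. max 0 (- ?v s)) + 2 * L * (2 * M^2 / R)" using li(2) by simp
    finally have le: "ennreal (LBINT s. max 0 (?v s)) \<le> ennreal (LBINT s. max 0 (- ?v s)) + ennreal (2 * L * (2 * M^2 / R))"
    proof -
      assume a: "(LBINT s. max 0 (?v s)) \<le> (LBINT s. max 0 (- ?v s)) + 2 * L * (2 * M^2 / R)"
      have "0 \<le> (LBINT s. max 0 (- ?v s))" by (intro Bochner_Integration.integral_nonneg) auto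
      moreover have "0 \<le> 2 * L * (2 * M^2 / R)" using L_pos R M_pos by auto
      ultimately show ?thesis using ennreal_leI[OF a] by (simp only: ennreal_plus)
    qed
    have "(\<integral>\<^sup>+s. ennreal (log_integral s) * indicator {-R..R} s \<partial>lborel) = (\<integral>\<^sup>+s. ennreal (max 0 (?v s)) \<partial>lborel)"
      by (intro nn_integral_cong) (auto simp: ennreal_max_0 split: split_indicator)
    also have "\<dots> = ennreal (LBINT s. max 0 (?v s))" using i(1) by (intro nn_integral_eq_integral) auto
    also note le
    also have "ennreal (LBINT s. max 0 (- ?v s)) = (\<integral>\<^sup>+s. ennreal (max 0 (- ?v s)) \<partial>lborel)"
      using i(2) by (intro nn_integral_eq_integral[symmetric]) auto
    also have "\<dots> \<le> ?N"
      by (intro nn_integral_mono) (auto simp: ennreal_max_0 split: split_indicator)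
    finally show ?thesis unfolding R_def by simp
  qed
  have "(\<lambda>n. \<integral>\<^sup>+s. ennreal (log_integral s) * indicator (?I n) s \<partial>lborel) \<longlonglongrightarrow> ?P"
  proof (rule nn_integral_LIMSEQ)
    show "incseq (\<lambda>n s. ennreal (log_integral s) * indicator (?I n) s)"
      by (auto simp: incseq_def le_fun_def split: split_indicator)
    fix s :: real
    obtain k :: nat where k: "\<bar>s\<bar> \<le> k" using real_arch_simple by blast
    have "eventually (\<lambda>n. ennreal (log_integral s) * indicator (?I n) s = ennreal (log_integral s)) sequentially"
      using k M_pos by (intro eventually_sequentiallyI[of k]) (auto split: split_indicator)
    then show "(\<lambda>n. ennreal (log_integral s) * indicator (?I n) s) \<longlonglongrightarrow> ennreal (log_integral s)" by (rule tendsto_eventually)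
  qed measurable
  moreover have "(\<lambda>n. ?N + ennreal (2 * L * (2 * M^2 / (M + real (Suc n))))) \<longlonglongrightarrow> ?N + ennreal 0"
  proof (intro tendsto_add tendsto_const tendsto_ennrealI)
    show "(\<lambda>n. 2 * L * (2 * M^2 / (M + real (Suc n)))) \<longlonglongrightarrow> 0" by real_asymp
  qed
  ultimately have "?P \<le> ?N + ennreal 0"
    by (rule LIMSEQ_le) (use step in blast)
  then show ?thesis by simp
qed

lemma L1_hilbert_signed_distribution_le:
  "L1_norm (hilbert_transform (signed_distribution g)) \<le> 2 * L1_norm (hilbert_transform g)"
proof -
  have "AE s in lebesgue. hilbert_transform (signed_distribution g) s = log_integral s / pi"
    using AE_hilbert_signed_distribution by (rule AE_completion)
  then have "AE s in lebesgue. ennreal \<bar>hilbert_transform (signed_distribution g) s\<bar> = ennreal (1 / pi) * ennreal \<bar>log_integral s\<bar>"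
    by eventually_elim (simp add: ennreal_mult[symmetric])
  then have "L1_norm (hilbert_transform (signed_distribution g)) = (\<integral>\<^sup>+s. ennreal (1 / pi) * ennreal \<bar>log_integral s\<bar> \<partial>lebesgue)"
    unfolding L1_norm_def by (rule nn_integral_cong_AE)
  also have "\<dots> = (\<integral>\<^sup>+s. ennreal (1 / pi) * ennreal \<bar>log_integral s\<bar> \<partial>lborel)" by (rule nn_integral_completion)
  also have "\<dots> = ennreal (1 / pi) * (\<integral>\<^sup>+s. ennreal \<bar>log_integral s\<bar> \<partial>lborel)" by (rule nn_integral_cmult) measurable
  also have "(\<integral>\<^sup>+s. ennreal \<bar>log_integral s\<bar> \<partial>lborel) = (\<integral>\<^sup>+s. ennreal (log_integral s) + ennreal (- log_integral s) \<partial>lborel)"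
  proof (rule nn_integral_cong)
    fix s show "ennreal \<bar>log_integral s\<bar> = ennreal (log_integral s) + ennreal (- log_integral s)"
      by (cases "log_integral s \<ge> 0") (auto simp: ennreal_neg)
  qed
  also have "\<dots> = (\<integral>\<^sup>+s. ennreal (log_integral s) \<partial>lborel) + (\<integral>\<^sup>+s. ennreal (- log_integral s) \<partial>lborel)"
    by (rule nn_integral_add) measurable
  also have "\<dots> \<le> ennreal pi * L1_norm (hilbert_transform g) + ennreal pi * L1_norm (hilbert_transform g)"
    using positive_part_le_negative_part negative_part_log_integral_le
    unfolding log_integral_def by (intro add_mono) (auto intro: order_trans)
  also have "ennreal (1 / pi) * \<dots> = (ennreal (1 / pi) * ennreal pi) * (L1_norm (hilbert_transform g) + L1_norm (hilbert_transform g))"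
    by (simp only: distrib_left mult.assoc)
  also have "\<dots> = 2 * L1_norm (hilbert_transform g)"
    by (simp add: ennreal_mult[symmetric] mult_2)
  finally show ?thesis by (simp add: mult_left_mono)
qed

end

section \<open>Reduction to a Borel representative\<close>

lemma hilbert_transform_cong_AE:
  assumes "f \<in> borel_measurable lebesgue" "h \<in> borel_measurable lebesgue" "AE x in lebesgue. f x = h x"
  shows "hilbert_transform f = hilbert_transform h"
proof
  fix \<xi>
  have "(LINT t:{t. \<bar>t - \<xi>\<bar> > e}|lebesgue. f t / (t - \<xi>)) = (LINT t:{t. \<bar>t - \<xi>\<bar> > e}|lebesgue. h t / (t - \<xi>))" for e
    unfolding set_lebesgue_integral_def
  proof (rule integral_cong_AE)
    note [measurable] = assms(1,2)
    have [measurable]: "(\<lambda>t. t - \<xi>) \<in> borel_measurable lebesgue" by (rule measurable_completion) measurable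
    have [measurable]: "{t. \<bar>t - \<xi>\<bar> > e} \<in> sets lebesgue" by (rule sets_completionI_sets) measurable
    show "(\<lambda>t. indicator {t. \<bar>t - \<xi>\<bar> > e} t *\<^sub>R (f t / (t - \<xi>))) \<in> borel_measurable lebesgue" by measurable
    show "(\<lambda>t. indicator {t. \<bar>t - \<xi>\<bar> > e} t *\<^sub>R (h t / (t - \<xi>))) \<in> borel_measurable lebesgue" by measurable
    show "AE t in lebesgue. indicator {t. \<bar>t - \<xi>\<bar> > e} t *\<^sub>R (f t / (t - \<xi>)) = indicator {t. \<bar>t - \<xi>\<bar> > e} t *\<^sub>R (h t / (t - \<xi>))"
      using assms(3) by eventually_elim simp
  qed
  then show "hilbert_transform f \<xi> = hilbert_transform h \<xi>" by (simp add: hilbert_transform_def)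
qed

lemma signed_distribution_cong_AE:
  assumes [measurable]: "f \<in> borel_measurable lebesgue" "h \<in> borel_measurable lebesgue" and "AE x in lebesgue. f x = h x"
  shows "signed_distribution f = signed_distribution h"
proof
  fix s
  have sets: "{x. k x > s} \<in> sets lebesgue" "{x. k x < s} \<in> sets lebesgue"
    if "k \<in> borel_measurable lebesgue" for k :: "real \<Rightarrow> real"
    using that borel_measurable_iff_greater[of k lebesgue] borel_measurable_iff_less[of k lebesgue] by simp_all
  have "AE x in lebesgue. x \<in> {x. f x > s} \<longleftrightarrow> x \<in> {x. h x > s}" "AE x in lebesgue. x \<in> {x. f x < s} \<longleftrightarrow> x \<in> {x. h x < s}"
    using assms(3) by (eventually_elim, simp)+
  then have "measure lebesgue {x. f x > s} = measure lebesgue {x. h x > s}" "measure lebesgue {x. f x < s} = measure lebesgue {x. h x < s}"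
    using sets assms(1,2) by (metis measure_eq_AE)+
  then show "signed_distribution f s = signed_distribution h s" by (simp add: signed_distribution_def)
qed

text \<open>A Borel function equal to \<open>g\<close> almost everywhere may violate the bounds on a
  null set. Clipping its values and cutting it off restores them everywhere and changes nothing
  where it agrees with \<open>g\<close>.\<close>

lemma bounded_support_representative:
  fixes g :: "real \<Rightarrow> real"
  assumes g: "g \<in> borel_measurable lebesgue" and b: "bounded (range g)" and c: "compact (closure {x. g x \<noteq> 0})"
  obtains f M L where "bounded_support f M L" "AE x in lebesgue. g x = f x"
proof -
  obtain f0 where f0: "f0 \<in> borel_measurable borel" "AE x in lborel. g x = f0 x"
    using completion_ex_borel_measurable_real[OF g] by auto
  obtain M where M: "M > 0" "\<And>x. \<bar>g x\<bar> \<le> M" using b by (auto simp: bounded_pos)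
  have "bounded {x. g x \<noteq> 0}" by (rule bounded_subset[OF compact_imp_bounded[OF c] closure_subset])
  then obtain L where L: "L > 0" "\<And>x. g x \<noteq> 0 \<Longrightarrow> \<bar>x\<bar> \<le> L" by (auto simp: bounded_pos)
  define f where "f x = indicator {-L..L} x * max (-M) (min M (f0 x))" for x
  show thesis
  proof
    show "bounded_support f M L"
    proof
      show "f \<in> borel_measurable borel" unfolding f_def using f0(1) by measurable
      show "\<bar>f x\<bar> \<le> M" for x using M(1) by (auto simp: f_def split: split_indicator)
      show "f x = 0" if "\<bar>x\<bar> > L" for x using that by (auto simp: f_def split: split_indicator)
    qed (use M L in auto)
    have "AE x in lborel. g x = f x"
      using f0(2)
    proof eventually_elim
      case (elim x)
      have "max (-M) (min M (g x)) = g x" using M(2)[of x] by (auto simp: abs_le_iff)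
      moreover have "x \<in> {-L..L} \<or> g x = 0" using L(2)[of x] by (auto simp: abs_le_iff)
      ultimately show ?case using elim M(1) by (auto simp: f_def split: split_indicator)
    qed
    then show "AE x in lebesgue. g x = f x" by (rule AE_completion)
  qed
qed

theorem theorem1p1:
  fixes g :: "real \<Rightarrow> real"
  assumes "g \<in> borel_measurable lebesgue"
    and "bounded (range g)"
    and "compact (closure {x. g x \<noteq> 0})"
  shows "L1_norm (hilbert_transform (signed_decreasing_rearrangement g))
           \<le> 4 * L1_norm (hilbert_transform g)"
proof -
  obtain f M L where "bounded_support f M L" and ae: "AE x in lebesgue. g x = f x"
    using bounded_support_representative[OF assms] by blast
  interpret F: bounded_support f M L by fact
  interpret N: bounded_support "signed_distribution f" "2 * L" M by (rule F.bounded_support_signed_distribution)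
  have fm: "f \<in> borel_measurable lebesgue" by (rule measurable_completion) (simp add: F.borel)
  have "L1_norm (hilbert_transform (signed_distribution (signed_distribution f))) \<le> 2 * L1_norm (hilbert_transform (signed_distribution f))"
    by (rule N.L1_hilbert_signed_distribution_le)
  also have "\<dots> \<le> 2 * (2 * L1_norm (hilbert_transform f))"
    by (intro mult_left_mono F.L1_hilbert_signed_distribution_le) auto
  also have "\<dots> = 4 * L1_norm (hilbert_transform f)" by (simp add: mult.assoc[symmetric])
  finally show ?thesis
    unfolding signed_decreasing_rearrangement_def
      signed_distribution_cong_AE[OF assms(1) fm ae] hilbert_transform_cong_AE[OF assms(1) fm ae] .
qed

end
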